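(* Let $X$ be a time-frequency shifts invariant Banach space on $\mathbb R^d$ with polynomial weight $v$ and constant $C>0$, so that $\|\pi_z u\|_X\le C\,v(z)\|u\|_X$ for all $u\in X$, $z\in\mathbb R^{2d}$. Let $g,\gamma$ be measurable functions on $\mathbb R^d$ with $\gamma\in L^1(\mathbb R^d)$, $\hat g\in L^1(\mathbb R^d)$ and $(\gamma,g)_{L^2}\ne0$, and let $L\in GL(2d)$ be such that $$\sum_{\kappa\in\mathbb Z^{2d}\setminus\{0\}}v(\mathcal J L^{-T}\kappa)\,|V_g\gamma(\mathcal J L^{-T}\kappa)|<\frac1C\,|(\gamma,g)_{L^2}|.$$ Then the Gabor operator $S^L_{g,\gamma}$ is invertible as an element of $\mathcal L(X)$, and $$\|(S^L_{g,\gamma})^{-1}\|_{\mathcal L(X)}\le\frac{|\det L|}{(1+C)\,|(\gamma,g)_{L^2}|-C\,\sigma_{L,g,\gamma}},$$ where $\sigma_{L,g,\gamma}=\sum_{\kappa\in\mathbb Z^{2d}}v(\mathcal J L^{-T}\kappa)|V_g\gamma(\mathcal J L^{-T}\kappa)|$.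
   Context: $GL(2d)$ is the set of real invertible $2d\times 2d$ matrices, $L^{-T}=(L^{-1})^T$, and $\mathcal J=\begin{pmatrix}0&-I\\ I&0\end{pmatrix}$ with $d\times d$ blocks. $\hat f(\omega)=\int f(x)e^{-2\pi ix\cdot\omega}dx$ (extended to $\mathcal S'$), and $(f,h)_{L^2}=\int f\bar h$. For $z=(x,\omega)\in\mathbb R^{2d}$, $T_xf(t)=f(t-x)$, $M_\omega f(t)=e^{2\pi i\omega\cdot t}f(t)$, $\pi_z f=M_\omega T_xf$. Short-time Fourier transform: $V_g\gamma(x,\omega)=\int_{\mathbb R^d}\gamma(t)e^{-2\pi i\omega\cdot t}\overline{g(t-x)}\,dt$. A polynomial weight is $v(z)=(1+|z|)^s$ for some $s\ge0$. A Banach space $X$ with $\mathcal S(\mathbb R^d)\hookrightarrow X\hookrightarrow\mathcal S'(\mathbb R^d)$ and $\mathcal S(\mathbb R^d)$ dense in $X$ is called time-frequency shifts invariant if for some polynomial weight $v$ and some constant $C>0$, $\|\pi_z u\|_X\le C v(z)\|u\|_X$ for all $u\in X$, $z\in\mathbb R^{2d}$. $\mathcal L(X)$ is the space of bounded linear operators on $X$. The Gabor operator is $S^L_{g,\gamma}u=\sum_{\kappa\in\mathbb Z^{2d}}(u,\pi_{-L\kappa}g)_{L^2}\,\pi_{-L\kappa}\gamma$ for $u\in\mathcal S(\mathbb R^d)$ (series convergent in $\mathcal S'(\mathbb R^d)$), extended from $\mathcal S(\mathbb R^d)$ to a bounded operator on $X$. *)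

theory Defs
  imports "HOL-Analysis.Analysis"
begin

section \<open>Complex Banach spaces and their bounded operators\<close>

text \<open>HOL-Analysis only has real normed spaces, so the complex structure is added here.\<close>

class complex_banach = banach +
  fixes scaleC :: "complex \<Rightarrow> 'a \<Rightarrow> 'a"
  assumes scaleC_add_right: "scaleC c (x + y) = scaleC c x + scaleC c y"
    and scaleC_add_left: "scaleC (b + c) x = scaleC b x + scaleC c x"
    and scaleC_scaleC: "scaleC b (scaleC c x) = scaleC (b * c) x"
    and scaleC_of_real: "scaleC (complex_of_real r) x = r *\<^sub>R x"
    and norm_scaleC: "norm (scaleC c x) = cmod c * norm x"

text \<open>The algebra \<open>\<L>(X)\<close>. The norm of \<open>'x \<Rightarrow>\<^sub>L 'x\<close>, the supremum of \<open>norm (A u) / norm u\<close>,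
  is the same over the real and over the complex scalars.\<close>

definition bounded_ops :: "('x::complex_banach \<Rightarrow>\<^sub>L 'x) set" where
  "bounded_ops = {A. \<forall>c u. blinfun_apply A (scaleC c u) = scaleC c (blinfun_apply A u)}"


section \<open>Schwartz functions and tempered distributions\<close>

definition partial_deriv :: "'n::finite \<Rightarrow> (real^'n \<Rightarrow> complex) \<Rightarrow> real^'n \<Rightarrow> complex" where
  "partial_deriv i f x = frechet_derivative f (at x) (axis i 1)"

text \<open>A multi-index is encoded by a list of coordinate directions; for smooth functions the order
  of the list is irrelevant.\<close>

definition iter_deriv :: "'n::finite list \<Rightarrow> (real^'n \<Rightarrow> complex) \<Rightarrow> real^'n \<Rightarrow> complex" where
  "iter_deriv \<alpha> f = foldr partial_deriv \<alpha> f"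

definition schwartz :: "(real^'n::finite \<Rightarrow> complex) set" where
  "schwartz = {f. (\<forall>\<alpha> x. iter_deriv \<alpha> f differentiable (at x)) \<and>
                  (\<forall>k \<alpha>. bounded (range (\<lambda>x. norm x ^ k *\<^sub>R iter_deriv \<alpha> f x)))}"

definition schwartz_seminorm :: "nat \<Rightarrow> 'n::finite list \<Rightarrow> (real^'n \<Rightarrow> complex) \<Rightarrow> real" where
  "schwartz_seminorm k \<alpha> f = (SUP x. norm x ^ k * cmod (iter_deriv \<alpha> f x))"

definition schwartz_topology :: "(real^'n::finite \<Rightarrow> complex) topology" where
  "schwartz_topology = topology_generated_by
     {{\<phi> \<in> schwartz. schwartz_seminorm k \<alpha> (\<lambda>x. \<phi> x - \<psi> x) < \<epsilon>} | k \<alpha> \<psi> \<epsilon>.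
        \<psi> \<in> schwartz \<and> 0 < \<epsilon>}"

text \<open>Functionals live on all functions and are normalised to be \<open>0\<close> off the Schwartz space, so that
  equality of tempered distributions is equality in HOL. The library's topology on function types is
  that of pointwise convergence, so on tempered distributions it is the weak-* topology.\<close>

type_synonym 'n functional = "(real^'n \<Rightarrow> complex) \<Rightarrow> complex"

definition tempered_distributions :: "('n::finite) functional set" where
  "tempered_distributions = {T.
     (\<forall>\<phi>. \<phi> \<notin> schwartz \<longrightarrow> T \<phi> = 0) \<and>
     (\<forall>\<phi>\<in>schwartz. \<forall>\<psi>\<in>schwartz. \<forall>a b. T (\<lambda>x. a * \<phi> x + b * \<psi> x) = a * T \<phi> + b * T \<psi>) \<and>
     continuous_map schwartz_topology euclidean T}"

text \<open>The pairing of a distribution with a test function is bilinear (no complex conjugate).\<close>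

definition regular_distribution :: "(real^'n::finite \<Rightarrow> complex) \<Rightarrow> 'n functional" where
  "regular_distribution f = (\<lambda>\<phi>. if \<phi> \<in> schwartz then LINT t|lebesgue. f t * \<phi> t else 0)"

definition fourier :: "(real^'n::finite \<Rightarrow> complex) \<Rightarrow> real^'n \<Rightarrow> complex" where
  "fourier f \<omega> = (LINT x|lebesgue. f x * cis (- 2 * pi * (x \<bullet> \<omega>)))"

definition fourier_distribution :: "('n::finite) functional \<Rightarrow> 'n functional" where
  "fourier_distribution T = (\<lambda>\<phi>. if \<phi> \<in> schwartz then T (fourier \<phi>) else 0)"

text \<open>\<open>g\<close> defines a tempered distribution whose Fourier transform is (given by) an integrable
  function. The integrability of \<open>g * \<phi>\<close> has to be demanded because the integral of a
  non-integrable function is \<open>0\<close> by convention.\<close>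

definition fourier_in_L1 :: "(real^'n::finite \<Rightarrow> complex) \<Rightarrow> bool" where
  "fourier_in_L1 g \<longleftrightarrow>
     (\<forall>\<phi>\<in>schwartz. integrable lebesgue (\<lambda>t. g t * \<phi> t)) \<and>
     regular_distribution g \<in> tempered_distributions \<and>
     (\<exists>h. integrable lebesgue h \<and>
          fourier_distribution (regular_distribution g) = regular_distribution h)"


section \<open>Time-frequency analysis\<close>

text \<open>Points \<open>z = (x, \<omega>)\<close> of the phase space \<open>\<real>\<^sup>2\<^sup>d\<close> are vectors over the index type \<open>'n + 'n\<close>.\<close>

definition pos :: "real^('n + 'n) \<Rightarrow> real^'n::finite" where
  "pos z = (\<chi> i. z $ Inl i)"

definition freq :: "real^('n + 'n) \<Rightarrow> real^'n::finite" where
  "freq z = (\<chi> i. z $ Inr i)"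

definition translation :: "real^'n::finite \<Rightarrow> (real^'n \<Rightarrow> complex) \<Rightarrow> real^'n \<Rightarrow> complex" where
  "translation x f = (\<lambda>t. f (t - x))"

definition modulation :: "real^'n::finite \<Rightarrow> (real^'n \<Rightarrow> complex) \<Rightarrow> real^'n \<Rightarrow> complex" where
  "modulation \<omega> f = (\<lambda>t. cis (2 * pi * (\<omega> \<bullet> t)) * f t)"

definition tf_shift :: "real^('n + 'n) \<Rightarrow> (real^'n::finite \<Rightarrow> complex) \<Rightarrow> real^'n \<Rightarrow> complex" where
  "tf_shift z f = modulation (freq z) (translation (pos z) f)"

text \<open>The extension of \<open>\<pi>\<^sub>z = M\<^sub>\<omega> T\<^sub>x\<close> to distributions: its transpose under the bilinear pairing is
  \<open>T\<^sub>-\<^sub>x M\<^sub>\<omega>\<close>.\<close>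

definition tf_shift_distribution ::
    "real^('n + 'n) \<Rightarrow> ('n::finite) functional \<Rightarrow> 'n functional" where
  "tf_shift_distribution z T = (\<lambda>\<phi>. T (translation (- pos z) (modulation (freq z) \<phi>)))"

definition L2_inner :: "(real^'n::finite \<Rightarrow> complex) \<Rightarrow> (real^'n \<Rightarrow> complex) \<Rightarrow> complex" where
  "L2_inner f h = (LINT t|lebesgue. f t * cnj (h t))"

definition STFT ::
    "(real^'n::finite \<Rightarrow> complex) \<Rightarrow> (real^'n \<Rightarrow> complex) \<Rightarrow> real^('n + 'n) \<Rightarrow> complex" where
  "STFT g \<gamma> z = (LINT t|lebesgue. \<gamma> t * cis (- 2 * pi * (freq z \<bullet> t)) * cnj (g (t - pos z)))"

definition polynomial_weight :: "(real^('n::finite + 'n) \<Rightarrow> real) \<Rightarrow> bool" where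
  "polynomial_weight v \<longleftrightarrow> (\<exists>s\<ge>0. \<forall>z. v z = (1 + norm z) powr s)"

definition symplectic_J :: "real^('n::finite + 'n)^('n + 'n)" where
  "symplectic_J = (\<chi> i j. case (i, j) of
       (Inl a, Inr b) \<Rightarrow> if a = b then - 1 else 0
     | (Inr a, Inl b) \<Rightarrow> if a = b then 1 else 0
     | _ \<Rightarrow> 0)"

definition int_vec :: "int^'m::finite \<Rightarrow> real^'m" where
  "int_vec \<kappa> = (\<chi> i. of_int (\<kappa> $ i))"

definition adjoint_lattice_point ::
    "real^('n::finite + 'n)^('n + 'n) \<Rightarrow> int^('n + 'n) \<Rightarrow> real^('n + 'n)" where
  "adjoint_lattice_point L \<kappa> = symplectic_J *v (transpose (matrix_inv L) *v int_vec \<kappa>)"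


section \<open>Banach spaces between \<open>\<S>\<close> and \<open>\<S>'\<close>\<close>

text \<open>The space \<open>X\<close> is a type \<open>'x\<close> with an injection \<open>\<iota>\<close> into the tempered distributions; the inclusion
  of \<open>\<S>\<close> into \<open>X\<close> is then \<open>schwartz_incl \<iota>\<close>.\<close>

definition schwartz_incl ::
    "('x \<Rightarrow> ('n::finite) functional) \<Rightarrow> (real^'n \<Rightarrow> complex) \<Rightarrow> 'x" where
  "schwartz_incl \<iota> \<phi> = inv \<iota> (regular_distribution \<phi>)"

definition banach_between :: "('x::complex_banach \<Rightarrow> ('n::finite) functional) \<Rightarrow> bool" where
  "banach_between \<iota> \<longleftrightarrow>
     range \<iota> \<subseteq> tempered_distributions \<and>
     (\<forall>a b u w \<phi>. \<iota> (scaleC a u + scaleC b w) \<phi> = a * \<iota> u \<phi> + b * \<iota> w \<phi>) \<and>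
     inj \<iota> \<and>
     continuous_on UNIV \<iota> \<and>
     regular_distribution ` schwartz \<subseteq> range \<iota> \<and>
     continuous_map schwartz_topology euclidean (schwartz_incl \<iota>) \<and>
     closure (schwartz_incl \<iota> ` schwartz) = UNIV"

text \<open>That \<open>\<pi>\<^sub>z u\<close> belongs to \<open>X\<close> is part of the inequality.\<close>

definition tf_invariant_with ::
    "('x::complex_banach \<Rightarrow> ('n::finite) functional) \<Rightarrow> (real^('n + 'n) \<Rightarrow> real) \<Rightarrow> real \<Rightarrow> bool" where
  "tf_invariant_with \<iota> v C \<longleftrightarrow>
     banach_between \<iota> \<and> polynomial_weight v \<and> 0 < C \<and>
     (\<forall>z u. \<exists>w. \<iota> w = tf_shift_distribution z (\<iota> u) \<and> norm w \<le> C * v z * norm u)"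


section \<open>The Gabor operator\<close>

text \<open>\<open>A\<close> is a bounded operator on \<open>X\<close> which on \<open>\<S>\<close> is given by the Gabor series, the latter converging
  unconditionally in the weak-* topology.\<close>

definition is_gabor_extension ::
    "('x::complex_banach \<Rightarrow> ('n::finite) functional) \<Rightarrow> real^('n + 'n)^('n + 'n) \<Rightarrow>
     (real^'n \<Rightarrow> complex) \<Rightarrow> (real^'n \<Rightarrow> complex) \<Rightarrow> ('x \<Rightarrow>\<^sub>L 'x) \<Rightarrow> bool" where
  "is_gabor_extension \<iota> L g \<gamma> A \<longleftrightarrow>
     A \<in> bounded_ops \<and>
     (\<forall>u\<in>schwartz. \<forall>\<phi>\<in>schwartz.
        ((\<lambda>\<kappa>. L2_inner u (tf_shift (- (L *v int_vec \<kappa>)) g) *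
              regular_distribution (tf_shift (- (L *v int_vec \<kappa>)) \<gamma>) \<phi>)
         has_sum \<iota> (blinfun_apply A (schwartz_incl \<iota> u)) \<phi>) UNIV)"

definition gabor_operator ::
    "('x::complex_banach \<Rightarrow> ('n::finite) functional) \<Rightarrow> real^('n + 'n)^('n + 'n) \<Rightarrow>
     (real^'n \<Rightarrow> complex) \<Rightarrow> (real^'n \<Rightarrow> complex) \<Rightarrow> 'x \<Rightarrow>\<^sub>L 'x" where
  "gabor_operator \<iota> L g \<gamma> = (THE A. is_gabor_extension \<iota> L g \<gamma> A)"

end

theory Submission
  imports Defs "HOL-Probability.Probability"
begin

text \<open>
The Gabor operator is, up to the factor \<open>1 / \<bar>det L\<bar>\<close>, a superposition of time-frequency shifts over the
adjoint lattice: with \<open>\<lambda>\<^sub>\<kappa> = J L\<^sup>-\<^sup>T \<kappa>\<close>, Janssen's identity (\<open>janssen_representation\<close>) reads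
\<open>S u = (1 / \<bar>det L\<bar>) (\<Sum>\<kappa>. V\<^sub>g \<gamma> (\<lambda>\<^sub>\<kappa>) \<pi>\<^bsub>\<lambda>\<^sub>\<kappa>\<^esub> u)\<close>.
The summand for \<open>\<kappa> = 0\<close> is the multiple \<open>(\<gamma>, g)\<close> of the identity. The shifts are bounded on \<open>X\<close> with norm
at most \<open>C v\<close>, so by hypothesis the remaining summands form an operator whose norm is at most
\<open>C (\<Sum>\<kappa>\<noteq>0. v (\<lambda>\<^sub>\<kappa>) \<bar>V\<^sub>g \<gamma> (\<lambda>\<^sub>\<kappa>)\<bar>) < \<bar>(\<gamma>, g)\<bar>\<close>. Hence \<open>\<bar>det L\<bar> S\<close> is invertible as a small perturbation
of a multiple of the identity (\<open>invertible_small_perturbation\<close>), and the inverse has norm at most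
\<open>1 / (\<bar>(\<gamma>, g)\<bar> - C (\<Sum>\<kappa>\<noteq>0. \<dots>))\<close>. Since \<open>v 0 = 1\<close>, the difference in this denominator is the one in
the statement.

Janssen's identity is a Poisson summation formula. Tested against \<open>\<phi>\<close>, the Gabor series is the sum of
\<open>F z = V\<^sub>g u z \<langle>\<pi>\<^sub>z \<gamma>, \<phi>\<rangle>\<close> over the lattice \<open>L \<int>\<^sup>2\<^sup>d\<close>, and the Fourier transform of \<open>F\<close> at \<open>\<zeta>\<close> is
\<open>V\<^sub>g \<gamma> (- J \<zeta>) \<langle>\<pi>\<^bsub>- J \<zeta>\<^esub> u, \<phi>\<rangle>\<close>, by Fubini and Fourier inversion (\<open>fourier_gabor_symbol\<close>). The formula holds
pointwise for two reasons. On the dual lattice the Fourier transform of \<open>F\<close> is absolutely summable, by the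
assumption on the weighted sum and \<open>v \<ge> 1\<close>. And \<open>F\<close> is continuous with summable suprema over the cells of the lattice
(\<open>gabor_symbol_lattice_bound\<close>): as \<open>g\<close> is the inverse Fourier transform of an integrable \<open>h\<close>, the first factor of \<open>F\<close>
is bounded by a convolution of \<open>\<bar>h\<bar>\<close> with a rapidly decreasing function of the frequency, and as \<open>\<gamma>\<close> is
integrable, the second factor is bounded by a convolution of \<open>\<bar>\<gamma>\<bar>\<close> with a rapidly decreasing function of the position.

The Fourier analysis behind this is built from one fact, that a continuous function on the cube all of whose
Fourier coefficients vanish is zero at the centre (\<open>vanishing_coefficients_imp_zero\<close>). It gives the Poisson
summation formula, and integrating that formula over all modulations gives Fourier inversion for Schwartz
functions. That \<open>g\<close>, whose Fourier transform is only known as a distribution, agrees almost everywhere with the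
inverse Fourier transform of \<open>h\<close> follows by testing against Gaussians (\<open>fourier_in_L1_representation\<close>).
\<close>

section \<open>Lebesgue measure on coordinate space\<close>

lemma Basis_vec_range: "(Basis :: (real^'m::finite) set) = range (\<lambda>i. axis i 1)"
  by (auto simp: Basis_vec_def)

lemma prod_Basis_vec: "(\<Prod>b\<in>(Basis :: (real^'m::finite) set). f b) = (\<Prod>i\<in>UNIV. f (axis i 1))"
proof -
  have "inj (\<lambda>i::'m. axis i (1::real))" by (auto simp: inj_on_def axis_eq_axis)
  then show ?thesis unfolding Basis_vec_range by (simp add: prod.reindex)
qed

lemma measurable_vec_lambda [measurable]:
  "vec_lambda \<in> measurable (\<Pi>\<^sub>M i\<in>(UNIV::'m::finite set). lborel) (borel :: (real^'m) measure)"
  unfolding borel_measurable_euclidean_space[of vec_lambda] Basis_vec_range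
  by (auto simp: inner_axis)

lemma lborel_vec_eq:
  "(lborel :: (real^'m::finite) measure) = distr (\<Pi>\<^sub>M i\<in>UNIV. lborel) borel vec_lambda"
proof (rule lborel_eqI)
  interpret product_sigma_finite "\<lambda>_::'m. lborel :: real measure" by standard
  fix l u :: "real^'m" assume le: "\<And>b. b \<in> Basis \<Longrightarrow> l \<bullet> b \<le> u \<bullet> b"
  have le': "l $ i \<le> u $ i" for i using le[of "axis i 1"] by (simp add: Basis_vec_range inner_axis)
  have "vec_lambda -` box l u \<inter> space (\<Pi>\<^sub>M i\<in>(UNIV::'m set). (lborel::real measure)) = Pi\<^sub>E UNIV (\<lambda>i. {l$i<..<u$i})"
    by (auto simp: space_PiM mem_box_cart PiE_iff)
  then show "emeasure (distr (\<Pi>\<^sub>M i\<in>UNIV. lborel) borel vec_lambda) (box l u)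
      = (\<Prod>b\<in>Basis. (u - l) \<bullet> b)"
    by (simp add: emeasure_distr emeasure_PiM le' prod_ennreal prod_Basis_vec inner_axis)
qed simp

lemma nn_integral_shift:
  fixes a :: "'a::euclidean_space"
  assumes [measurable]: "f \<in> borel_measurable borel"
  shows "(\<integral>\<^sup>+x. f (x + a) \<partial>lborel) = (\<integral>\<^sup>+x. f x \<partial>lborel)"
  by (subst (2) lborel_distr_plus[of a, symmetric]) (simp add: nn_integral_distr add.commute)

text \<open>For fixed values of the other coordinates the shear translates the coordinate \<open>m\<close>, which is integrated first.\<close>

lemma nn_integral_lborel_shear:
  fixes f :: "real^'m::finite \<Rightarrow> ennreal"
  assumes [measurable]: "f \<in> borel_measurable borel" and mn: "m \<noteq> n"
  shows "(\<integral>\<^sup>+x. f (\<chi> i. if i = m then x$m + x$n else x$i) \<partial>lborel) = (\<integral>\<^sup>+x. f x \<partial>lborel)"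
proof -
  interpret product_sigma_finite "\<lambda>_::'m. lborel :: real measure" by standard
  let ?I = "UNIV - {m}"
  have U: "UNIV = insert m ?I" by auto
  have S [measurable]: "(\<lambda>x::real^'m. (\<chi> i. if i = m then x$m + x$n else x$i)) \<in> borel_measurable borel"
    unfolding borel_measurable_euclidean_space[of "\<lambda>x::real^'m. (\<chi> i. if i = m then x$m + x$n else x$i)"] Basis_vec_range
    by (auto simp: inner_axis intro!: borel_measurable_continuous_onI continuous_intros)
  have *: "(\<integral>\<^sup>+x. h x \<partial>lborel) = (\<integral>\<^sup>+x. (\<integral>\<^sup>+y. h (vec_lambda (x(m:=y))) \<partial>lborel) \<partial>(Pi\<^sub>M ?I (\<lambda>_. lborel)))"
    if [measurable]: "h \<in> borel_measurable borel" for h :: "real^'m \<Rightarrow> ennreal"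
  proof -
    have hm: "(\<lambda>x. h (vec_lambda x)) \<in> borel_measurable (Pi\<^sub>M (insert m ?I) (\<lambda>_. lborel))"
      unfolding U[symmetric] by measurable
    have "(\<integral>\<^sup>+x. h x \<partial>lborel) = (\<integral>\<^sup>+x. h (vec_lambda x) \<partial>(Pi\<^sub>M (insert m ?I) (\<lambda>_. lborel)))"
      unfolding U[symmetric] by (subst lborel_vec_eq) (simp add: nn_integral_distr)
    also have "\<dots> = (\<integral>\<^sup>+x. (\<integral>\<^sup>+y. h (vec_lambda (x(m:=y))) \<partial>lborel) \<partial>(Pi\<^sub>M ?I (\<lambda>_. lborel)))"
      by (rule product_nn_integral_insert) (use hm in auto)
    finally show ?thesis .
  qed
  have "(\<integral>\<^sup>+y. f (\<chi> i. if i = m then vec_lambda (x(m:=y)) $ m + vec_lambda (x(m:=y)) $ n else vec_lambda (x(m:=y)) $ i) \<partial>lborel)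
      = (\<integral>\<^sup>+y. f (vec_lambda (x(m:=y))) \<partial>lborel)" for x
  proof -
    have [measurable]: "(\<lambda>y::real. vec_lambda (x(m:=y)) :: real^'m) \<in> borel_measurable borel"
      unfolding borel_measurable_euclidean_space[of "\<lambda>y::real. vec_lambda (x(m:=y))"] Basis_vec_range
      by (auto simp: inner_axis)
    have "(\<chi> i. if i = m then vec_lambda (x(m:=y)) $ m + vec_lambda (x(m:=y)) $ n else vec_lambda (x(m:=y)) $ i)
       = vec_lambda (x(m:=y + x n))" for y
      using mn by (auto simp: vec_eq_iff)
    then show ?thesis using nn_integral_shift[of "\<lambda>y. f (vec_lambda (x(m:=y)))" "x n"] by simp
  qed
  then show ?thesis
    by (subst (1 2) *) simp_all
qed

lemma measurable_matrix_vector_mult [measurable]: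
  fixes A :: "real^'m::finite^'m"
  shows "(\<lambda>x. A *v x) \<in> borel_measurable borel"
  by (intro borel_measurable_continuous_onI matrix_vector_mult_linear_continuous_on)

text \<open>Both sides are multiplicative in \<open>A\<close>, so it is enough to treat the elementary matrices: diagonal matrices,
transpositions of coordinates and shears. The index type is an arbitrary finite type without an order, as it will
be instantiated with the disjoint sum that indexes phase space.\<close>

lemma nn_integral_linear_vec:
  fixes A :: "real^'m::finite^'m"
  assumes "det A \<noteq> 0" "f \<in> borel_measurable borel"
  shows "ennreal \<bar>det A\<bar> * (\<integral>\<^sup>+x. f (A *v x) \<partial>lborel) = (\<integral>\<^sup>+x. f x \<partial>lborel)"
proof -
  have "det A \<noteq> 0 \<longrightarrow> (\<forall>f\<in>borel_measurable borel.
      ennreal \<bar>det A\<bar> * (\<integral>\<^sup>+x. f (A *v x) \<partial>lborel) = (\<integral>\<^sup>+x. f x \<partial>lborel))"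
  proof (induction rule: induct_matrix_elementary_alt[of _ A])
    case (1 A B)
    show ?case
    proof (intro impI ballI)
      fix f :: "real^'m \<Rightarrow> ennreal" assume d: "det (A ** B) \<noteq> 0" and [measurable]: "f \<in> borel_measurable borel"
      have "ennreal \<bar>det (A ** B)\<bar> * (\<integral>\<^sup>+x. f ((A ** B) *v x) \<partial>lborel)
        = ennreal \<bar>det A\<bar> * (ennreal \<bar>det B\<bar> * (\<integral>\<^sup>+x. f (A *v (B *v x)) \<partial>lborel))"
        by (simp add: det_mul abs_mult ennreal_mult matrix_vector_mul_assoc mult.assoc)
      also have "ennreal \<bar>det B\<bar> * (\<integral>\<^sup>+x. f (A *v (B *v x)) \<partial>lborel) = (\<integral>\<^sup>+x. f (A *v x) \<partial>lborel)"
        using 1(2)[THEN mp, THEN bspec, of "\<lambda>y. f (A *v y)"] d by (simp add: det_mul)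
      also have "ennreal \<bar>det A\<bar> * \<dots> = (\<integral>\<^sup>+x. f x \<partial>lborel)"
        using 1(1) d by (simp add: det_mul)
      finally show "ennreal \<bar>det (A ** B)\<bar> * (\<integral>\<^sup>+x. f ((A ** B) *v x) \<partial>lborel) = (\<integral>\<^sup>+x. f x \<partial>lborel)" .
    qed
  next
    case (2 A i)
    then show ?case by (simp add: det_zero_row)
  next
    case (3 A)
    show ?case
    proof (intro impI ballI)
      fix f :: "real^'m \<Rightarrow> ennreal" assume d: "det A \<noteq> 0" and [measurable]: "f \<in> borel_measurable borel"
      have dA: "det A = (\<Prod>i\<in>UNIV. A$i$i)" using 3 by (rule det_diagonal)
      then have nz: "A $ i $ i \<noteq> 0" for i using d by auto
      let ?c = "\<lambda>b::real^'m. b \<bullet> (A *v b)"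
      have c: "?c (axis i 1) = A$i$i" for i
        by (simp add: inner_axis' matrix_vector_mult_basis column_def)
      have Av: "A *v x = 0 + (\<Sum>j\<in>Basis. (?c j * (x \<bullet> j)) *\<^sub>R j)" for x
      proof -
        have "inj (\<lambda>i::'m. axis i (1::real))" by (auto simp: inj_on_def axis_eq_axis)
        then have "(\<Sum>j\<in>Basis. (?c j * (x \<bullet> j)) *\<^sub>R j) = (\<Sum>i\<in>UNIV. (A$i$i * x$i) *\<^sub>R axis i 1)"
          unfolding Basis_vec_range by (simp add: sum.reindex c inner_axis)
        also have "\<dots> = A *v x"
        proof -
          have "(A *v x) $ k = A $ k $ k * x $ k" for k
          proof -
            have "(A *v x) $ k = (\<Sum>j\<in>UNIV. if j = k then A$k$k * x$k else 0)"
              using 3[of k] unfolding matrix_vector_mult_def vec_lambda_beta by (intro sum.cong refl) auto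
            then show ?thesis by simp
          qed
          then show ?thesis by (simp add: vec_eq_iff axis_def if_distrib cong: if_cong)
        qed
        finally show ?thesis by simp
      qed
      have "lborel = density (distr lborel borel (\<lambda>x. A *v x)) (\<lambda>_. (\<Prod>j\<in>(Basis::(real^'m) set). \<bar>?c j\<bar>))"
      proof -
        have "(\<lambda>x. 0 + (\<Sum>j\<in>Basis. (?c j * (x \<bullet> j)) *\<^sub>R j)) = (\<lambda>x. A *v x)"
          by (intro ext Av[symmetric])
        moreover have "b \<in> Basis \<Longrightarrow> ?c b \<noteq> 0" for b by (auto simp: Basis_vec_range c nz)
        ultimately show ?thesis
          using lborel_affine_euclidean[of ?c 0] by simp
      qed
      also have "(\<Prod>j\<in>(Basis::(real^'m) set). \<bar>?c j\<bar>) = \<bar>det A\<bar>"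
        by (simp add: prod_Basis_vec c dA abs_prod)
      finally have "(\<integral>\<^sup>+x. f x \<partial>lborel) = (\<integral>\<^sup>+x. f x \<partial>(density (distr lborel borel (\<lambda>x. A *v x)) (\<lambda>_. \<bar>det A\<bar>)))"
        by simp
      also have "\<dots> = ennreal \<bar>det A\<bar> * (\<integral>\<^sup>+x. f (A *v x) \<partial>lborel)"
        by (simp add: nn_integral_density nn_integral_distr nn_integral_cmult)
      finally show "ennreal \<bar>det A\<bar> * (\<integral>\<^sup>+x. f (A *v x) \<partial>lborel) = (\<integral>\<^sup>+x. f x \<partial>lborel)" by simp
    qed
  next
    case (4 m n)
    let ?A = "(\<chi> i j. mat 1 $ i $ Transposition.transpose m n j) :: real^'m^'m"
    show ?case
    proof (intro impI ballI)
      fix f :: "real^'m \<Rightarrow> ennreal" assume [measurable]: "f \<in> borel_measurable borel"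
      let ?p = "Transposition.transpose m n"
      have d: "\<bar>det ?A\<bar> = 1" using 4
        by (simp add: det_permute_columns[OF permutes_swap_id] sign_swap_id abs_mult)
      have Av: "(?A *v x) = (\<chi> i. x $ ?p i)" for x
      proof -
        have "(?A *v x) $ i = (\<Sum>j\<in>UNIV. if j = ?p i then x $ ?p i else 0)" for i
        proof -
          have "i = ?p j \<longleftrightarrow> j = ?p i" for j by (metis transpose_involutory)
          then show ?thesis unfolding matrix_vector_mult_def mat_def by (simp add: mult_if_delta)
        qed
        then show ?thesis by (simp add: vec_eq_iff)
      qed
      have "lborel = distr lborel borel (\<lambda>x. ?A *v x)"
      proof (rule lborel_eqI)
        fix l u :: "real^'m" assume le: "\<And>b. b \<in> Basis \<Longrightarrow> l \<bullet> b \<le> u \<bullet> b"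
        have le': "l $ i \<le> u $ i" for i using le[of "axis i 1"] by (simp add: Basis_vec_range inner_axis)
        have "(\<lambda>x. ?A *v x) -` box l u = box (?A *v l) (?A *v u)"
          unfolding Av by (auto simp: mem_box_cart) (metis transpose_involutory)+
        then have "emeasure (distr lborel borel (\<lambda>x. ?A *v x)) (box l u) = emeasure lborel (box (?A *v l) (?A *v u))"
          by (simp add: emeasure_distr)
        also have "\<dots> = ennreal (\<Prod>i\<in>UNIV. u $ ?p i - l $ ?p i)"
        proof -
          have "\<forall>b\<in>Basis. (?A *v l) \<bullet> b \<le> (?A *v u) \<bullet> b"
            using le' by (auto simp: Av inner_axis Basis_vec_range)
          then show ?thesis by (simp add: emeasure_lborel_box_eq prod_Basis_vec inner_axis Av)
        qed
        also have "(\<Prod>i\<in>UNIV. u $ ?p i - l $ ?p i) = (\<Prod>i\<in>UNIV. u $ i - l $ i)"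
          using prod.permute[OF permutes_swap_id[of m UNIV n], of "\<lambda>i. u $ i - l $ i"] by (simp add: o_def)
        finally show "emeasure (distr lborel borel (\<lambda>x. ?A *v x)) (box l u) = ennreal (\<Prod>b\<in>Basis. (u - l) \<bullet> b)"
          by (simp add: prod_Basis_vec inner_axis)
      qed simp
      then have "(\<integral>\<^sup>+x. f x \<partial>lborel) = (\<integral>\<^sup>+x. f x \<partial>(distr lborel borel (\<lambda>x. ?A *v x)))" by simp
      then show "ennreal \<bar>det ?A\<bar> * (\<integral>\<^sup>+x. f (?A *v x) \<partial>lborel) = (\<integral>\<^sup>+x. f x \<partial>lborel)"
        by (simp add: d nn_integral_distr)
    qed
  next
    case (5 m n)
    let ?A = "(\<chi> i j. of_bool (i = m \<and> j = n \<or> i = j)) :: real^'m^'m"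
    have e: "?A = (\<chi> k. if k = m then row m (mat 1) + (1::real) *s row n (mat 1) else row k (mat 1))"
      using 5 by (auto simp: vec_eq_iff row_def mat_def)
    have d: "det ?A = 1" unfolding e det_row_operation[OF 5] by (rule det_I)
    have Av: "(?A *v x) = (\<chi> i. if i = m then x$m + x$n else x$i)" for x
    proof -
      have "(?A *v x) $ i = (\<Sum>j\<in>UNIV. (if j = i then x $ i else 0) + (if j = n then if i = m then x$n else 0 else 0))" for i
        unfolding matrix_vector_mult_def using 5 by (auto intro!: sum.cong)
      then show ?thesis by (simp add: vec_eq_iff sum.distrib)
    qed
    show ?case unfolding Av using nn_integral_lborel_shear[OF _ 5] d by simp
  qed
  then show ?thesis using assms by blast
qed

lemma lborel_linear_vec:
  fixes A :: "real^'m::finite^'m"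
  assumes "det A \<noteq> 0"
  shows "lborel = density (distr lborel borel (\<lambda>x. A *v x)) (\<lambda>_. ennreal \<bar>det A\<bar>)"
proof (rule measure_eqI)
  fix X :: "(real^'m) set" assume "X \<in> sets lborel"
  then have X [measurable]: "X \<in> sets borel" by simp
  have "emeasure (density (distr lborel borel (\<lambda>x. A *v x)) (\<lambda>_. ennreal \<bar>det A\<bar>)) X
    = ennreal \<bar>det A\<bar> * (\<integral>\<^sup>+x. indicator X (A *v x) \<partial>lborel)"
    by (subst emeasure_density) (simp_all add: nn_integral_cmult nn_integral_distr del: nn_integral_indicator)
  then show "emeasure lborel X = emeasure (density (distr lborel borel (\<lambda>x. A *v x)) (\<lambda>_. ennreal \<bar>det A\<bar>)) X"
    using nn_integral_linear_vec[OF assms, of "indicator X"] by simp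
qed simp

lemma integral_linear_vec:
  fixes A :: "real^'m::finite^'m" and f :: "real^'m \<Rightarrow> 'b::{banach,second_countable_topology}"
  assumes "det A \<noteq> 0" and [measurable]: "f \<in> borel_measurable borel"
  shows "(\<integral>x. f x \<partial>lborel) = \<bar>det A\<bar> *\<^sub>R (\<integral>x. f (A *v x) \<partial>lborel)"
  by (subst lborel_linear_vec[OF assms(1)]) (simp add: integral_density integral_distr)

lemma integrable_linear_vec_iff:
  fixes A :: "real^'m::finite^'m" and f :: "real^'m \<Rightarrow> 'b::{banach,second_countable_topology}"
  assumes "det A \<noteq> 0" and [measurable]: "f \<in> borel_measurable borel"
  shows "integrable lborel f \<longleftrightarrow> integrable lborel (\<lambda>x. f (A *v x))"
proof -
  have "integrable lborel f \<longleftrightarrow> integrable lborel (\<lambda>x. \<bar>det A\<bar> *\<^sub>R f (A *v x))"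
    by (subst lborel_linear_vec[OF assms(1)]) (simp add: integrable_density integrable_distr_eq)
  also have "\<dots> \<longleftrightarrow> integrable lborel (\<lambda>x. f (A *v x))"
  proof
    assume "integrable lborel (\<lambda>x. \<bar>det A\<bar> *\<^sub>R f (A *v x))"
    then have "integrable lborel (\<lambda>x. inverse \<bar>det A\<bar> *\<^sub>R (\<bar>det A\<bar> *\<^sub>R f (A *v x)))"
      by (rule integrable_scaleR_right)
    then show "integrable lborel (\<lambda>x. f (A *v x))" using assms(1) by simp
  qed simp
  finally show ?thesis .
qed

lemma integral_shift:
  fixes a :: "'a::euclidean_space" and f :: "'a \<Rightarrow> 'b::{banach,second_countable_topology}"
  assumes [measurable]: "f \<in> borel_measurable borel"
  shows "(\<integral>x. f (x + a) \<partial>lborel) = (\<integral>x. f x \<partial>lborel)"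
  by (subst (2) lborel_distr_plus[of a, symmetric]) (simp add: integral_distr add.commute)

lemma integrable_shift_iff:
  fixes a :: "'a::euclidean_space" and f :: "'a \<Rightarrow> 'b::{banach,second_countable_topology}"
  assumes [measurable]: "f \<in> borel_measurable borel"
  shows "integrable lborel (\<lambda>x. f (x + a)) \<longleftrightarrow> integrable lborel f"
  by (subst (2) lborel_distr_plus[of a, symmetric]) (simp add: integrable_distr_eq add.commute)

lemma integrable_shift:
  fixes a :: "'a::euclidean_space" and f :: "'a \<Rightarrow> 'b::{banach,second_countable_topology}"
  assumes f: "integrable lborel f"
  shows "integrable lborel (\<lambda>x. f (x + a))"
  using integrable_shift_iff[of f a] f borel_measurable_integrable[OF f] by simp

section \<open>Phase space as a product\<close>

definition phase :: "real^'n \<Rightarrow> real^'n \<Rightarrow> real^('n::finite + 'n)" where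
  "phase x \<omega> = (\<chi> i. case i of Inl a \<Rightarrow> x $ a | Inr b \<Rightarrow> \<omega> $ b)"

lemma pos_phase [simp]: "pos (phase x \<omega>) = x" and freq_phase [simp]: "freq (phase x \<omega>) = \<omega>"
  by (simp_all add: pos_def freq_def phase_def vec_eq_iff)

lemma phase_nth [simp]: "phase x \<omega> $ Inl a = x $ a" "phase x \<omega> $ Inr a = \<omega> $ a"
  by (simp_all add: phase_def)

lemma phase_eta [simp]: "phase (pos z) (freq z) = z"
  by (simp add: vec_eq_iff phase_def pos_def freq_def split: sum.splits)

lemma sum_UNIV_sum: "(\<Sum>i\<in>(UNIV::('a::finite + 'b::finite) set). f i) = (\<Sum>a\<in>UNIV. f (Inl a)) + (\<Sum>b\<in>UNIV. f (Inr b))"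
  using sum.Plus[of UNIV UNIV f] by simp

lemma prod_UNIV_sum: "(\<Prod>i\<in>(UNIV::('a::finite + 'b::finite) set). f i) = (\<Prod>a\<in>UNIV. f (Inl a)) * (\<Prod>b\<in>UNIV. f (Inr b))"
  using prod.Plus[of UNIV UNIV f] by simp

lemma inner_phase: "phase x \<omega> \<bullet> z = x \<bullet> pos z + \<omega> \<bullet> freq z"
  by (simp add: inner_vec_def sum_UNIV_sum pos_def freq_def)

lemma linear_pos: "linear pos" and linear_freq: "linear freq"
  by (auto intro!: linearI simp: pos_def freq_def vec_eq_iff)

lemma continuous_on_pos [continuous_intros]: "continuous_on A f \<Longrightarrow> continuous_on A (\<lambda>x. pos (f x))"
  and continuous_on_freq [continuous_intros]: "continuous_on A f \<Longrightarrow> continuous_on A (\<lambda>x. freq (f x))"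
  by (rule bounded_linear.continuous_on[OF linear_conv_bounded_linear[THEN iffD1, OF linear_pos]], assumption)
    (rule bounded_linear.continuous_on[OF linear_conv_bounded_linear[THEN iffD1, OF linear_freq]], assumption)

lemma measurable_phase [measurable]:
  "(\<lambda>p. phase (fst p) (snd p)) \<in> borel_measurable (borel :: ((real^'n::finite) \<times> (real^'n)) measure)"
  unfolding borel_measurable_euclidean_space[of "\<lambda>p::(real^'n) \<times> (real^'n). phase (fst p) (snd p)"] Basis_vec_range
  proof clarsimp
  fix i :: "'n + 'n"
  show "(\<lambda>x. phase (fst x) (snd x) \<bullet> axis i 1) \<in> borel_measurable (borel :: ((real^'n) \<times> (real^'n)) measure)"
    by (cases i) (auto simp: inner_axis intro!: borel_measurable_continuous_onI continuous_intros)
qed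

text \<open>Lebesgue measure on phase space as a product, since a box in phase space is a product of a box of positions and a
box of frequencies. Every later use of Fubini's theorem in phase space goes through this splitting.\<close>

lemma lborel_phase:
  "lborel = distr (lborel :: ((real^'n::finite) \<times> (real^'n)) measure) borel (\<lambda>p. phase (fst p) (snd p))"
proof (rule lborel_eqI)
  fix l u :: "real^('n + 'n)" assume le: "\<And>b. b \<in> Basis \<Longrightarrow> l \<bullet> b \<le> u \<bullet> b"
  have le': "l $ i \<le> u $ i" for i using le[of "axis i 1"] by (simp add: Basis_vec_range inner_axis)
  have lep: "\<forall>b\<in>Basis. pos l \<bullet> b \<le> pos u \<bullet> b" "\<forall>b\<in>Basis. freq l \<bullet> b \<le> freq u \<bullet> b"
    using le' by (auto simp: Basis_vec_range inner_axis pos_def freq_def)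
  have eq: "(\<lambda>p. phase (fst p) (snd p)) -` box l u = box (pos l) (pos u) \<times> box (freq l) (freq u)"
    by (auto simp: mem_box_cart pos_def freq_def phase_def split: sum.splits)
  show "emeasure (distr (lborel :: ((real^'n) \<times> (real^'n)) measure) borel (\<lambda>p. phase (fst p) (snd p))) (box l u) = (\<Prod>b\<in>Basis. (u - l) \<bullet> b)"
    using lep
    apply (simp add: emeasure_distr eq)
    apply (subst lborel_prod[symmetric])
    apply (simp add: lborel.emeasure_pair_measure_Times emeasure_lborel_box_eq prod_Basis_vec inner_axis prod_UNIV_sum pos_def freq_def)
    apply (subst ennreal_mult[symmetric])
    apply (auto intro!: prod_nonneg simp: le')
    done
qed simp

lemma integral_phase:
  fixes f :: "real^('n::finite + 'n) \<Rightarrow> 'b::{banach,second_countable_topology}"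
  assumes f: "integrable lborel f"
  shows "(\<integral>z. f z \<partial>lborel) = (\<integral>x. (\<integral>\<omega>. f (phase x \<omega>) \<partial>lborel) \<partial>lborel)"
proof -
  note [measurable] = borel_measurable_integrable[OF f, simplified]
  have fi: "integrable (lborel \<Otimes>\<^sub>M lborel) (\<lambda>p. f (phase (fst p) (snd p)))"
    unfolding lborel_prod using f by (subst (asm) lborel_phase) (simp add: integrable_distr_eq)
  have "(\<integral>z. f z \<partial>lborel) = (\<integral>p. f (phase (fst p) (snd p)) \<partial>lborel)"
    by (subst lborel_phase) (simp add: integral_distr)
  also have "\<dots> = (\<integral>x. (\<integral>\<omega>. f (phase x \<omega>) \<partial>lborel) \<partial>lborel)"
    unfolding lborel_prod[symmetric] using lborel_pair.integral_fst'[OF fi] by simp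
  finally show ?thesis .
qed

section \<open>Sums over countable index sets and integrals\<close>

text \<open>Extension by \<open>0\<close> along an enumeration of a countable type. It carries theorems about series indexed by the
natural numbers over to the lattice of integer vectors.\<close>

definition extend_nat :: "('k::countable \<Rightarrow> 'c::zero) \<Rightarrow> nat \<Rightarrow> 'c" where
  "extend_nat h n = (if n \<in> range (to_nat :: 'k \<Rightarrow> nat) then h (from_nat n) else 0)"

lemma has_sum_integral:
  fixes f :: "'k::countable \<Rightarrow> 'a \<Rightarrow> 'b::{banach,second_countable_topology}"
  assumes f: "\<And>k. integrable M (f k)"
    and norms: "(\<lambda>k. \<integral>x. norm (f k x) \<partial>M) summable_on UNIV"
    and pointwise: "\<And>x. x \<in> space M \<Longrightarrow> (\<lambda>k. norm (f k x)) summable_on UNIV"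
  shows "integrable M (\<lambda>x. \<Sum>\<^sub>\<infinity>k. f k x)"
    and "((\<lambda>k. \<integral>x. f k x \<partial>M) has_sum (\<integral>x. (\<Sum>\<^sub>\<infinity>k. f k x) \<partial>M)) UNIV"
proof -
  define R where "R = range (to_nat :: 'k \<Rightarrow> nat)"
  have ext_iff: "(extend_nat h has_sum s) UNIV \<longleftrightarrow> (h has_sum s) UNIV" for h :: "'k \<Rightarrow> 'c::{comm_monoid_add,topological_space}" and s
  proof -
    have "(extend_nat h has_sum s) UNIV \<longleftrightarrow> (extend_nat h has_sum s) R"
      unfolding R_def by (rule has_sum_cong_neutral) (auto simp: extend_nat_def)
    also have "\<dots> \<longleftrightarrow> ((extend_nat h \<circ> to_nat) has_sum s) (UNIV :: 'k set)"
      unfolding R_def by (rule has_sum_reindex) auto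
    also have "extend_nat h \<circ> to_nat = h" by (auto simp: extend_nat_def)
    finally show ?thesis .
  qed
  have sums_of: "summable (extend_nat h)" if hs: "h summable_on UNIV" for h :: "'k \<Rightarrow> real"
  proof -
    obtain s where "(h has_sum s) UNIV" using hs by (auto simp: summable_on_def)
    then have "(extend_nat h has_sum s) UNIV" by (simp add: ext_iff)
    then show ?thesis using has_sum_imp_sums sums_summable by blast
  qed
  let ?F = "\<lambda>n x. extend_nat (\<lambda>k. f k x) n"
  have n: "norm (extend_nat h i) = extend_nat (\<lambda>k. norm (h k)) i" for h :: "'k \<Rightarrow> 'b" and i by (simp add: extend_nat_def)
  have i: "(\<integral>x. extend_nat (\<lambda>k. h k x) i \<partial>M) = extend_nat (\<lambda>k. \<integral>x. h k x \<partial>M) i" for h :: "'k \<Rightarrow> 'a \<Rightarrow> 'c::{banach,second_countable_topology}" and i by (simp add: extend_nat_def)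
  have A: "integrable M (?F i)" for i using f by (cases "i \<in> range (to_nat :: 'k \<Rightarrow> nat)") (simp_all add: extend_nat_def)
  have B: "AE x in M. summable (\<lambda>i. norm (?F i x))"
    unfolding n using pointwise by (intro AE_I2 sums_of)
  have C: "summable (\<lambda>i. (\<integral>x. norm (?F i x) \<partial>M))"
    unfolding n i using norms by (intro sums_of)
  have eq: "(\<Sum>i. ?F i x) = (\<Sum>\<^sub>\<infinity>k. f k x)" if "x \<in> space M" for x
  proof -
    have "summable (\<lambda>i. norm (?F i x))" unfolding n using pointwise[OF that] by (intro sums_of)
    then have "((\<lambda>i. ?F i x) has_sum (\<Sum>i. ?F i x)) UNIV"
      by (metis norm_summable_imp_has_sum summable_sums summable_norm_cancel)
    then have "((\<lambda>k. f k x) has_sum (\<Sum>i. ?F i x)) UNIV" by (simp add: ext_iff)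
    then show ?thesis by (simp add: infsumI)
  qed
  have int: "(\<integral>x. (\<Sum>i. ?F i x) \<partial>M) = (\<integral>x. (\<Sum>\<^sub>\<infinity>k. f k x) \<partial>M)"
    by (intro Bochner_Integration.integral_cong eq refl)
  show "integrable M (\<lambda>x. \<Sum>\<^sub>\<infinity>k. f k x)"
    using integrable_suminf[OF A B C] eq by (simp cong: Bochner_Integration.integrable_cong)
  have S: "(\<lambda>i. \<integral>x. ?F i x \<partial>M) sums (\<integral>x. (\<Sum>i. ?F i x) \<partial>M)"
    by (rule sums_integral[OF A B C])
  have "summable (\<lambda>i. norm (\<integral>x. ?F i x \<partial>M))"
    by (rule summable_comparison_test'[OF C, of 0]) simp
  then have "((\<lambda>i. \<integral>x. ?F i x \<partial>M) has_sum (\<integral>x. (\<Sum>i. ?F i x) \<partial>M)) UNIV"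
    by (rule norm_summable_imp_has_sum[OF _ S])
  then show "((\<lambda>k. \<integral>x. f k x \<partial>M) has_sum (\<integral>x. (\<Sum>\<^sub>\<infinity>k. f k x) \<partial>M)) UNIV"
    unfolding i int ext_iff .
qed

section \<open>Tiling by unit cubes\<close>

text \<open>The cube is half-open so that its integer translates partition the space.\<close>

definition unit_cube :: "(real^'m::finite) set" where
  "unit_cube = {t. \<forall>i. 0 \<le> t $ i \<and> t $ i < 1}"

definition floor_vec :: "real^'m::finite \<Rightarrow> int^'m" where
  "floor_vec x = (\<chi> i. \<lfloor>x $ i\<rfloor>)"

lemma sub_int_vec_in_unit_cube_iff: "x - int_vec \<kappa> \<in> unit_cube \<longleftrightarrow> \<kappa> = floor_vec x"
proof -
  have "(0 \<le> a - real_of_int k \<and> a - real_of_int k < 1) \<longleftrightarrow> k = \<lfloor>a\<rfloor>" for a k by linarith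
  then show ?thesis by (simp add: unit_cube_def int_vec_def floor_vec_def vec_eq_iff)
qed

lemma int_vec_simps: "int_vec 0 = 0" "int_vec (- \<kappa>) = - int_vec \<kappa>" "int_vec (\<kappa> + \<mu>) = int_vec \<kappa> + int_vec \<mu>"
  by (simp_all add: int_vec_def vec_eq_iff)

lemma sets_unit_cube [measurable]: "unit_cube \<in> sets borel"
  unfolding unit_cube_def by measurable

lemma unit_cube_subset: "unit_cube \<subseteq> cbox 0 (1 :: real^'m::finite)"
  by (auto simp: unit_cube_def mem_box_cart less_imp_le)

lemma emeasure_unit_cube_finite: "emeasure lborel (unit_cube :: (real^'m::finite) set) < \<infinity>"
  using emeasure_bounded_finite[of "unit_cube :: (real^'m) set"] bounded_subset[OF bounded_cbox unit_cube_subset] by auto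

lemma unit_cube_subset_symmetric: "unit_cube \<subseteq> cbox (-1) (1 :: real^'m::finite)"
proof
  fix t :: "real^'m" assume t: "t \<in> unit_cube"
  have "- 1 \<le> t $ i" "t $ i \<le> 1" for i
    using t by (auto simp: unit_cube_def less_imp_le intro: order_trans[of "- 1" 0])
  then show "t \<in> cbox (- 1) 1" by (simp add: mem_box_cart)
qed

lemma norm_le_CARD:
  assumes "t \<in> cbox (-1) 1"
  shows "norm (t :: real^'m::finite) \<le> real CARD('m)"
proof -
  have "norm t \<le> (\<Sum>i\<in>UNIV. \<bar>t $ i\<bar>)" by (rule norm_le_l1_cart)
  also have "\<dots> \<le> (\<Sum>i\<in>(UNIV::'m set). 1)"
    using assms by (intro sum_mono) (auto simp: mem_box_cart abs_le_iff minus_le_iff)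
  finally show ?thesis by simp
qed

lemma tile_has_sum: "((\<lambda>\<kappa>. indicator unit_cube (x - int_vec \<kappa>) *\<^sub>R y) has_sum y) UNIV"
  for y :: "'b::real_normed_vector"
proof -
  have "((\<lambda>\<kappa>. indicator unit_cube (x - int_vec \<kappa>) *\<^sub>R y) has_sum y) {floor_vec x}"
    using has_sum_finite[of "{floor_vec x}" "\<lambda>\<kappa>. indicator unit_cube (x - int_vec \<kappa>) *\<^sub>R y"]
    by (simp add: sub_int_vec_in_unit_cube_iff)
  then show ?thesis
    by (rule has_sum_cong_neutral[THEN iffD1, rotated -1]) (auto simp: sub_int_vec_in_unit_cube_iff)
qed

lemma integral_tile_shift:
  fixes f :: "real^'m::finite \<Rightarrow> 'b::{banach,second_countable_topology}"
  assumes [measurable]: "f \<in> borel_measurable borel"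
  shows "(\<integral>x. indicator unit_cube (x - int_vec \<kappa>) *\<^sub>R f x \<partial>lborel)
       = (\<integral>t. indicator unit_cube t *\<^sub>R f (t + int_vec \<kappa>) \<partial>lborel)"
  using integral_shift[of "\<lambda>x. indicator unit_cube (x - int_vec \<kappa>) *\<^sub>R f x" "int_vec \<kappa>"] by simp

lemma sum_tile_le:
  assumes "finite F" and "0 \<le> y"
  shows "(\<Sum>\<kappa>\<in>F. indicator unit_cube (x - int_vec \<kappa>) * y) \<le> (y::real)"
proof -
  have "(\<Sum>\<kappa>\<in>F. indicator unit_cube (x - int_vec \<kappa>) * y) = (\<Sum>\<kappa>\<in>F. if \<kappa> = floor_vec x then y else 0)"
    by (intro sum.cong) (auto simp: sub_int_vec_in_unit_cube_iff indicator_def)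
  also have "\<dots> \<le> y" using assms by simp
  finally show ?thesis .
qed

text \<open>The indicators of the translated cubes are a partition of unity, and the sum over them is exchanged with the
integral.\<close>

lemma integral_tiling:
  fixes f :: "real^'m::finite \<Rightarrow> 'b::{banach,second_countable_topology}"
  assumes f: "integrable lborel f"
  shows "((\<lambda>\<kappa>. \<integral>t. indicator unit_cube t *\<^sub>R f (t + int_vec \<kappa>) \<partial>lborel) has_sum (\<integral>x. f x \<partial>lborel)) UNIV"
proof -
  note [measurable] = borel_measurable_integrable[OF f, simplified]
  let ?f = "\<lambda>\<kappa> x. indicator unit_cube (x - int_vec \<kappa>) *\<^sub>R f x"
  have i: "integrable lborel (?f \<kappa>)" for \<kappa>
    by (rule Bochner_Integration.integrable_bound[OF f]) (auto simp: indicator_def)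
  have n: "norm (?f \<kappa> x) = indicator unit_cube (x - int_vec \<kappa>) * norm (f x)" for \<kappa> x by (simp add: indicator_def)
  have S: "(\<lambda>\<kappa>. \<integral>x. norm (?f \<kappa> x) \<partial>lborel) summable_on UNIV"
  proof (rule nonneg_bdd_above_summable_on)
    show "bdd_above (sum (\<lambda>\<kappa>. \<integral>x. norm (?f \<kappa> x) \<partial>lborel) ` {F. F \<subseteq> UNIV \<and> finite F})"
    proof (rule bdd_aboveI2[where M="\<integral>x. norm (f x) \<partial>lborel"], clarify)
      fix F :: "(int^'m) set" assume F: "finite F"
      have "(\<Sum>\<kappa>\<in>F. \<integral>x. norm (?f \<kappa> x) \<partial>lborel) = (\<integral>x. (\<Sum>\<kappa>\<in>F. norm (?f \<kappa> x)) \<partial>lborel)"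
        by (rule Bochner_Integration.integral_sum[symmetric]) (intro integrable_norm i)
      also have "\<dots> \<le> (\<integral>x. norm (f x) \<partial>lborel)"
        unfolding n using integrable_norm[OF i] integrable_norm[OF f] F
        by (intro integral_mono sum_tile_le Bochner_Integration.integrable_sum) (simp_all add: n)
      finally show "(\<Sum>\<kappa>\<in>F. \<integral>x. norm (?f \<kappa> x) \<partial>lborel) \<le> (\<integral>x. norm (f x) \<partial>lborel)" .
    qed
  qed simp
  have P: "(\<lambda>\<kappa>. norm (?f \<kappa> x)) summable_on UNIV" for x
    unfolding n using tile_has_sum[of x "norm (f x)"] by (auto simp: summable_on_def)
  have "((\<lambda>\<kappa>. \<integral>x. ?f \<kappa> x \<partial>lborel) has_sum (\<integral>x. (\<Sum>\<^sub>\<infinity>\<kappa>. ?f \<kappa> x) \<partial>lborel)) UNIV"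
    by (rule has_sum_integral(2)[OF i S P])
  moreover have "(\<lambda>x. \<Sum>\<^sub>\<infinity>\<kappa>. ?f \<kappa> x) = f" by (intro ext infsumI tile_has_sum)
  ultimately show ?thesis by (simp add: integral_tile_shift)
qed

text \<open>The condition says that the suprema of \<open>f\<close> over the translated cubes are summable. It is the global regularity
under which the Poisson summation formula holds pointwise.\<close>

lemma integrable_tiling:
  fixes f :: "real^'m::finite \<Rightarrow> 'b::{banach,second_countable_topology}"
  assumes [measurable]: "f \<in> borel_measurable borel"
    and M: "\<And>\<kappa> t. t \<in> unit_cube \<Longrightarrow> norm (f (t + int_vec \<kappa>)) \<le> M \<kappa>" and S: "M summable_on UNIV"
  shows "integrable lborel f"
proof -
  let ?c = "unit_cube :: (real^'m) set"
  let ?f = "\<lambda>\<kappa> x. indicator unit_cube (x - int_vec \<kappa>) *\<^sub>R f x"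
  have n: "norm (?f \<kappa> x) = indicator unit_cube (x - int_vec \<kappa>) * norm (f x)" for \<kappa> x by (simp add: indicator_def)
  have M0: "0 \<le> M \<kappa>" for \<kappa> using order_trans[OF norm_ge_zero M[of 0 \<kappa>]] by (simp add: unit_cube_def)
  have ci: "integrable lborel (\<lambda>t. indicator ?c t * M \<kappa>)" for \<kappa>
    using emeasure_unit_cube_finite by (intro integrable_mult_left integrable_real_indicator) auto
  have b: "norm (?f \<kappa> (t + int_vec \<kappa>)) \<le> indicator ?c t * M \<kappa>" for \<kappa> t using M[of t \<kappa>] by (auto simp: indicator_def)
  have "integrable lborel (\<lambda>t. ?f \<kappa> (t + int_vec \<kappa>))" for \<kappa>
    by (rule Bochner_Integration.integrable_bound[OF ci]) (use b M0 in \<open>auto intro!: AE_I2\<close>)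
  then have i: "integrable lborel (?f \<kappa>)" for \<kappa>
    by (subst (asm) integrable_shift_iff) auto
  have S: "(\<lambda>\<kappa>. \<integral>x. norm (?f \<kappa> x) \<partial>lborel) summable_on UNIV"
  proof (rule summable_on_comparison_test)
    show "(\<lambda>\<kappa>. M \<kappa> * measure lborel ?c) summable_on UNIV" by (intro summable_on_cmult_left S)
    fix \<kappa> :: "int^'m"
    have "(\<integral>x. norm (?f \<kappa> x) \<partial>lborel) = (\<integral>t. norm (?f \<kappa> (t + int_vec \<kappa>)) \<partial>lborel)"
      by (subst integral_shift[symmetric, of _ "int_vec \<kappa>"]) auto
    also have "\<dots> \<le> (\<integral>t. indicator ?c t * M \<kappa> \<partial>lborel)"
      by (rule integral_mono'[OF ci]) (use b M0 in auto)
    finally show "(\<integral>x. norm (?f \<kappa> x) \<partial>lborel) \<le> M \<kappa> * measure lborel ?c" by (simp add: mult.commute)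
  qed auto
  have P: "(\<lambda>\<kappa>. norm (?f \<kappa> x)) summable_on UNIV" for x
    unfolding n using tile_has_sum[of x "norm (f x)"] by (auto simp: summable_on_def)
  have "integrable lborel (\<lambda>x. \<Sum>\<^sub>\<infinity>\<kappa>. ?f \<kappa> x)"
    by (rule has_sum_integral(1)[OF i S P])
  also have "(\<lambda>x. \<Sum>\<^sub>\<infinity>\<kappa>. ?f \<kappa> x) = f" by (intro ext infsumI tile_has_sum)
  finally show ?thesis .
qed

section \<open>A rapidly decreasing majorant\<close>

text \<open>One majorant serves all decay estimates. The exponent is twice the dimension, so that \<open>decay x\<close> is at most the
product of the integrable functions \<open>1 / (1 + (x $ i)\<^sup>2)\<close> of the coordinates.\<close>

definition decay :: "real^'m::finite \<Rightarrow> real" where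
  "decay x = inverse ((1 + norm x) ^ (2 * CARD('m)))"

lemma decay_pos: "0 < decay x" and decay_le_1: "decay x \<le> 1"
  by (auto simp: decay_def add_pos_nonneg intro!: inverse_le_1_iff[THEN iffD2] one_le_power)

lemma le_mult_decay:
  fixes x :: "real^'m::finite"
  assumes "(1 + norm x) ^ (2 * CARD('m)) * a \<le> B"
  shows "a \<le> B * decay x"
proof -
  have "0 < (1 + norm x) ^ (2 * CARD('m))" by (simp add: add_pos_nonneg)
  then show ?thesis using assms by (simp add: decay_def field_simps)
qed

lemma le_of_le_mult_decay: "a \<le> B * decay x \<Longrightarrow> 0 \<le> B \<Longrightarrow> a \<le> B"
  using mult_left_le[OF decay_le_1] order_trans by blast

lemma one_plus_power_le:
  assumes "0 \<le> (r::real)"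
  shows "(1 + r) ^ N \<le> 2 ^ N * (1 + r ^ N)"
proof -
  have "(1 + r) ^ N \<le> (2 * max 1 r) ^ N" using assms by (intro power_mono) auto
  also have "\<dots> = 2 ^ N * max 1 r ^ N" by (rule power_mult_distrib)
  also have "max 1 r ^ N \<le> 1 + r ^ N" using assms by (cases "r \<le> 1") (auto simp: max_def)
  finally show ?thesis by simp
qed

text \<open>Because of its polynomial size, the majorant changes at most by a constant factor when its argument is moved
within a bounded distance or is mapped by an invertible matrix.\<close>

lemma decay_perturb:
  fixes x y :: "real^'m::finite"
  assumes "norm y \<le> R * norm x + R'" "0 \<le> R" "0 \<le> R'"
  shows "decay x \<le> (1 + R + R') ^ (2 * CARD('m)) * decay y"
proof -
  have "1 + norm y \<le> (1 + R + R') * (1 + norm x)"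
    using assms by (simp add: algebra_simps add_increasing mult_nonneg_nonneg)
      (smt (verit) mult_nonneg_nonneg norm_ge_zero)
  then have "(1 + norm y) ^ (2 * CARD('m)) \<le> (1 + R + R') ^ (2 * CARD('m)) * (1 + norm x) ^ (2 * CARD('m))"
    unfolding power_mult_distrib[symmetric] by (intro power_mono) auto
  moreover have "0 < (1 + norm y) ^ (2 * CARD('m))" "0 < (1 + norm x) ^ (2 * CARD('m))" by (auto simp: add_pos_nonneg)
  ultimately show ?thesis unfolding decay_def by (simp add: field_simps)
qed

lemma continuous_on_decay [continuous_intros]: "continuous_on A f \<Longrightarrow> continuous_on A (\<lambda>x. decay (f x))"
  unfolding decay_def by (intro continuous_intros) (auto simp: add_nonneg_eq_0_iff)

lemma measurable_decay [measurable]: "decay \<in> borel_measurable borel"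
  by (intro borel_measurable_continuous_onI continuous_intros)

lemma integral_prod_vec:
  fixes f :: "'m::finite \<Rightarrow> real \<Rightarrow> 'b::{real_normed_field,banach,second_countable_topology}"
  assumes f: "\<And>i. integrable lborel (f i)"
  shows "integrable (lborel :: (real^'m) measure) (\<lambda>x. \<Prod>i\<in>UNIV. f i (x $ i))"
    and "(\<integral>x. (\<Prod>i\<in>UNIV. f i ((x::real^'m) $ i)) \<partial>lborel) = (\<Prod>i\<in>UNIV. \<integral>x. f i x \<partial>lborel)"
proof -
  interpret product_sigma_finite "\<lambda>_::'m. lborel :: real measure" by standard
  have [measurable]: "f i \<in> borel_measurable borel" for i using borel_measurable_integrable[OF f[of i]] by simp
  show "integrable (lborel :: (real^'m) measure) (\<lambda>x. \<Prod>i\<in>UNIV. f i (x $ i))"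
    by (subst lborel_vec_eq) (simp add: integrable_distr_eq product_integrable_prod f)
  show "(\<integral>x. (\<Prod>i\<in>UNIV. f i ((x::real^'m) $ i)) \<partial>lborel) = (\<Prod>i\<in>UNIV. \<integral>x. f i x \<partial>lborel)"
    by (subst lborel_vec_eq) (simp add: integral_distr product_integral_prod f)
qed

lemma integrable_decay: "integrable lborel (decay :: real^'m::finite \<Rightarrow> real)"
proof -
  have "integrable lborel (\<lambda>x::real. inverse (1 + x^2))"
    using integrable_inverse_1_plus_square by (simp add: set_integrable_def einterval_def)
  then have "integrable lborel (\<lambda>x::real^'m. \<Prod>i\<in>UNIV. inverse (1 + (x $ i)^2))"
    by (rule integral_prod_vec(1))
  then show ?thesis
  proof (rule Bochner_Integration.integrable_bound)
    show "AE x in lborel. norm (decay x) \<le> norm (\<Prod>i\<in>(UNIV::'m set). inverse (1 + (x $ i)^2))"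
    proof (rule AE_I2)
      fix x :: "real^'m"
      have "(\<Prod>i\<in>(UNIV::'m set). 1 + (x $ i)^2) \<le> (\<Prod>i\<in>(UNIV::'m set). (1 + norm x)^2)"
      proof (intro prod_mono conjI)
        fix i
        have "(x $ i)^2 \<le> (norm x)^2" using component_le_norm_cart[of x i] by (simp add: abs_le_square_iff[symmetric])
        then show "1 + (x $ i)^2 \<le> (1 + norm x)^2" by (simp add: power2_eq_square algebra_simps add_increasing2)
      qed (auto intro: add_nonneg_nonneg)
      also have "\<dots> = (1 + norm x) ^ (2 * CARD('m))" by (simp add: power_mult[symmetric])
      finally have "decay x \<le> inverse (\<Prod>i\<in>(UNIV::'m set). 1 + (x $ i)^2)"
        unfolding decay_def by (intro le_imp_inverse_le prod_pos) (auto intro: add_pos_nonneg)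
      also have "\<dots> = (\<Prod>i\<in>(UNIV::'m set). inverse (1 + (x $ i)^2))" by (simp add: prod_inversef[symmetric] o_def)
      finally show "norm (decay x) \<le> norm (\<Prod>i\<in>(UNIV::'m set). inverse (1 + (x $ i)^2))"
        using decay_pos[of x] by simp
    qed
  qed simp
qed

text \<open>The value of \<open>decay\<close> at a lattice point is at most a constant times its integral over the adjacent unit cube, so
the sum is at most a constant times the integral over the whole space. That this does not depend on \<open>q\<close> allows
the estimate to be integrated over \<open>q\<close> against the windows.\<close>

lemma sum_decay_bounded:
  obtains B where "\<And>(q::real^'m::finite) F. finite F \<Longrightarrow> (\<Sum>\<kappa>\<in>F. decay (int_vec \<kappa> + q)) \<le> B" "0 \<le> B"
proof
  let ?c = "unit_cube :: (real^'m) set"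
  let ?K = "(1 + 1 + real CARD('m)) ^ (2 * CARD('m))"
  let ?B = "?K * (\<integral>x. decay (x::real^'m) \<partial>lborel) / measure lborel ?c"
  have "0 \<le> (\<integral>x. decay (x::real^'m) \<partial>lborel)" by (intro integral_nonneg_AE AE_I2 less_imp_le decay_pos)
  then show "0 \<le> ?B" by (intro divide_nonneg_nonneg mult_nonneg_nonneg) auto
  have box: "box 0 1 \<subseteq> ?c" by (auto simp: unit_cube_def mem_box_cart less_imp_le)
  have "0 < measure lborel (box 0 (1::real^'m))" by (subst measure_lborel_box) (auto simp: Basis_vec_range inner_axis intro!: prod_pos)
  also have "\<dots> \<le> measure lborel ?c"
    using emeasure_unit_cube_finite box by (intro measure_mono_fmeasurable) (auto simp: fmeasurable_def)
  finally have cpos: "0 < measure lborel ?c" .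
  fix q :: "real^'m" and F :: "(int^'m) set" assume F: "finite F"
  have dq: "integrable lborel (\<lambda>x. decay (x + q))" by (rule integrable_shift[OF integrable_decay])
  have tile: "integrable lborel (\<lambda>t. indicator ?c (t - int_vec \<kappa>) * decay (t + q))" for \<kappa>
    by (rule Bochner_Integration.integrable_bound[OF dq]) (auto simp: indicator_def)
  have "measure lborel ?c * decay (int_vec \<kappa> + q) \<le> ?K * (\<integral>t. indicator ?c (t - int_vec \<kappa>) * decay (t + q) \<partial>lborel)" for \<kappa>
  proof -
    have "measure lborel ?c * decay (int_vec \<kappa> + q) = (\<integral>t. indicator ?c t * decay (int_vec \<kappa> + q) \<partial>lborel)" by simp
    also have "\<dots> \<le> (\<integral>t. ?K * (indicator ?c t * decay (t + int_vec \<kappa> + q)) \<partial>lborel)"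
    proof (rule integral_mono)
      show "integrable lborel (\<lambda>t. indicator ?c t * decay (int_vec \<kappa> + q))"
        using emeasure_unit_cube_finite by (intro integrable_mult_left integrable_real_indicator) auto
      have "integrable lborel (\<lambda>t. (\<lambda>t. indicator ?c (t - int_vec \<kappa>) * decay (t + q)) (t + int_vec \<kappa>))"
        by (rule integrable_shift[OF tile])
      then show "integrable lborel (\<lambda>t. ?K * (indicator ?c t * decay (t + int_vec \<kappa> + q)))" by simp
      fix t :: "real^'m"
      have "norm (t + int_vec \<kappa> + q) \<le> 1 * norm (int_vec \<kappa> + q) + real CARD('m)" if "t \<in> ?c"
        using norm_triangle_ineq[of t "int_vec \<kappa> + q"] norm_le_CARD[OF subsetD[OF unit_cube_subset_symmetric that]] by (simp add: add.assoc)
      then show "indicator ?c t * decay (int_vec \<kappa> + q) \<le> ?K * (indicator ?c t * decay (t + int_vec \<kappa> + q))"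
        using decay_perturb[of "t + int_vec \<kappa> + q" 1 "int_vec \<kappa> + q" "real CARD('m)"] by (auto simp: indicator_def)
    qed
    also have "\<dots> = ?K * (\<integral>t. indicator ?c (t - int_vec \<kappa>) * decay (t + q) \<partial>lborel)"
      using integral_shift[of "\<lambda>t. indicator ?c (t - int_vec \<kappa>) * decay (t + q)" "int_vec \<kappa>"] by simp
    finally show ?thesis .
  qed
  then have "measure lborel ?c * (\<Sum>\<kappa>\<in>F. decay (int_vec \<kappa> + q)) \<le> (\<Sum>\<kappa>\<in>F. ?K * (\<integral>t. indicator ?c (t - int_vec \<kappa>) * decay (t + q) \<partial>lborel))"
    unfolding sum_distrib_left by (intro sum_mono)
  also have "\<dots> = ?K * (\<integral>t. (\<Sum>\<kappa>\<in>F. indicator ?c (t - int_vec \<kappa>) * decay (t + q)) \<partial>lborel)"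
    using tile by (simp add: sum_distrib_left Bochner_Integration.integral_sum)
  also have "\<dots> \<le> ?K * (\<integral>t. decay (t + q) \<partial>lborel)"
    using F tile dq decay_pos by (intro mult_left_mono integral_mono sum_tile_le Bochner_Integration.integrable_sum) (auto intro: less_imp_le)
  also have "\<dots> = ?K * (\<integral>x. decay (x::real^'m) \<partial>lborel)" by (simp add: integral_shift)
  finally show "(\<Sum>\<kappa>\<in>F. decay (int_vec \<kappa> + q)) \<le> ?B" using cpos by (simp add: field_simps)
qed

section \<open>The Poisson summation formula\<close>

lemma integral_lebesgue_lborel:
  fixes f :: "'a::euclidean_space \<Rightarrow> 'b::{banach,second_countable_topology}"
  shows "f \<in> borel_measurable borel \<Longrightarrow> (LINT x|lebesgue. f x) = (LINT x|lborel. f x)"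
  by (rule integral_completion) simp

lemma fourier_lborel:
  assumes [measurable]: "f \<in> borel_measurable borel"
  shows "fourier f \<omega> = (LINT x|lborel. f x * cis (- 2 * pi * (x \<bullet> \<omega>)))"
proof -
  have [measurable]: "(\<lambda>x. cis (- 2 * pi * (x \<bullet> \<omega>))) \<in> borel_measurable borel"
    by (intro borel_measurable_continuous_onI continuous_intros)
  show ?thesis unfolding fourier_def by (rule integral_lebesgue_lborel) measurable
qed

definition unit_char :: "int^'m::finite \<Rightarrow> real^'m \<Rightarrow> complex" where
  "unit_char \<kappa> t = cis (2 * pi * (int_vec \<kappa> \<bullet> t))"

lemma unit_char_add: "unit_char (\<kappa> + \<mu>) t = unit_char \<kappa> t * unit_char \<mu> t"
  by (simp add: unit_char_def int_vec_simps inner_add_left distrib_left cis_mult)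

lemma norm_unit_char [simp]: "norm (unit_char \<kappa> t) = 1"
  by (simp add: unit_char_def)

lemma continuous_on_unit_char [continuous_intros]:
  "continuous_on A f \<Longrightarrow> continuous_on A (\<lambda>x. unit_char \<kappa> (f x))"
  unfolding unit_char_def by (intro continuous_intros)

lemma measurable_unit_char [measurable]: "unit_char \<kappa> \<in> borel_measurable borel"
  by (intro borel_measurable_continuous_onI continuous_intros)

lemma cis_int_inner: "cis (2 * pi * (int_vec \<kappa> \<bullet> int_vec \<mu>)) = 1"
proof -
  have "int_vec \<kappa> \<bullet> int_vec \<mu> = of_int (\<Sum>i\<in>UNIV. \<kappa> $ i * \<mu> $ i)"
    by (simp add: inner_vec_def int_vec_def)
  then show ?thesis by (metis cis_multiple_2pi Ints_of_int)
qed

lemma unit_char_periodic: "unit_char \<kappa> (t + int_vec \<mu>) = unit_char \<kappa> t"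
proof -
  have "unit_char \<kappa> (t + int_vec \<mu>) = unit_char \<kappa> t * cis (2 * pi * (int_vec \<kappa> \<bullet> int_vec \<mu>))"
    unfolding unit_char_def cis_mult by (simp add: inner_add_right distrib_left)
  then show ?thesis by (simp add: cis_int_inner)
qed

lemma integrable_on_unit_cube:
  fixes F :: "real^'m::finite \<Rightarrow> 'b::{banach,second_countable_topology}"
  assumes "continuous_on (cbox 0 1) F"
  shows "integrable lborel (\<lambda>t. indicator unit_cube t *\<^sub>R F t)"
proof -
  have "integrable lborel (\<lambda>t. indicator unit_cube t *\<^sub>R (indicator (cbox 0 1) t *\<^sub>R F t))"
    by (rule integrable_mult_indicator[OF _ borel_integrable_compact[OF compact_cbox assms]]) simp
  moreover have "indicator unit_cube t *\<^sub>R (indicator (cbox 0 1) t *\<^sub>R F t) = indicator unit_cube t *\<^sub>R F t" for t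
    using unit_cube_subset by (auto simp: indicator_def)
  ultimately show ?thesis by (simp only:)
qed

lemma integral_unit_char_1d:
  "(LINT x|lborel. indicator {0..<1::real} x *\<^sub>R cis (2 * pi * (of_int k * x))) = (if k = 0 then 1 else 0)"
proof -
  let ?f = "\<lambda>x. cis (2 * pi * (of_int k * x))"
  have "(LINT x|lborel. indicator {0..<1::real} x *\<^sub>R ?f x) = (LINT x|lborel. indicator {0..1::real} x *\<^sub>R ?f x)"
  proof (rule integral_cong_AE)
    show "AE x in lborel. indicator {0..<1::real} x *\<^sub>R ?f x = indicator {0..1::real} x *\<^sub>R ?f x"
      using AE_lborel_singleton[of 1] by eventually_elim (auto simp: indicator_def)
    have [measurable]: "?f \<in> borel_measurable borel" by (intro borel_measurable_continuous_onI continuous_intros)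
    show "(\<lambda>x. indicator {0..<1::real} x *\<^sub>R ?f x) \<in> borel_measurable lborel"
      "(\<lambda>x. indicator {0..1::real} x *\<^sub>R ?f x) \<in> borel_measurable lborel" by measurable
  qed
  also have "\<dots> = (if k = 0 then 1 else 0)"
  proof (cases "k = 0")
    case False
    let ?F = "\<lambda>x::real. cis (2 * pi * (of_int k * x)) / (2 * pi * \<i> * of_int k)"
    have "(LINT x|lborel. indicator {0..1::real} x *\<^sub>R ?f x) = ?F 1 - ?F 0"
    proof (rule integral_FTC_Icc)
      fix x :: real
      show "(?F has_vector_derivative ?f x) (at x within {0..1})"
      proof -
        let ?c = "2 * pi * \<i> * of_int k"
        have "((\<lambda>z. exp (?c * z) / ?c) has_field_derivative exp (?c * of_real x)) (at (of_real x))"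
          using False by (auto intro!: derivative_eq_intros)
        from has_vector_derivative_real_field[OF this, of "{0..1}"] show ?thesis
          by (simp add: cis_conv_exp ac_simps)
      qed
    qed (auto intro!: continuous_intros)
    moreover have "cis (2 * pi * of_int k) = 1" by (metis cis_multiple_2pi Ints_of_int)
    ultimately show ?thesis using False by simp
  qed simp
  finally show ?thesis .
qed

lemma indicator_unit_cube_prod:
  "indicator unit_cube (t::real^'m::finite) = (\<Prod>i\<in>UNIV. indicator {0..<1} (t $ i) :: real)"
proof (cases "t \<in> unit_cube")
  case False
  then obtain i where "t $ i \<notin> {0..<1}" by (auto simp: unit_cube_def)
  then have "\<exists>i\<in>UNIV. indicator {0..<1} (t $ i) = (0::real)" by (intro bexI[of _ i]) auto
  then have "(\<Prod>i\<in>UNIV. indicator {0..<1} (t $ i) :: real) = 0" by (intro prod_zero finite)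
  then show ?thesis using False by simp
qed (auto simp: unit_cube_def)

lemma integral_unit_char:
  "(LINT t|lborel. indicator unit_cube t *\<^sub>R unit_char (\<kappa>::int^'m::finite) t) = (if \<kappa> = 0 then 1 else 0)"
proof -
  let ?f = "\<lambda>i x. indicator {0..<1::real} x *\<^sub>R cis (2 * pi * (of_int (\<kappa>$i) * x))"
  have "unit_char \<kappa> t = (\<Prod>i\<in>UNIV. cis (2 * pi * (of_int (\<kappa>$i) * t $ i)))" for t
    by (simp add: unit_char_def inner_vec_def int_vec_def sum_distrib_left cis_conv_exp exp_sum sum_distrib_left)
  then have eq: "indicator unit_cube t *\<^sub>R unit_char \<kappa> t = (\<Prod>i\<in>UNIV. ?f i (t $ i))" for t
    by (simp add: indicator_unit_cube_prod scaleR_conv_of_real prod.distrib of_real_prod)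
  have i: "integrable lborel (?f i)" for i
    proof -
    have "integrable lborel (\<lambda>x. indicator {0..<1} x *\<^sub>R (indicator {0..1::real} x *\<^sub>R cis (2 * pi * (of_int (\<kappa>$i) * x))))"
      by (intro integrable_mult_indicator borel_integrable_compact continuous_intros) auto
    then show ?thesis by (rule Bochner_Integration.integrable_cong[THEN iffD1, rotated -1]) (auto simp: indicator_def)
  qed
  have "(LINT t|lborel. indicator unit_cube t *\<^sub>R unit_char \<kappa> t) = (\<Prod>i\<in>UNIV. if \<kappa>$i = 0 then 1 else 0)"
    unfolding eq integral_prod_vec(2)[OF i] integral_unit_char_1d ..
  also have "\<dots> = (if \<kappa> = 0 then 1 else 0)" by (auto simp: vec_eq_iff prod_zero_iff)
  finally show ?thesis .
qed

text \<open>The trigonometric polynomial \<open>p\<close> of the proof takes values in \<open>[0, 1]\<close> and equals \<open>1\<close> on the closed cube only at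
its centre \<open>c\<close>. By assumption \<open>H p\<^sup>N\<close> has integral \<open>0\<close> for every \<open>N\<close>. If \<open>H c\<close> were nonzero, this would fail for
large \<open>N\<close>, because \<open>p\<^sup>N\<close> concentrates at \<open>c\<close>. Working at the centre, and not at a corner of the cube, makes the
argument independent of any periodicity of \<open>H\<close>.\<close>

lemma vanishing_coefficients_imp_zero:
  fixes H :: "real^'m::finite \<Rightarrow> complex"
  assumes H: "continuous_on (cbox 0 1) H"
    and coeff: "\<And>\<kappa>. (LINT t|lborel. indicator unit_cube t *\<^sub>R (unit_char \<kappa> t * H t)) = 0"
  shows "H (\<chi> i. 1/2) = 0"
proof (rule ccontr)
  define c :: "real^'m" where "c = (\<chi> i. 1/2)"
  let ?Q = "unit_cube :: (real^'m) set"
  let ?m = "real CARD('m)"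
  assume "H (\<chi> i. 1/2) \<noteq> 0"
  then have Hc: "H c \<noteq> 0" by (simp add: c_def)
  define p :: "real^'m \<Rightarrow> real" where "p t = (\<Sum>i\<in>UNIV. (1 - cos (2 * pi * t $ i)) / 2) / ?m" for t
  have pc: "continuous_on A p" for A unfolding p_def by (intro continuous_intros) auto
  have half: "(1 - cos x) / 2 \<le> 1" for x :: real
  proof -
    have "1 - cos x \<le> 1 - (-1)" by (intro diff_left_mono cos_ge_minus_one)
    then show ?thesis by simp
  qed
  have p_bounds: "0 \<le> p t" "p t \<le> 1" for t
  proof -
    show "0 \<le> p t" unfolding p_def by (intro divide_nonneg_nonneg sum_nonneg) auto
    have "(\<Sum>i\<in>UNIV. (1 - cos (2 * pi * t $ i)) / 2) \<le> (\<Sum>i\<in>(UNIV::'m set). 1)"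
    proof (rule sum_mono)
      fix i show "(1 - cos (2 * pi * t $ i)) / 2 \<le> 1" by (rule half)
    qed
    then show "p t \<le> 1" unfolding p_def by simp
  qed
  have p_c: "p c = 1" by (simp add: p_def c_def)
  have p_max: "t = c" if "p t = 1" "t \<in> cbox 0 1" for t
  proof -
    have "(\<Sum>i\<in>UNIV. 1 - (1 - cos (2 * pi * t $ i)) / 2) = 0"
      using that(1) by (simp add: p_def sum_subtractf)
    moreover have "0 \<le> 1 - (1 - cos (2 * pi * t $ i)) / 2" for i
      using half by simp
    ultimately have *: "cos (2 * pi * t $ i) = -1" for i
      by (subst (asm) sum_nonneg_eq_0_iff) (auto simp: field_simps dest!: spec[of _ i])
    have "t $ i = 1/2" for i
    proof -
      have "cos (2 * pi * t $ i - pi) = 1" using *[of i] by simp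
      then obtain n where n: "2 * pi * t $ i - pi = of_int n * 2 * pi" using cos_one_2pi_int by metis
      then have "2 * pi * (t $ i - 1/2) = 2 * pi * of_int n" by (simp add: algebra_simps)
      then have "t $ i - 1/2 = of_int n" by simp
      moreover have "0 \<le> t $ i" "t $ i \<le> 1" using that(2) by (auto simp: mem_box_cart)
      ultimately have "n = 0" by linarith
      then show ?thesis using \<open>t $ i - 1/2 = of_int n\<close> by simp
    qed
    then show ?thesis by (simp add: c_def vec_eq_iff)
  qed
  have pe: "complex_of_real (p t) * z = (\<Sum>i\<in>UNIV. (1/2) * z - (1/4) * (unit_char (axis i 1) t * z) - (1/4) * (unit_char (- axis i 1) t * z)) / ?m" for t z
  proof -
    have iv: "int_vec (axis i 1) \<bullet> t = t $ i" for i
    proof -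
      have "int_vec (axis i 1) = (axis i 1 :: real^'m)" by (simp add: vec_eq_iff int_vec_def axis_def)
      then show ?thesis by (simp add: inner_axis')
    qed
    have "complex_of_real ((1 - cos (2 * pi * t $ i)) / 2) = 1/2 - 1/4 * unit_char (axis i 1) t - 1/4 * unit_char (- axis i 1) t" for i
      by (simp add: unit_char_def iv int_vec_simps complex_eq_iff)
    then have "complex_of_real (p t) = (\<Sum>i\<in>UNIV. 1/2 - 1/4 * unit_char (axis i 1) t - 1/4 * unit_char (- axis i 1) t) / ?m"
      unfolding p_def of_real_divide of_real_sum by (simp only: of_real_of_nat_eq)
    then show ?thesis by (simp add: times_divide_eq_left sum_distrib_right left_diff_distrib mult.assoc)
  qed
  have int: "integrable lborel (\<lambda>t. indicator ?Q t *\<^sub>R (of_real (p t) ^ N * (unit_char \<kappa> t * H t)))" for N \<kappa>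
    by (intro integrable_on_unit_cube continuous_intros pc H)
  have vanish: "(LINT t|lborel. indicator ?Q t *\<^sub>R (of_real (p t) ^ N * (unit_char \<kappa> t * H t))) = 0" for N \<kappa>
  proof (induction N arbitrary: \<kappa>)
    case 0
    then show ?case using coeff by simp
  next
    case (Suc N)
    let ?g = "\<lambda>\<kappa> t. indicator ?Q t *\<^sub>R (of_real (p t) ^ N * (unit_char \<kappa> t * H t))"
    have "indicator ?Q t *\<^sub>R (of_real (p t) ^ Suc N * (unit_char \<kappa> t * H t)) =
      (\<Sum>i\<in>UNIV. (1/2) * ?g \<kappa> t - (1/4) * ?g (axis i 1 + \<kappa>) t - (1/4) * ?g (- axis i 1 + \<kappa>) t) / ?m" for t
    proof -
      have "indicator ?Q t *\<^sub>R (of_real (p t) ^ Suc N * (unit_char \<kappa> t * H t)) = of_real (p t) * ?g \<kappa> t" by simp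
      then show ?thesis unfolding pe unit_char_add by (simp add: algebra_simps)
    qed
    moreover have hb: "has_bochner_integral lborel (?g \<mu>) 0" for \<mu>
      using int Suc by (simp add: has_bochner_integral_iff)
    ultimately have "(LINT t|lborel. indicator ?Q t *\<^sub>R (of_real (p t) ^ Suc N * (unit_char \<kappa> t * H t))) =
      (LINT t|lborel. (\<Sum>i\<in>UNIV. (1/2) * ?g \<kappa> t - (1/4) * ?g (axis i 1 + \<kappa>) t - (1/4) * ?g (- axis i 1 + \<kappa>) t) / ?m)"
      by (simp only:)
    also from hb have "\<dots>
      = (\<Sum>i\<in>(UNIV::'m set). (1/2) * (0::complex) - (1/4) * 0 - (1/4) * 0) / ?m"
      by (intro has_bochner_integral_integral_eq has_bochner_integral_divide_zero has_bochner_integral_sum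
          has_bochner_integral_diff has_bochner_integral_mult_right)
    finally show ?case by simp
  qed
  \<comment> \<open>Rotate \<open>H\<close> so that its value at the centre becomes the positive number \<open>h\<close>.\<close>
  define a where "a = cnj (H c) / norm (H c)"
  define R where "R t = Re (a * H t)" for t
  define h where "h = norm (H c)"
  have h: "0 < h" using Hc by (simp add: h_def)
  have Rc: "R c = h" using Hc unfolding R_def a_def h_def
    by (simp add: mult.commute[of "cnj _"] complex_norm_square[symmetric] power2_eq_square)
  have Rcont: "continuous_on (cbox 0 1) R" unfolding R_def by (intro continuous_intros H)
  have R0: "(LINT t|lborel. indicator ?Q t * (p t ^ N * R t)) = 0" for N
  proof -
    have "(LINT t|lborel. indicator ?Q t * (p t ^ N * R t)) = (LINT t|lborel. Re (a * (indicator ?Q t *\<^sub>R (of_real (p t) ^ N * (unit_char 0 t * H t)))))"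
      by (intro Bochner_Integration.integral_cong refl) (simp add: R_def unit_char_def int_vec_simps algebra_simps flip: of_real_power)
    also have "\<dots> = Re (a * (LINT t|lborel. (indicator ?Q t *\<^sub>R (of_real (p t) ^ N * (unit_char 0 t * H t)))))"
      by (subst integral_Re) (use int in \<open>simp_all only: integral_mult_right_zero integrable_mult_right\<close>)
    finally show ?thesis by (simp add: vanish)
  qed
  have cin: "c \<in> cbox 0 1" by (simp add: c_def mem_box_cart)
  obtain M where M: "\<And>t. t \<in> cbox 0 1 \<Longrightarrow> \<bar>R t\<bar> \<le> M" and "0 \<le> M"
  proof -
    have "bounded (R ` cbox 0 1)" by (intro compact_imp_bounded compact_continuous_image Rcont compact_cbox)
    then show thesis using that by (auto simp: bounded_pos) (meson less_imp_le)
  qed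
  have Qbox: "t \<in> cbox 0 1" if "t \<in> ?Q" for t using that unit_cube_subset by blast
  obtain d where d: "0 < d" "\<And>t. t \<in> cbox 0 1 \<Longrightarrow> dist t c < d \<Longrightarrow> h / 2 < R t"
  proof -
    have "\<exists>d>0. \<forall>x\<in>cbox 0 1. dist x c < d \<longrightarrow> dist (R x) (R c) < h/2"
      using Rcont[unfolded continuous_on_iff, rule_format, OF cin, of "h/2"] h by simp
    then show thesis using that Rc by (auto simp: dist_real_def) (smt (verit) field_sum_of_halves)
  qed
  obtain r where r: "0 \<le> r" "r < 1" "\<And>t. t \<in> cbox 0 1 \<Longrightarrow> \<not> dist t c < d \<Longrightarrow> p t \<le> r"
  proof (cases "cbox 0 1 - ball c d = {}")
    case True
    then have "dist t c < d" if "t \<in> cbox 0 1" for t using that by (auto simp: dist_commute)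
    then show thesis using that[of 0] by auto
  next
    case False
    have "compact (cbox 0 1 - ball c d)" by (intro compact_diff compact_cbox open_ball)
    from continuous_attains_sup[OF this False pc] obtain x where
      x: "x \<in> cbox 0 1 - ball c d" "\<And>y. y \<in> cbox 0 1 - ball c d \<Longrightarrow> p y \<le> p x" by blast
    have "p x \<noteq> 1" using p_max x(1) d(1) by auto
    then show thesis using that[of "p x"] p_bounds[of x] x(2) by (auto simp: dist_commute)
  qed
  \<comment> \<open>Near \<open>c\<close> the powers of \<open>p\<close> are at least those of \<open>r'\<close>, away from \<open>c\<close> at most those of \<open>r < r'\<close>.\<close>
  define r' where "r' = (1 + r) / 2"
  have r': "r < r'" "r' < 1" "0 < r'" using r by (auto simp: r'_def)
  obtain d1 where d1: "0 < d1" "\<And>t. dist t c < d1 \<Longrightarrow> r' < p t"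
  proof -
    have "\<exists>d>0. \<forall>x\<in>UNIV. dist x c < d \<longrightarrow> dist (p x) (p c) < 1 - r'"
      using pc[of UNIV] r' by (auto simp: continuous_on_iff)
    then show thesis using that p_c by (auto simp: dist_real_def) (smt (verit))
  qed
  define e where "e = min d (min d1 (1/2))"
  have e: "0 < e" "e \<le> d" "e \<le> d1" "e \<le> 1/2" using d d1 by (auto simp: e_def)
  let ?B = "ball c e"
  have BQ: "?B \<subseteq> ?Q"
  proof
    fix t assume "t \<in> ?B"
    then have n: "norm (t - c) < 1/2" using e by (simp add: dist_norm norm_minus_commute)
    have "\<bar>t $ i - 1/2\<bar> < 1/2" for i
      using component_le_norm_cart[of "t - c" i] n by (simp add: c_def)
    then show "t \<in> ?Q" by (auto simp: unit_cube_def abs_less_iff) (smt (verit) field_sum_of_halves)+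
  qed
  let ?V = "measure lborel ?B" and ?W = "measure lborel ?Q"
  have V: "0 < ?V" using e(1) by (simp add: content_ball_pos)
  have key: "h / 2 * r' ^ N * ?V \<le> M * r ^ N * ?W" for N
  proof -
    have i1: "integrable lborel (\<lambda>t. indicator ?B t * (h / 2 * r' ^ N))"
      using emeasure_bounded_finite[OF bounded_ball[of c e]] by (intro integrable_mult_left integrable_real_indicator) auto
    have i2: "integrable lborel (\<lambda>t. indicator ?Q t * (M * r ^ N))"
      using emeasure_unit_cube_finite by (intro integrable_mult_left integrable_real_indicator) auto
    have i3: "integrable lborel (\<lambda>t. indicator ?Q t * (p t ^ N * R t))"
    proof -
      have "integrable lborel (\<lambda>t. indicator ?Q t *\<^sub>R (p t ^ N * R t))"
        by (intro integrable_on_unit_cube continuous_intros pc Rcont)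
      then show ?thesis by simp
    qed
    have "(LINT t|lborel. indicator ?B t * (h / 2 * r' ^ N) - indicator ?Q t * (M * r ^ N)) \<le>
       (LINT t|lborel. indicator ?Q t * (p t ^ N * R t))"
    proof (rule integral_mono)
      fix t
      have pN: "0 \<le> p t ^ N" "0 \<le> M * r ^ N" using p_bounds \<open>0 \<le> M\<close> r by auto
      show "indicator ?B t * (h / 2 * r' ^ N) - indicator ?Q t * (M * r ^ N) \<le> indicator ?Q t * (p t ^ N * R t)"
      proof (cases "t \<in> ?Q")
        case False
        then show ?thesis using BQ by (auto simp: indicator_def)
      next
        case True
        note tb = Qbox[OF True]
        show ?thesis
        proof (cases "dist t c < d")
          case near: True
          then have Rt: "h / 2 < R t" using d tb by auto
          have "h / 2 * r' ^ N \<le> p t ^ N * R t" if "t \<in> ?B"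
          proof -
            have "r' ^ N \<le> p t ^ N" using d1(2)[of t] that e r' by (intro power_mono) (auto simp: dist_commute less_imp_le)
            then have "r' ^ N * (h / 2) \<le> p t ^ N * R t" using Rt h r' pN by (intro mult_mono) auto
            then show ?thesis by (simp add: mult.commute)
          qed
          moreover have "0 \<le> p t ^ N * R t" using pN Rt h by (intro mult_nonneg_nonneg) auto
          ultimately show ?thesis using True pN by (auto simp: indicator_def)
        next
          case far: False
          then have "t \<notin> ?B" using e by (auto simp: dist_commute)
          have "p t ^ N \<le> r ^ N" using r(3)[OF tb far] p_bounds by (intro power_mono) auto
          then have "p t ^ N * \<bar>R t\<bar> \<le> r ^ N * M" using M[OF tb] r pN by (intro mult_mono) auto
          moreover have "- (p t ^ N * \<bar>R t\<bar>) \<le> p t ^ N * R t"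
            using pN(1) by (metis abs_ge_minus_self abs_mult abs_of_nonneg minus_le_iff)
          ultimately show ?thesis using True \<open>t \<notin> ?B\<close> by (simp add: mult.commute)
        qed
      qed
    qed (use i1 i2 i3 in auto)
    then show ?thesis using i1 i2 unfolding R0 by (simp add: mult.commute mult.left_commute)
  qed
  have "(\<lambda>N. M * ?W * (r / r') ^ N) \<longlonglongrightarrow> M * ?W * 0"
    using r r' by (intro tendsto_intros LIMSEQ_power_zero) auto
  moreover have "h / 2 * ?V \<le> M * ?W * (r / r') ^ N" for N
    using key[of N] r' by (simp add: power_divide field_simps)
  ultimately have "h / 2 * ?V \<le> M * ?W * 0" by (intro LIMSEQ_le_const) auto
  then show False using h V by (simp add: mult_le_0_iff)
qed

text \<open>The periodisation \<open>G\<close> of \<open>f\<close> and the Fourier series \<open>T\<close> have the same Fourier coefficients: for \<open>G\<close> the sum over the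
lattice and the integral over the cube combine to an integral over the whole space. Both are continuous, by the two
summability assumptions, so they agree at the centre of the cube.\<close>

theorem poisson_summation:
  fixes f :: "real^'m::finite \<Rightarrow> complex"
  assumes f: "continuous_on UNIV f"
    and M: "\<And>\<kappa> t. t \<in> cbox (-1) 1 \<Longrightarrow> norm (f (t + int_vec \<kappa>)) \<le> M \<kappa>" and sM: "M summable_on UNIV"
    and ft: "(\<lambda>\<kappa>. norm (fourier f (int_vec \<kappa>))) summable_on UNIV"
  shows "((\<lambda>\<kappa>. f (int_vec \<kappa>)) has_sum (\<Sum>\<^sub>\<infinity>\<kappa>. fourier f (int_vec \<kappa>))) UNIV"
proof -
  define c :: "real^'m" where "c = (\<chi> i. 1/2)"
  let ?Q = "unit_cube :: (real^'m) set"
  let ?F = "\<lambda>\<kappa>. fourier f (int_vec \<kappa>)"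
  have [measurable]: "f \<in> borel_measurable borel" by (intro borel_measurable_continuous_onI f)
  have fm: "fourier f \<omega> = (LINT x|lborel. f x * cis (- 2 * pi * (x \<bullet> \<omega>)))" for \<omega>
    by (rule fourier_lborel) simp
  have tc: "t - c \<in> cbox (-1) 1" if "t \<in> cbox 0 1" for t
    using that by (auto simp: mem_box_cart c_def) (smt (verit) field_sum_of_halves)+
  have Mb: "norm (f (t - c + int_vec \<kappa>)) \<le> M \<kappa>" if "t \<in> cbox 0 1" for t \<kappa>
    using M[OF tc[OF that]] .
  have fcont: "continuous_on A (\<lambda>t. f (t - c + int_vec \<kappa>))" for A \<kappa>
    by (intro continuous_on_compose2[OF f] continuous_intros) auto
  \<comment> \<open>The shift by \<open>c\<close> makes the value of \<open>G\<close> at the centre of the cube the sum of \<open>f\<close> over the lattice.\<close>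
  define G where "G t = (\<Sum>\<^sub>\<infinity>\<kappa>. f (t - c + int_vec \<kappa>))" for t
  define b where "b \<kappa> = unit_char (- \<kappa>) c * ?F \<kappa>" for \<kappa>
  define T where "T t = (\<Sum>\<^sub>\<infinity>\<kappa>. b \<kappa> * unit_char \<kappa> t)" for t
  have nb: "norm (b \<kappa> * unit_char \<kappa> t) = norm (?F \<kappa>)" for \<kappa> t by (simp add: b_def norm_mult)
  have Gc: "continuous_on (cbox 0 1) G"
    unfolding G_def using Mb sM
    by (intro uniform_limit_theorem[OF _ Weierstrass_m_test_general[where M=M]] always_eventually allI continuous_on_sum fcont) auto
  have Tc: "continuous_on A T" for A
    unfolding T_def
    by (intro uniform_limit_theorem[OF _ Weierstrass_m_test_general[OF _ ft]] always_eventually allI continuous_on_sum continuous_intros)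
       (simp_all add: nb)
  have summ1: "(\<lambda>\<kappa>. norm (f (t - c + int_vec \<kappa>))) summable_on UNIV" if "t \<in> cbox 0 1" for t
    using Mb[OF that] by (intro Infinite_Sum.abs_summable_on_comparison_test'[OF sM])
  have fi: "integrable lborel (\<lambda>t. f (t - c))"
    by (rule integrable_tiling[OF _ _ sM]) (use Mb unit_cube_subset in \<open>auto simp: algebra_simps\<close>)
  have G_coeff: "(LINT t|lborel. indicator ?Q t *\<^sub>R (unit_char \<mu> t * G t)) = unit_char \<mu> c * ?F (- \<mu>)" for \<mu>
  proof -
    let ?f = "\<lambda>\<kappa> t. indicator ?Q t *\<^sub>R (unit_char \<mu> t * f (t - c + int_vec \<kappa>))"
    have "((\<lambda>\<kappa>. LINT t|lborel. ?f \<kappa> t) has_sum (LINT t|lborel. (\<Sum>\<^sub>\<infinity>\<kappa>. ?f \<kappa> t))) UNIV"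
    proof (rule has_sum_integral(2))
      show i: "integrable lborel (?f \<kappa>)" for \<kappa>
        by (intro integrable_on_unit_cube continuous_intros fcont)
      show "(\<lambda>\<kappa>. LINT t|lborel. norm (?f \<kappa> t)) summable_on UNIV"
      proof (rule summable_on_comparison_test)
        show "(\<lambda>\<kappa>. M \<kappa> * measure lborel ?Q) summable_on UNIV" by (intro summable_on_cmult_left sM)
        fix \<kappa> :: "int^'m"
        have "(LINT t|lborel. norm (?f \<kappa> t)) \<le> (LINT t|lborel. indicator ?Q t * M \<kappa>)"
        proof (rule integral_mono)
          show "integrable lborel (\<lambda>t. indicator ?Q t * M \<kappa>)"
            using emeasure_unit_cube_finite by (intro integrable_mult_left integrable_real_indicator) auto
          show "norm (?f \<kappa> t) \<le> indicator ?Q t * M \<kappa>" for t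
            using Mb[of t \<kappa>] unit_cube_subset by (auto simp: indicator_def norm_mult)
        qed (intro integrable_norm i)
        then show "(LINT t|lborel. norm (?f \<kappa> t)) \<le> M \<kappa> * measure lborel ?Q" by (simp add: mult.commute)
      qed auto
      show "(\<lambda>\<kappa>. norm (?f \<kappa> t)) summable_on UNIV" for t
      proof (cases "t \<in> ?Q")
        case True
        then show ?thesis using summ1[of t] subsetD[OF unit_cube_subset, of t] by (simp add: norm_mult)
      qed simp
    qed
    also have "(\<lambda>t. \<Sum>\<^sub>\<infinity>\<kappa>. ?f \<kappa> t) = (\<lambda>t. indicator ?Q t *\<^sub>R (unit_char \<mu> t * G t))"
    proof
      fix t
      show "(\<Sum>\<^sub>\<infinity>\<kappa>. ?f \<kappa> t) = indicator ?Q t *\<^sub>R (unit_char \<mu> t * G t)"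
      proof (cases "t \<in> ?Q")
        case True
        then have "t \<in> cbox 0 1" using unit_cube_subset by blast
        from infsum_cmult_right[OF abs_summable_summable[OF summ1[OF this]], of "unit_char \<mu> t"] True
        show ?thesis by (simp add: G_def)
      qed simp
    qed
    finally have 1: "((\<lambda>\<kappa>. LINT t|lborel. ?f \<kappa> t) has_sum (LINT t|lborel. indicator ?Q t *\<^sub>R (unit_char \<mu> t * G t))) UNIV" .
    have "integrable lborel (\<lambda>t. unit_char \<mu> t * f (t - c))"
      by (rule Bochner_Integration.integrable_bound[OF fi]) (auto simp: norm_mult)
    from integral_tiling[OF this]
    have "((\<lambda>\<kappa>. LINT t|lborel. ?f \<kappa> t) has_sum (LINT t|lborel. unit_char \<mu> t * f (t - c))) UNIV"
      by (simp add: unit_char_periodic algebra_simps)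
    with 1 have "(LINT t|lborel. indicator ?Q t *\<^sub>R (unit_char \<mu> t * G t)) = (LINT t|lborel. unit_char \<mu> t * f (t - c))"
      using has_sum_unique by blast
    also have "\<dots> = (LINT t|lborel. unit_char \<mu> (t + c) * f t)"
      using integral_shift[of "\<lambda>t. unit_char \<mu> t * f (t - c)" c] by simp
    also have "\<dots> = (LINT t|lborel. unit_char \<mu> c * (f t * cis (- 2 * pi * (t \<bullet> int_vec (- \<mu>)))))"
      by (intro Bochner_Integration.integral_cong refl)
         (simp add: unit_char_def int_vec_simps inner_add_right distrib_left cis_mult[symmetric] inner_commute algebra_simps)
    finally show ?thesis unfolding fm by simp
  qed
  have T_coeff: "(LINT t|lborel. indicator ?Q t *\<^sub>R (unit_char \<mu> t * T t)) = unit_char \<mu> c * ?F (- \<mu>)" for \<mu>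
  proof -
    let ?f = "\<lambda>\<kappa> t. b \<kappa> * (indicator ?Q t *\<^sub>R unit_char (\<mu> + \<kappa>) t)"
    have nf: "norm (?f \<kappa> t) = norm (?F \<kappa>) * indicator ?Q t" for \<kappa> t by (simp add: b_def norm_mult)
    have bs: "(\<lambda>\<kappa>. b \<kappa> * unit_char \<kappa> t) summable_on UNIV" for t
      by (rule abs_summable_summable) (simp add: nb ft)
    have "((\<lambda>\<kappa>. LINT t|lborel. ?f \<kappa> t) has_sum (LINT t|lborel. (\<Sum>\<^sub>\<infinity>\<kappa>. ?f \<kappa> t))) UNIV"
    proof (rule has_sum_integral(2))
      show i: "integrable lborel (?f \<kappa>)" for \<kappa>
        by (intro integrable_mult_right integrable_on_unit_cube continuous_intros)
      show "(\<lambda>\<kappa>. LINT t|lborel. norm (?f \<kappa> t)) summable_on UNIV"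
      proof -
        have "(\<lambda>\<kappa>. norm (?F \<kappa>) * measure lborel ?Q) summable_on UNIV" by (rule summable_on_cmult_left[OF ft])
        then show ?thesis unfolding nf by simp
      qed
      show "(\<lambda>\<kappa>. norm (?f \<kappa> t)) summable_on UNIV" for t
        unfolding nf by (intro summable_on_cmult_left ft)
    qed
    also have "(\<lambda>t. \<Sum>\<^sub>\<infinity>\<kappa>. ?f \<kappa> t) = (\<lambda>t. indicator ?Q t *\<^sub>R (unit_char \<mu> t * T t))"
    proof
      fix t
      have "(\<Sum>\<^sub>\<infinity>\<kappa>. ?f \<kappa> t) = (\<Sum>\<^sub>\<infinity>\<kappa>. (of_real (indicator ?Q t) * unit_char \<mu> t) * (b \<kappa> * unit_char \<kappa> t))"
        by (intro infsum_cong) (simp add: unit_char_add scaleR_conv_of_real algebra_simps)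
      also have "\<dots> = (of_real (indicator ?Q t) * unit_char \<mu> t) * T t"
        unfolding T_def by (intro infsum_cmult_right bs)
      finally show "(\<Sum>\<^sub>\<infinity>\<kappa>. ?f \<kappa> t) = indicator ?Q t *\<^sub>R (unit_char \<mu> t * T t)" by (simp add: scaleR_conv_of_real)
    qed
    finally have 1: "((\<lambda>\<kappa>. LINT t|lborel. ?f \<kappa> t) has_sum (LINT t|lborel. indicator ?Q t *\<^sub>R (unit_char \<mu> t * T t))) UNIV" .
    have "(LINT t|lborel. ?f \<kappa> t) = (if \<kappa> = - \<mu> then b \<kappa> else 0)" for \<kappa>
    proof -
      have "(LINT t|lborel. ?f \<kappa> t) = b \<kappa> * (LINT t|lborel. indicator ?Q t *\<^sub>R unit_char (\<mu> + \<kappa>) t)"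
        by (rule integral_mult_right_zero)
      then show ?thesis unfolding integral_unit_char by (simp add: eq_neg_iff_add_eq_0 add.commute)
    qed
    with 1 have "((\<lambda>\<kappa>. if \<kappa> = - \<mu> then b \<kappa> else 0) has_sum (LINT t|lborel. indicator ?Q t *\<^sub>R (unit_char \<mu> t * T t))) UNIV"
      by simp
    moreover have "((\<lambda>\<kappa>. if \<kappa> = - \<mu> then b \<kappa> else 0) has_sum b (- \<mu>)) UNIV"
      by (rule has_sum_cong_neutral[THEN iffD1, OF _ _ _ has_sum_finite[of "{-\<mu>}", simplified]]) auto
    ultimately show ?thesis using has_sum_unique by (fastforce simp: b_def)
  qed
  have "G c - T c = 0"
    unfolding c_def
  proof (rule vanishing_coefficients_imp_zero)
    show "continuous_on (cbox 0 1) (\<lambda>t. G t - T t)" by (intro continuous_intros Gc Tc)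
    fix \<kappa> :: "int^'m"
    have "(LINT t|lborel. indicator ?Q t *\<^sub>R (unit_char \<kappa> t * (G t - T t)))
      = (LINT t|lborel. indicator ?Q t *\<^sub>R (unit_char \<kappa> t * G t) - indicator ?Q t *\<^sub>R (unit_char \<kappa> t * T t))"
      by (intro Bochner_Integration.integral_cong refl) (simp add: algebra_simps)
    also have "\<dots> = (LINT t|lborel. indicator ?Q t *\<^sub>R (unit_char \<kappa> t * G t)) - (LINT t|lborel. indicator ?Q t *\<^sub>R (unit_char \<kappa> t * T t))"
      by (intro Bochner_Integration.integral_diff integrable_on_unit_cube continuous_intros Gc Tc)
    finally show "(LINT t|lborel. indicator ?Q t *\<^sub>R (unit_char \<kappa> t * (G t - T t))) = 0"
      by (simp add: G_coeff T_coeff)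
  qed
  moreover have "T c = (\<Sum>\<^sub>\<infinity>\<kappa>. ?F \<kappa>)"
  proof -
    have "unit_char (- \<kappa>) c * unit_char \<kappa> c = 1" for \<kappa> :: "int^'m"
      unfolding unit_char_add[symmetric] by (simp add: unit_char_def int_vec_simps)
    then show ?thesis unfolding T_def b_def by (intro infsum_cong) (simp add: ac_simps)
  qed
  moreover have "((\<lambda>\<kappa>. f (int_vec \<kappa>)) has_sum G c) UNIV"
  proof -
    have "c \<in> cbox 0 1" by (simp add: c_def mem_box_cart)
    from has_sum_infsum[OF abs_summable_summable[OF summ1[OF this]]] show ?thesis by (simp add: G_def)
  qed
  ultimately show ?thesis by simp
qed

section \<open>Parameter integrals\<close>

text \<open>The majorant \<open>a x * b (y + \<tau> x)\<close> covers integrands of product type, with \<open>\<tau> = 0\<close>, and of convolution type, where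
\<open>\<tau> x\<close> is \<open>x\<close> or \<open>- x\<close>. Its integral over \<open>y\<close> is a multiple of \<open>a x\<close> by translation invariance.\<close>

lemma fubini_convolution_bound:
  fixes f :: "'a::euclidean_space \<Rightarrow> 'b::euclidean_space \<Rightarrow> 'c::{banach,second_countable_topology}"
  assumes meas: "(\<lambda>p. f (fst p) (snd p)) \<in> borel_measurable (borel \<Otimes>\<^sub>M borel)"
    and a: "integrable lborel a" and b: "integrable lborel b"
    and bound: "\<And>x y. norm (f x y) \<le> a x * b (y + \<tau> x)"
  shows "integrable (lborel \<Otimes>\<^sub>M lborel) (\<lambda>(x, y). f x y)"
    and "integrable lborel (\<lambda>x. LINT y|lborel. f x y)"
    and "integrable lborel (\<lambda>y. LINT x|lborel. f x y)"
    and "(LINT x|lborel. LINT y|lborel. f x y) = (LINT y|lborel. LINT x|lborel. f x y)"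
proof -
  have m [measurable]: "(\<lambda>p. f (fst p) (snd p)) \<in> borel_measurable (lborel \<Otimes>\<^sub>M lborel)"
    using meas unfolding lborel_prod borel_prod by simp
  have [measurable]: "f x \<in> borel_measurable lborel" for x
    using measurable_compose[OF measurable_Pair1' m, of x] by (simp add: space_pair_measure)
  have bx: "integrable lborel (\<lambda>y. a x * b (y + \<tau> x))" for x
    by (intro integrable_mult_right integrable_shift b)
  have fx: "integrable lborel (f x)" for x
    by (rule Bochner_Integration.integrable_bound[OF bx[of x]]) (use bound in \<open>auto intro!: AE_I2 order_trans[OF bound] abs_ge_self\<close>)
  have "integrable (lborel \<Otimes>\<^sub>M lborel) (\<lambda>p. f (fst p) (snd p))"
  proof (rule lborel_pair.Fubini_integrable)
    have "integrable lborel (\<lambda>x. a x * (LINT y|lborel. b y))" by (intro integrable_mult_left a)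
    then show "integrable lborel (\<lambda>x. LINT y|lborel. norm (f (fst (x, y)) (snd (x, y))))"
    proof (rule Bochner_Integration.integrable_bound)
      show "AE x in lborel. norm (LINT y|lborel. norm (f (fst (x, y)) (snd (x, y)))) \<le> norm (a x * (LINT y|lborel. b y))"
      proof (rule AE_I2)
        fix x
        have "(LINT y|lborel. norm (f x y)) \<le> (LINT y|lborel. a x * b (y + \<tau> x))"
          by (intro integral_mono integrable_norm fx bx bound)
        also have "\<dots> = a x * (LINT y|lborel. b y)"
          using borel_measurable_integrable[OF b] by (simp add: integral_shift)
        finally show "norm (LINT y|lborel. norm (f (fst (x, y)) (snd (x, y)))) \<le> norm (a x * (LINT y|lborel. b y))"
          by (simp add: abs_of_nonneg[OF integral_nonneg_AE] order_trans[OF _ abs_ge_self])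
      qed
      have "(\<lambda>x. LINT y|lborel. (\<lambda>x y. norm (f (fst (x, y)) (snd (x, y)))) x y) \<in> borel_measurable lborel"
        by (rule lborel.borel_measurable_lebesgue_integral) (simp add: split_beta')
      then show "(\<lambda>x. LINT y|lborel. norm (f (fst (x, y)) (snd (x, y)))) \<in> borel_measurable lborel" by simp
    qed
  qed (use fx in auto)
  then have i: "integrable (lborel \<Otimes>\<^sub>M lborel) (\<lambda>(x, y). f x y)" by (simp add: split_beta')
  show "integrable (lborel \<Otimes>\<^sub>M lborel) (\<lambda>(x, y). f x y)" by (rule i)
  show "integrable lborel (\<lambda>x. LINT y|lborel. f x y)"
    using lborel_pair.integrable_fst[OF i] .
  show "integrable lborel (\<lambda>y. LINT x|lborel. f x y)"
    using lborel_pair.integrable_snd[OF i] .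
  show "(LINT x|lborel. LINT y|lborel. f x y) = (LINT y|lborel. LINT x|lborel. f x y)"
    using lborel_pair.Fubini_integral[OF i] by simp
qed

lemma continuous_on_param_integral:
  fixes f :: "'a::metric_space \<Rightarrow> 'b \<Rightarrow> 'c::{banach,second_countable_topology}"
  assumes m: "\<And>x. f x \<in> borel_measurable M"
    and c: "\<And>t. continuous_on UNIV (\<lambda>x. f x t)"
    and w: "integrable M w" and b: "\<And>x t. norm (f x t) \<le> w t"
  shows "continuous_on UNIV (\<lambda>x. LINT t|M. f x t)"
  unfolding continuous_on_sequentially
proof (intro ballI allI impI, elim conjE)
  fix a and x :: "nat \<Rightarrow> 'a" assume lim: "x \<longlonglongrightarrow> a"
  have "(\<lambda>n. LINT t|M. f (x n) t) \<longlonglongrightarrow> (LINT t|M. f a t)"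
  proof (rule integral_dominated_convergence[OF m m w])
    show "AE t in M. (\<lambda>n. f (x n) t) \<longlonglongrightarrow> f a t"
      using c lim unfolding continuous_on_sequentially by (auto simp: o_def)
    show "AE t in M. norm (f (x n) t) \<le> w t" for n using b by simp
  qed
  then show "((\<lambda>x. LINT t|M. f x t) \<circ> x) \<longlonglongrightarrow> (LINT t|M. f a t)" by (simp add: o_def)
qed

lemma measurable_cis [measurable (raw)]:
  assumes "f \<in> borel_measurable M"
  shows "(\<lambda>x. cis (f x)) \<in> borel_measurable M"
  by (rule measurable_compose[OF assms]) (intro borel_measurable_continuous_onI continuous_intros)

section \<open>Schwartz functions\<close>

lemma partial_deriv_eqI: "(f has_derivative D) (at x) \<Longrightarrow> partial_deriv i f x = D (axis i 1)"
  unfolding partial_deriv_def using frechet_derivative_at by metis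

lemma iter_deriv_Nil [simp]: "iter_deriv [] f = f"
  and iter_deriv_Cons: "iter_deriv (i # \<alpha>) f = partial_deriv i (iter_deriv \<alpha> f)"
  and iter_deriv_append: "iter_deriv (\<alpha> @ \<beta>) f = iter_deriv \<alpha> (iter_deriv \<beta> f)"
  by (simp_all add: iter_deriv_def)

lemma schwartz_differentiable: "f \<in> schwartz \<Longrightarrow> f differentiable (at x)"
  unfolding schwartz_def by (auto dest!: spec[of _ "[]"])

lemma schwartz_bounded: "f \<in> schwartz \<Longrightarrow> bounded (range (\<lambda>x. norm x ^ k *\<^sub>R f x))"
  unfolding schwartz_def by (auto dest!: spec[of _ "[]"])

lemma schwartz_partial_deriv: "f \<in> schwartz \<Longrightarrow> partial_deriv i f \<in> schwartz"
  unfolding schwartz_def mem_Collect_eq iter_deriv_Cons[of i "[]", simplified, symmetric] iter_deriv_append[symmetric]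
  by blast

text \<open>Schwartz functions form the greatest set of differentiable, rapidly decreasing functions that is closed under
partial derivatives. This replaces explicit formulas for iterated derivatives of sums, modulations, translations
and Gaussians.\<close>

lemma schwartz_coinduct:
  assumes "f \<in> K"
    and d: "\<And>f x. f \<in> K \<Longrightarrow> f differentiable (at x)"
    and p: "\<And>f i. f \<in> K \<Longrightarrow> partial_deriv i f \<in> K"
    and b: "\<And>f k. f \<in> K \<Longrightarrow> bounded (range (\<lambda>x. norm x ^ k *\<^sub>R f x))"
  shows "f \<in> schwartz"
proof -
  have "iter_deriv \<alpha> f \<in> K" for \<alpha>
    by (induction \<alpha>) (auto simp: iter_deriv_Cons assms(1) p)
  then show ?thesis unfolding schwartz_def using d b by auto
qed

lemma schwartz_has_derivative:
  "f \<in> schwartz \<Longrightarrow> (f has_derivative frechet_derivative f (at x)) (at x)"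
  using schwartz_differentiable frechet_derivative_works by blast

lemma schwartz_lincomb:
  assumes "f \<in> schwartz" "g \<in> schwartz"
  shows "(\<lambda>x. a * f x + b * g x) \<in> schwartz"
proof (rule schwartz_coinduct[where K="{(\<lambda>x. a * f x + b * g x) | f g. f \<in> schwartz \<and> g \<in> schwartz}"])
  have D: "((\<lambda>x. a * f x + b * g x) has_derivative (\<lambda>h. a * frechet_derivative f (at x) h + b * frechet_derivative g (at x) h)) (at x)"
    if "f \<in> schwartz" "g \<in> schwartz" for f g x
    using that by (intro has_derivative_add has_derivative_mult_right schwartz_has_derivative)
  { fix F assume "F \<in> {(\<lambda>x. a * f x + b * g x) | f g. f \<in> schwartz \<and> g \<in> schwartz}"
    then obtain f g where F: "F = (\<lambda>x. a * f x + b * g x)" "f \<in> schwartz" "g \<in> schwartz" by blast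
    show "F differentiable (at x)" for x using D F unfolding differentiable_def by blast
    show "partial_deriv i F \<in> {(\<lambda>x. a * f x + b * g x) | f g. f \<in> schwartz \<and> g \<in> schwartz}" for i
    proof -
      have "partial_deriv i F = (\<lambda>x. a * partial_deriv i f x + b * partial_deriv i g x)"
        unfolding F(1) using D[OF F(2,3)] by (intro ext partial_deriv_eqI[THEN trans]) (auto simp: partial_deriv_def)
      then show ?thesis using F schwartz_partial_deriv by blast
    qed
    show "bounded (range (\<lambda>x. norm x ^ k *\<^sub>R F x))" for k
    proof -
      obtain A B where "\<And>x. norm (norm x ^ k *\<^sub>R f x) \<le> A" "\<And>x. norm (norm x ^ k *\<^sub>R g x) \<le> B"
        using schwartz_bounded[OF F(2), of k] schwartz_bounded[OF F(3), of k] unfolding bounded_iff by blast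
      then have "norm (norm x ^ k *\<^sub>R F x) \<le> norm a * A + norm b * B" for x
      proof -
        have "norm x ^ k *\<^sub>R F x = a * (norm x ^ k *\<^sub>R f x) + b * (norm x ^ k *\<^sub>R g x)"
          by (simp add: F(1) algebra_simps)
        also have "norm \<dots> \<le> norm a * norm (norm x ^ k *\<^sub>R f x) + norm b * norm (norm x ^ k *\<^sub>R g x)"
          unfolding norm_mult[symmetric] by (rule norm_triangle_ineq)
        also have "\<dots> \<le> norm a * A + norm b * B"
          by (intro add_mono mult_left_mono \<open>\<And>x. norm (norm x ^ k *\<^sub>R f x) \<le> A\<close> \<open>\<And>x. norm (norm x ^ k *\<^sub>R g x) \<le> B\<close>) auto
        finally show ?thesis .
      qed
      then show ?thesis unfolding bounded_iff by blast
    qed }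
qed (use assms in blast)

lemma has_derivative_cis_inner:
  "((\<lambda>t. cis (c * (y \<bullet> t))) has_derivative (\<lambda>h. \<i> * of_real (c * (y \<bullet> h)) * cis (c * (y \<bullet> x)))) (at x)"
proof -
  have "((\<lambda>t. \<i> * of_real (c * (y \<bullet> t))) has_derivative (\<lambda>h. \<i> * of_real (c * (y \<bullet> h)))) (at x)"
    by (intro has_derivative_mult_right has_derivative_of_real has_derivative_inner_right has_derivative_ident)
  then have "((\<lambda>t. exp (\<i> * of_real (c * (y \<bullet> t)))) has_derivative
      (\<lambda>h. exp (\<i> * of_real (c * (y \<bullet> x))) * (\<i> * of_real (c * (y \<bullet> h))))) (at x)"
    by (rule has_derivative_compose) (rule DERIV_exp[unfolded has_field_derivative_def])
  then show ?thesis by (simp add: cis_conv_exp mult.commute)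
qed

lemma schwartz_modulation:
  assumes "f \<in> schwartz"
  shows "modulation \<omega> f \<in> schwartz"
proof (rule schwartz_coinduct[where K="modulation \<omega> ` schwartz"])
  { fix F assume "F \<in> modulation \<omega> ` schwartz"
    then obtain f where F: "F = modulation \<omega> f" "f \<in> schwartz" by blast
    have D: "(F has_derivative (\<lambda>h. cis (2 * pi * (\<omega> \<bullet> x)) * frechet_derivative f (at x) h
       + \<i> * of_real (2 * pi * (\<omega> \<bullet> h)) * cis (2 * pi * (\<omega> \<bullet> x)) * f x)) (at x)" for x
      unfolding F(1) modulation_def
      by (intro has_derivative_mult has_derivative_cis_inner schwartz_has_derivative F)
    show "F differentiable (at x)" for x using D unfolding differentiable_def by blast
    show "partial_deriv i F \<in> modulation \<omega> ` schwartz" for i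
    proof -
      have "partial_deriv i F = modulation \<omega> (\<lambda>x. 1 * partial_deriv i f x + (\<i> * of_real (2 * pi * \<omega> $ i)) * f x)"
        by (rule ext, rule trans[OF partial_deriv_eqI[OF D]])
           (simp add: modulation_def partial_deriv_def inner_axis algebra_simps)
      then show ?thesis using schwartz_lincomb[OF schwartz_partial_deriv[OF F(2)] F(2)] by blast
    qed
    have "norm (norm x ^ k *\<^sub>R F x) = norm (norm x ^ k *\<^sub>R f x)" for x k
      by (simp add: F(1) modulation_def norm_mult)
    then show "bounded (range (\<lambda>x. norm x ^ k *\<^sub>R F x))" for k
      using schwartz_bounded[OF F(2), of k] unfolding bounded_iff by (simp del: norm_scaleR) }
qed (use assms in blast)

lemma schwartz_decay_power:
  assumes "f \<in> schwartz"
  obtains B where "0 < B" "\<And>x. (1 + norm x) ^ N * norm (f x) \<le> B"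
proof -
  obtain A1 A2 where A: "\<And>x. norm (norm x ^ 0 *\<^sub>R f x) \<le> A1" "\<And>x. norm (norm x ^ N *\<^sub>R f x) \<le> A2"
    using schwartz_bounded[OF assms, of 0] schwartz_bounded[OF assms, of N] unfolding bounded_iff by blast
  have A0: "0 \<le> A1" "0 \<le> A2" using order_trans[OF norm_ge_zero A(1)] order_trans[OF norm_ge_zero A(2)] by auto
  have "(1 + norm x) ^ N * norm (f x) \<le> 2 ^ N * (A1 + A2)" for x
  proof -
    have "(1 + norm x) ^ N * norm (f x) \<le> 2 ^ N * ((1 + norm x ^ N) * norm (f x))"
      unfolding mult.assoc[symmetric] by (intro mult_right_mono one_plus_power_le) auto
    also have "(1 + norm x ^ N) * norm (f x) \<le> A1 + A2" using A[of x] by (simp add: algebra_simps abs_mult)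
    finally show ?thesis by simp
  qed
  then show thesis using that[of "2 ^ N * (A1 + A2) + 1"] A0 by (smt (verit) mult_nonneg_nonneg zero_le_power)
qed

lemma schwartz_decay:
  fixes f :: "real^'n::finite \<Rightarrow> complex"
  assumes "f \<in> schwartz"
  obtains B where "0 < B" "\<And>x. norm (f x) \<le> B * decay x"
  by (rule schwartz_decay_power[OF assms]) (rule that[OF _ le_mult_decay])

lemma schwartz_continuous: "f \<in> schwartz \<Longrightarrow> continuous_on A f"
  by (intro continuous_at_imp_continuous_on ballI differentiable_imp_continuous_within schwartz_differentiable)

lemma schwartz_measurable: "f \<in> schwartz \<Longrightarrow> f \<in> borel_measurable borel"
  by (intro borel_measurable_continuous_onI schwartz_continuous)

lemma integrable_decay_bound:
  fixes f :: "real^'n::finite \<Rightarrow> 'b::{banach,second_countable_topology}"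
  assumes "f \<in> borel_measurable borel" "\<And>x. norm (f x) \<le> B * decay x"
  shows "integrable lborel f"
proof (rule Bochner_Integration.integrable_bound)
  show "integrable lborel (\<lambda>x. B * decay (x::real^'n))" by (intro integrable_mult_right integrable_decay)
  show "AE x in lborel. norm (f x) \<le> norm (B * decay x)"
    using assms(2) by (intro AE_I2) (auto intro: order_trans[OF _ abs_ge_self])
qed (use assms in auto)

lemma schwartz_integrable: "f \<in> schwartz \<Longrightarrow> integrable lborel f"
  by (metis integrable_decay_bound schwartz_decay schwartz_measurable)

lemma schwartz_translation:
  assumes "f \<in> schwartz"
  shows "translation y f \<in> schwartz"
proof (rule schwartz_coinduct[where K="translation y ` schwartz"])
  { fix F assume "F \<in> translation y ` schwartz"
    then obtain f where F: "F = translation y f" "f \<in> schwartz" by blast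
    have D: "(F has_derivative frechet_derivative f (at (x - y))) (at x)" for x
    proof -
      have "((\<lambda>t. f (t - y)) has_derivative (\<lambda>h. frechet_derivative f (at (x - y)) h)) (at x)"
        by (rule has_derivative_compose[OF _ schwartz_has_derivative[OF F(2)]]) (auto intro!: derivative_eq_intros)
      then show ?thesis by (simp add: F(1) translation_def)
    qed
    show "F differentiable (at x)" for x using D unfolding differentiable_def by blast
    show "partial_deriv i F \<in> translation y ` schwartz" for i
    proof -
      have "partial_deriv i F = translation y (partial_deriv i f)"
        by (rule ext, rule trans[OF partial_deriv_eqI[OF D]]) (simp add: translation_def partial_deriv_def)
      then show ?thesis using schwartz_partial_deriv[OF F(2)] by blast
    qed
    show "bounded (range (\<lambda>x. norm x ^ k *\<^sub>R F x))" for k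
    proof -
      obtain B where B: "0 < B" "\<And>x. (1 + norm x) ^ k * norm (f x) \<le> B"
        using schwartz_decay_power[OF F(2)] by blast
      have "norm (norm x ^ k *\<^sub>R F x) \<le> (1 + norm y) ^ k * B" for x
      proof -
        have "norm x \<le> norm (x - y) + norm y" by (metis diff_add_cancel norm_triangle_ineq)
        also have "\<dots> \<le> (1 + norm y) * (1 + norm (x - y))" by (simp add: algebra_simps)
        finally have "norm x ^ k \<le> (1 + norm y) ^ k * (1 + norm (x - y)) ^ k"
          unfolding power_mult_distrib[symmetric] by (intro power_mono) auto
        then have "norm x ^ k * norm (F x) \<le> (1 + norm y) ^ k * (1 + norm (x - y)) ^ k * norm (f (x - y))"
          unfolding F(1) translation_def by (intro mult_right_mono) auto
        also have "\<dots> \<le> (1 + norm y) ^ k * B" unfolding mult.assoc by (intro mult_left_mono B) auto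
        finally show ?thesis by simp
      qed
      then show ?thesis unfolding bounded_iff by blast
    qed }
qed (use assms in blast)

section \<open>The Fourier transform of Schwartz functions\<close>

lemma fourier_continuous:
  assumes f: "integrable lborel f"
  shows "continuous_on UNIV (fourier f)"
proof -
  have [measurable]: "f \<in> borel_measurable borel" using borel_measurable_integrable[OF f] by simp
  have "continuous_on UNIV (\<lambda>\<omega>. LINT x|lborel. f x * cis (- 2 * pi * (x \<bullet> \<omega>)))"
    by (rule continuous_on_param_integral[where w="\<lambda>x. norm (f x)"])
       (use f in \<open>auto intro!: continuous_intros simp: norm_mult\<close>)
  then show ?thesis by (subst (asm) fourier_lborel[symmetric]) (simp_all add: eta_contract_eq)
qed

lemma norm_fourier_le:
  assumes f: "integrable lborel f"
  shows "norm (fourier f \<omega>) \<le> (LINT x|lborel. norm (f x))"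
proof -
  have [measurable]: "f \<in> borel_measurable borel" using borel_measurable_integrable[OF f] by simp
  have "norm (fourier f \<omega>) \<le> (LINT x|lborel. norm (f x * cis (- 2 * pi * (x \<bullet> \<omega>))))"
    by (subst fourier_lborel) (auto intro: integral_norm_bound)
  then show ?thesis by (simp add: norm_mult)
qed

lemma fourier_shift:
  assumes [measurable]: "f \<in> borel_measurable borel"
  shows "fourier (\<lambda>t. f (t + y)) \<omega> = cis (2 * pi * (y \<bullet> \<omega>)) * fourier f \<omega>"
proof -
  have "fourier (\<lambda>t. f (t + y)) \<omega> = (LINT x|lborel. (\<lambda>t. f t * cis (- 2 * pi * ((t - y) \<bullet> \<omega>))) (x + y))"
    by (subst fourier_lborel) simp_all
  also have "\<dots> = (LINT t|lborel. f t * cis (- 2 * pi * ((t - y) \<bullet> \<omega>)))"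
    by (rule integral_shift) measurable
  also have "\<dots> = (LINT t|lborel. cis (2 * pi * (y \<bullet> \<omega>)) * (f t * cis (- 2 * pi * (t \<bullet> \<omega>))))"
  proof (intro Bochner_Integration.integral_cong refl)
    fix t
    have "- 2 * pi * ((t - y) \<bullet> \<omega>) = 2 * pi * (y \<bullet> \<omega>) + (- 2 * pi * (t \<bullet> \<omega>))"
      by (simp add: inner_diff_left algebra_simps)
    then show "f t * cis (- 2 * pi * ((t - y) \<bullet> \<omega>)) = cis (2 * pi * (y \<bullet> \<omega>)) * (f t * cis (- 2 * pi * (t \<bullet> \<omega>)))"
      by (simp only: cis_mult[symmetric]) (simp only: ac_simps)
  qed
  finally show ?thesis by (simp add: fourier_lborel)
qed

lemma fourier_modulate:
  assumes [measurable]: "f \<in> borel_measurable borel"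
  shows "fourier (\<lambda>t. cis (2 * pi * (y \<bullet> t)) * f t) \<omega> = fourier f (\<omega> - y)"
proof -
  have *: "cis (2 * pi * (y \<bullet> t)) * f t * cis (- 2 * pi * (t \<bullet> \<omega>)) = f t * cis (- 2 * pi * (t \<bullet> (\<omega> - y)))" for t
  proof -
    have "- 2 * pi * (t \<bullet> (\<omega> - y)) = 2 * pi * (y \<bullet> t) + (- 2 * pi * (t \<bullet> \<omega>))"
      by (simp add: inner_diff_right inner_commute algebra_simps)
    then show ?thesis by (simp only: cis_mult[symmetric]) (simp only: ac_simps)
  qed
  have [measurable]: "(\<lambda>t. cis (2 * pi * (y \<bullet> t))) \<in> borel_measurable borel"
    by (subst inner_commute) measurable
  show ?thesis by (subst (1 2) fourier_lborel) (simp_all only: *, measurable)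
qed

text \<open>By the mean value theorem the difference quotients have a common integrable majorant, which is what dominated
convergence needs when \<open>h\<close> tends to \<open>0\<close>.\<close>

lemma schwartz_difference_bound:
  assumes f: "f \<in> schwartz"
  obtains B where "\<And>x h. 0 < h \<Longrightarrow> h \<le> 1 \<Longrightarrow> norm (f (x + h *\<^sub>R axis i 1) - f x) \<le> h * (B * decay x)"
proof -
  let ?e = "axis i (1::real)"
  obtain B where B: "0 < B" "\<And>x. norm (partial_deriv i f x) \<le> B * decay x"
    using schwartz_decay[OF schwartz_partial_deriv[OF f]] by blast
  let ?K = "(1 + 1 + 1::real) ^ (2 * CARD('a))"
  have "norm (f (x + h *\<^sub>R ?e) - f x) \<le> h * (B * ?K * decay x)" if h: "0 < h" "h \<le> 1" for x h
  proof -
    let ?\<phi> = "\<lambda>s. f (x + s *\<^sub>R ?e)"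
    have D: "(?\<phi> has_derivative (\<lambda>r. frechet_derivative f (at (x + s *\<^sub>R ?e)) (r *\<^sub>R ?e))) (at s)" for s
      by (rule has_derivative_compose[OF _ schwartz_has_derivative[OF f]]) (auto intro!: derivative_eq_intros)
    have "continuous_on {0..h} ?\<phi>"
      by (intro continuous_on_compose2[OF schwartz_continuous[OF f, of UNIV]] continuous_intros) auto
    from mvt_general[OF h(1) this D] obtain s where s: "s \<in> {0<..<h}"
      "norm (?\<phi> h - ?\<phi> 0) \<le> norm (frechet_derivative f (at (x + s *\<^sub>R ?e)) ((h - 0) *\<^sub>R ?e))" by blast
    have lin: "linear (frechet_derivative f (at (x + s *\<^sub>R ?e)))"
      using schwartz_has_derivative[OF f] has_derivative_linear by blast
    have "norm x \<le> norm (x + s *\<^sub>R ?e) + norm (s *\<^sub>R ?e)" using norm_triangle_ineq4[of "x + s *\<^sub>R ?e" "s *\<^sub>R ?e"] by simp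
    also have "norm (s *\<^sub>R ?e) \<le> 1" using s h by (simp add: norm_axis_1)
    finally have "decay (x + s *\<^sub>R ?e) \<le> ?K * decay x"
      using decay_perturb[of x 1 "x + s *\<^sub>R ?e" 1] by simp
    have "norm (?\<phi> h - ?\<phi> 0) \<le> h * norm (partial_deriv i f (x + s *\<^sub>R ?e))"
      using s(2) h by (simp add: partial_deriv_def linear_scale[OF lin])
    also have "\<dots> \<le> h * (B * (?K * decay x))"
      using h B(1) by (intro mult_left_mono order_trans[OF B(2)] \<open>decay (x + s *\<^sub>R ?e) \<le> ?K * decay x\<close>) auto
    finally show ?thesis by (simp add: mult.assoc)
  qed
  then show thesis using that by blast
qed

text \<open>The Fourier transform turns the difference quotient of step \<open>h\<close> in direction \<open>i\<close> into multiplication by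
\<open>(cis (2 * pi * h * \<omega> $ i) - 1) / h\<close>. Letting \<open>h\<close> tend to \<open>0\<close> on both sides avoids integration by parts.\<close>

lemma fourier_partial_deriv:
  assumes f: "f \<in> schwartz"
  shows "fourier (partial_deriv i f) \<omega> = 2 * pi * \<i> * (\<omega> $ i) * fourier f \<omega>"
proof -
  let ?e = "axis i (1::real)"
  define s where "s n = inverse (real (Suc n))" for n
  have s: "0 < s n" "s n \<le> 1" for n by (auto simp: s_def field_simps)
  have s0: "s \<longlonglongrightarrow> 0" unfolding s_def by (rule LIMSEQ_inverse_real_of_nat)
  have s_at: "filterlim s (at 0) sequentially" using s0 s(1) by (auto simp: filterlim_at less_imp_neq[symmetric] intro!: always_eventually)
  note [measurable] = schwartz_measurable[OF f] schwartz_measurable[OF schwartz_partial_deriv[OF f, of i]]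
  obtain B where B: "\<And>x h. 0 < h \<Longrightarrow> h \<le> 1 \<Longrightarrow> norm (f (x + h *\<^sub>R ?e) - f x) \<le> h * (B * decay x)"
    using schwartz_difference_bound[OF f] by blast
  let ?q = "\<lambda>n x. (f (x + s n *\<^sub>R ?e) - f x) / s n"
  have lim1: "(\<lambda>n. LINT x|lborel. ?q n x * cis (- 2 * pi * (x \<bullet> \<omega>))) \<longlonglongrightarrow> (LINT x|lborel. partial_deriv i f x * cis (- 2 * pi * (x \<bullet> \<omega>)))"
  proof (rule integral_dominated_convergence[where w="\<lambda>x. B * decay x"])
    show "integrable lborel (\<lambda>x. B * decay (x::real^'a))" by (intro integrable_mult_right integrable_decay)
    show "AE x in lborel. norm (?q n x * cis (- 2 * pi * (x \<bullet> \<omega>))) \<le> B * decay x" for n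
    proof (rule AE_I2)
      fix x
      have "norm (f (x + s n *\<^sub>R ?e) - f x) / s n \<le> B * decay x"
        using B[OF s[of n], of x] s[of n] by (simp add: field_simps)
      then show "norm (?q n x * cis (- 2 * pi * (x \<bullet> \<omega>))) \<le> B * decay x"
        using s(1)[of n] by (simp add: norm_mult norm_divide)
    qed
    show "AE x in lborel. (\<lambda>n. ?q n x * cis (- 2 * pi * (x \<bullet> \<omega>))) \<longlonglongrightarrow> partial_deriv i f x * cis (- 2 * pi * (x \<bullet> \<omega>))"
    proof (intro AE_I2 tendsto_mult_right)
      fix x
      let ?D = "frechet_derivative f (at x)"
      have D: "(f has_derivative ?D) (at x)" by (rule schwartz_has_derivative[OF f])
      have lin: "linear ?D" using D has_derivative_linear by blast
      have "((\<lambda>h. norm (f (x + h) - f x - ?D h) / norm h) \<longlongrightarrow> 0) (at 0)" using D by (simp add: has_derivative_at)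
      moreover have "filterlim (\<lambda>n. s n *\<^sub>R ?e) (at 0) sequentially"
      proof -
        have "(\<lambda>n. s n *\<^sub>R ?e) \<longlonglongrightarrow> 0 *\<^sub>R ?e" by (intro tendsto_intros s0)
        moreover have "s n *\<^sub>R ?e \<noteq> 0" for n using s(1)[of n] by (simp add: axis_eq_0_iff)
        ultimately show ?thesis by (simp add: filterlim_at)
      qed
      ultimately have "(\<lambda>n. norm (f (x + s n *\<^sub>R ?e) - f x - ?D (s n *\<^sub>R ?e)) / norm (s n *\<^sub>R ?e)) \<longlonglongrightarrow> 0"
        by (rule filterlim_compose)
      moreover have "norm (f (x + s n *\<^sub>R ?e) - f x - ?D (s n *\<^sub>R ?e)) / norm (s n *\<^sub>R ?e) = norm (?q n x - ?D ?e)" for n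
      proof -
        have "?q n x - ?D ?e = (f (x + s n *\<^sub>R ?e) - f x - s n *\<^sub>R ?D ?e) / s n"
          using s(1)[of n] by (simp add: field_simps scaleR_conv_of_real)
        then show ?thesis using s(1)[of n] by (simp add: norm_divide norm_axis_1 linear_scale[OF lin])
      qed
      ultimately have "(\<lambda>n. norm (?q n x - ?D ?e)) \<longlonglongrightarrow> 0" by simp
      then show "(\<lambda>n. ?q n x) \<longlonglongrightarrow> partial_deriv i f x"
        unfolding partial_deriv_def by (rule LIM_zero_cancel[OF tendsto_norm_zero_cancel])
    qed
  qed measurable
  have quotient: "(LINT x|lborel. ?q n x * cis (- 2 * pi * (x \<bullet> \<omega>))) = (cis (2 * pi * s n * \<omega> $ i) - 1) / s n * fourier f \<omega>" for n
  proof -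
    have i0: "integrable lborel (\<lambda>x. f x * cis (- 2 * pi * (x \<bullet> \<omega>)))"
      by (rule Bochner_Integration.integrable_bound[OF schwartz_integrable[OF f]]) (auto simp: norm_mult)
    have i1: "integrable lborel (\<lambda>x. f (x + s n *\<^sub>R ?e) * cis (- 2 * pi * (x \<bullet> \<omega>)))"
      by (rule Bochner_Integration.integrable_bound[OF integrable_shift[OF schwartz_integrable[OF f]], of _ "s n *\<^sub>R ?e"]) (auto simp: norm_mult)
    have "(LINT x|lborel. ?q n x * cis (- 2 * pi * (x \<bullet> \<omega>)))
      = (LINT x|lborel. (f (x + s n *\<^sub>R ?e) * cis (- 2 * pi * (x \<bullet> \<omega>)) - f x * cis (- 2 * pi * (x \<bullet> \<omega>))) / s n)"
      by (intro Bochner_Integration.integral_cong refl) (simp add: field_simps)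
    also have "\<dots> = (fourier (\<lambda>x. f (x + s n *\<^sub>R ?e)) \<omega> - fourier f \<omega>) / s n"
      using i0 i1 by (simp add: fourier_lborel)
    also have "fourier (\<lambda>x. f (x + s n *\<^sub>R ?e)) \<omega> = cis (2 * pi * s n * \<omega> $ i) * fourier f \<omega>"
      by (simp add: fourier_shift inner_axis' mult.assoc)
    finally show ?thesis by (simp add: algebra_simps diff_divide_distrib)
  qed
  have lim2: "(\<lambda>n. (cis (2 * pi * s n * \<omega> $ i) - 1) / s n * fourier f \<omega>) \<longlonglongrightarrow> 2 * pi * \<i> * (\<omega> $ i) * fourier f \<omega>"
  proof (rule tendsto_mult_right)
    let ?c = "2 * pi * \<i> * (\<omega> $ i)"
    have "((\<lambda>z. exp (?c * z)) has_field_derivative ?c) (at 0)" by (auto intro!: derivative_eq_intros)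
    then have "((\<lambda>z. (exp (?c * (0 + z)) - exp (?c * 0)) / z) \<longlongrightarrow> ?c) (at 0)" by (rule DERIV_D)
    moreover have "filterlim (\<lambda>n. complex_of_real (s n)) (at 0) sequentially"
    proof -
      have "(\<lambda>n. complex_of_real (s n)) \<longlonglongrightarrow> of_real 0" by (intro tendsto_intros s0)
      then show ?thesis using s(1) by (auto simp: filterlim_at less_imp_neq[symmetric] intro!: always_eventually)
    qed
    ultimately have "(\<lambda>n. (exp (?c * (0 + of_real (s n))) - exp (?c * 0)) / of_real (s n)) \<longlonglongrightarrow> ?c"
      by (rule filterlim_compose)
    then show "(\<lambda>n. (cis (2 * pi * s n * \<omega> $ i) - 1) / s n) \<longlonglongrightarrow> ?c" by (simp add: cis_conv_exp ac_simps)
  qed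
  have "(LINT x|lborel. partial_deriv i f x * cis (- 2 * pi * (x \<bullet> \<omega>))) = 2 * pi * \<i> * (\<omega> $ i) * fourier f \<omega>"
    by (rule LIMSEQ_unique[OF lim1[unfolded quotient] lim2])
  then show ?thesis by (simp add: fourier_lborel)
qed

lemma schwartz_iter_deriv: "f \<in> schwartz \<Longrightarrow> iter_deriv \<alpha> f \<in> schwartz"
  by (induction \<alpha>) (auto simp: iter_deriv_Cons schwartz_partial_deriv)

lemma fourier_iter_deriv:
  assumes f: "f \<in> schwartz"
  shows "fourier (iter_deriv (replicate k i) f) \<omega> = (2 * pi * \<i> * (\<omega> $ i)) ^ k * fourier f \<omega>"
  by (induction k) (simp_all add: iter_deriv_Cons fourier_partial_deriv schwartz_iter_deriv f)

text \<open>The norm of \<open>\<omega>\<close> is at most the dimension times its largest coordinate \<open>i\<close>, and powers of that coordinate come from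
derivatives in direction \<open>i\<close>.\<close>

lemma fourier_schwartz_decay_power:
  fixes f :: "real^'n::finite \<Rightarrow> complex"
  assumes f: "f \<in> schwartz"
  obtains B where "0 < B" "\<And>\<omega>. (1 + norm \<omega>) ^ N * norm (fourier f \<omega>) \<le> B"
proof -
  let ?n = "real CARD('n)"
  define A where "A i = (LINT x|lborel. norm (iter_deriv (replicate N i) f x))" for i
  define A0 where "A0 = (LINT x|lborel. norm (f x))"
  have A_nonneg: "0 \<le> A i" "0 \<le> A0" for i by (auto simp: A_def A0_def)
  have i_bound: "\<bar>\<omega> $ i\<bar> ^ N * norm (fourier f \<omega>) \<le> A i" for i \<omega>
  proof -
    have "\<bar>\<omega> $ i\<bar> ^ N * norm (fourier f \<omega>) \<le> (2 * pi * \<bar>\<omega> $ i\<bar>) ^ N * norm (fourier f \<omega>)"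
    proof (intro mult_right_mono power_mono)
      have "1 * \<bar>\<omega> $ i\<bar> \<le> (2 * pi) * \<bar>\<omega> $ i\<bar>" using pi_ge_two by (intro mult_right_mono) linarith+
      then show "\<bar>\<omega> $ i\<bar> \<le> 2 * pi * \<bar>\<omega> $ i\<bar>" by simp
    qed auto
    also have "\<dots> = norm (fourier (iter_deriv (replicate N i) f) \<omega>)"
      by (simp add: fourier_iter_deriv[OF f] norm_mult norm_power power_mult_distrib)
    also have "\<dots> \<le> A i" unfolding A_def by (intro norm_fourier_le schwartz_integrable schwartz_iter_deriv f)
    finally show ?thesis .
  qed
  have "(1 + norm \<omega>) ^ N * norm (fourier f \<omega>) \<le> 2 ^ N * (A0 + ?n ^ N * (\<Sum>i\<in>UNIV. A i))" for \<omega>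
  proof -
    obtain i where i: "\<And>j. \<bar>\<omega> $ j\<bar> \<le> \<bar>\<omega> $ i\<bar>"
    proof -
      have "Max (range (\<lambda>j. \<bar>\<omega> $ j\<bar>)) \<in> range (\<lambda>j. \<bar>\<omega> $ j\<bar>)" by (intro Max_in) auto
      then obtain i where i: "Max (range (\<lambda>j. \<bar>\<omega> $ j\<bar>)) = \<bar>\<omega> $ i\<bar>" by (rule rangeE)
      show thesis
      proof (rule that[of i])
        fix j show "\<bar>\<omega> $ j\<bar> \<le> \<bar>\<omega> $ i\<bar>" unfolding i[symmetric] by (rule Max_ge) auto
      qed
    qed
    have "norm \<omega> \<le> (\<Sum>j\<in>UNIV. \<bar>\<omega> $ j\<bar>)" by (rule norm_le_l1_cart)
    also have "\<dots> \<le> ?n * \<bar>\<omega> $ i\<bar>" using sum_bounded_above[of UNIV "\<lambda>j. \<bar>\<omega> $ j\<bar>" "\<bar>\<omega> $ i\<bar>"] i by simp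
    finally have "norm \<omega> ^ N \<le> ?n ^ N * \<bar>\<omega> $ i\<bar> ^ N" unfolding power_mult_distrib[symmetric] by (intro power_mono) auto
    then have "norm \<omega> ^ N * norm (fourier f \<omega>) \<le> ?n ^ N * (\<bar>\<omega> $ i\<bar> ^ N * norm (fourier f \<omega>))"
      by (simp add: mult.assoc[symmetric] mult_right_mono)
    also have "\<dots> \<le> ?n ^ N * A i" by (intro mult_left_mono i_bound) auto
    also have "\<dots> \<le> ?n ^ N * (\<Sum>i\<in>UNIV. A i)" by (intro mult_left_mono member_le_sum) (auto simp: A_nonneg)
    finally have 1: "norm \<omega> ^ N * norm (fourier f \<omega>) \<le> ?n ^ N * (\<Sum>i\<in>UNIV. A i)" .
    have 2: "norm (fourier f \<omega>) \<le> A0" unfolding A0_def by (intro norm_fourier_le schwartz_integrable f)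
    have "(1 + norm \<omega>) ^ N * norm (fourier f \<omega>) \<le> 2 ^ N * ((1 + norm \<omega> ^ N) * norm (fourier f \<omega>))"
      unfolding mult.assoc[symmetric] by (intro mult_right_mono one_plus_power_le) auto
    also have "(1 + norm \<omega> ^ N) * norm (fourier f \<omega>) \<le> A0 + ?n ^ N * (\<Sum>i\<in>UNIV. A i)"
      using 1 2 by (simp add: algebra_simps)
    finally show ?thesis by simp
  qed
  moreover have "0 \<le> 2 ^ N * (A0 + ?n ^ N * (\<Sum>i\<in>UNIV. A i))"
    by (intro mult_nonneg_nonneg add_nonneg_nonneg sum_nonneg A_nonneg) auto
  ultimately show thesis using that[of "2 ^ N * (A0 + ?n ^ N * (\<Sum>i\<in>UNIV. A i)) + 1"] by (smt (verit))
qed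

lemma fourier_schwartz_decay:
  fixes f :: "real^'n::finite \<Rightarrow> complex"
  assumes "f \<in> schwartz"
  obtains B where "0 < B" "\<And>x. norm (fourier f x) \<le> B * decay x"
  by (rule fourier_schwartz_decay_power[OF assms]) (rule that[OF _ le_mult_decay])

section \<open>Fourier inversion\<close>

lemma summable_decay: "(\<lambda>\<kappa>. decay (int_vec \<kappa> + q)) summable_on UNIV" for q :: "real^'m::finite"
proof -
  obtain B where B: "\<And>(q::real^'m::finite) F. finite F \<Longrightarrow> (\<Sum>\<kappa>\<in>F. decay (int_vec \<kappa> + q)) \<le> B" and "0 \<le> B"
    by (rule sum_decay_bounded) (rule that)
  show ?thesis
  proof (rule nonneg_bdd_above_summable_on)
    show "0 \<le> decay (int_vec \<kappa> + q)" for \<kappa> by (rule less_imp_le[OF decay_pos])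
    show "bdd_above (sum (\<lambda>\<kappa>. decay (int_vec \<kappa> + q)) ` {F. F \<subseteq> UNIV \<and> finite F})"
      by (rule bdd_aboveI2[where M=B]) (simp add: B)
  qed
qed

lemma decay_box_shift:
  assumes "t \<in> cbox (-1) 1"
  shows "decay (t + q) \<le> (1 + 1 + real CARD('m)) ^ (2 * CARD('m)) * decay (q :: real^'m::finite)"
proof (rule decay_perturb)
  show "norm q \<le> 1 * norm (t + q) + real CARD('m)"
    using norm_triangle_ineq4[of "t + q" t] norm_le_CARD[OF assms] by simp
qed auto

text \<open>Poisson summation for \<open>f\<close> modulated by \<open>\<theta>\<close> states that \<open>\<Sum>\<kappa>. f \<kappa> cis (- 2 pi \<kappa> \<bullet> \<theta>)\<close> equals the sum of the Fourier
transform of \<open>f\<close> over \<open>\<theta> + \<kappa>\<close>. Integrating over \<open>\<theta>\<close> in the unit cube leaves \<open>f 0\<close> on the left, by orthogonality of the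
characters, and the integral over the whole space on the right, since the translated cubes tile it.\<close>

lemma fourier_inversion_at_0:
  fixes f :: "real^'m::finite \<Rightarrow> complex"
  assumes f: "continuous_on UNIV f" and B: "\<And>x. norm (f x) \<le> B * decay x"
    and B': "\<And>x. norm (fourier f x) \<le> B' * decay x"
  shows "(LINT \<omega>|lborel. fourier f \<omega>) = f 0"
proof -
  let ?Q = "unit_cube :: (real^'m) set"
  let ?K = "(1 + 1 + real CARD('m)) ^ (2 * CARD('m))"
  have [measurable]: "f \<in> borel_measurable borel" by (intro borel_measurable_continuous_onI f)
  have fi: "integrable lborel f" by (rule integrable_decay_bound[OF _ B]) simp
  have Fc: "continuous_on UNIV (fourier f)" by (rule fourier_continuous[OF fi])
  have [measurable]: "fourier f \<in> borel_measurable borel" by (intro borel_measurable_continuous_onI Fc)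
  have Fi: "integrable lborel (fourier f)" by (rule integrable_decay_bound[OF _ B']) simp
  have Bpos: "0 \<le> B" "0 \<le> B'"
    using order_trans[OF norm_ge_zero B[of 0]] order_trans[OF norm_ge_zero B'[of 0]] decay_pos[of "0::real^'m"]
    by (simp_all add: zero_le_mult_iff)
  have sd: "(\<lambda>\<kappa>. c * decay (int_vec \<kappa> :: real^'m)) summable_on UNIV" for c
    using summable_on_cmult_right[OF summable_decay[of 0]] by simp
  have bnd: "norm (h (t + int_vec \<kappa>)) \<le> b * ?K * decay (int_vec \<kappa>)"
    if "\<And>x. norm (h x) \<le> b * decay x" "t \<in> cbox (-1) 1" "0 \<le> b" for h :: "real^'m \<Rightarrow> complex" and b t \<kappa>
    unfolding mult.assoc by (intro order_trans[OF that(1)] mult_left_mono decay_box_shift that)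
  have P: "((\<lambda>\<kappa>. f (int_vec \<kappa>) * unit_char (- \<kappa>) \<theta>) has_sum (\<Sum>\<^sub>\<infinity>\<kappa>. fourier f (\<theta> + int_vec \<kappa>))) UNIV" if \<theta>: "\<theta> \<in> cbox (-1) 1" for \<theta>
  proof -
    let ?f = "\<lambda>t. cis (2 * pi * (- \<theta> \<bullet> t)) * f t"
    have F: "fourier ?f \<omega> = fourier f (\<theta> + \<omega>)" for \<omega>
      using fourier_modulate[of f "- \<theta>" \<omega>] by (simp add: add.commute)
    have "((\<lambda>\<kappa>. ?f (int_vec \<kappa>)) has_sum (\<Sum>\<^sub>\<infinity>\<kappa>. fourier ?f (int_vec \<kappa>))) UNIV"
    proof (rule poisson_summation)
      show "continuous_on UNIV ?f" by (intro continuous_intros f)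
      show "norm (?f (t + int_vec \<kappa>)) \<le> B * ?K * decay (int_vec \<kappa>)" if "t \<in> cbox (-1) 1" for \<kappa> t
        by (rule bnd[OF _ that Bpos(1)]) (simp add: norm_mult B)
      show "(\<lambda>\<kappa>. B * ?K * decay (int_vec \<kappa> :: real^'m)) summable_on UNIV" by (rule sd)
      show "(\<lambda>\<kappa>. norm (fourier ?f (int_vec \<kappa>))) summable_on UNIV"
        unfolding F by (rule Infinite_Sum.abs_summable_on_comparison_test'[OF sd[of "B' * ?K"]]) (rule bnd[OF B' \<theta> Bpos(2)])
    qed
    also have "(\<lambda>\<kappa>. ?f (int_vec \<kappa>)) = (\<lambda>\<kappa>. f (int_vec \<kappa>) * unit_char (- \<kappa>) \<theta>)"
      by (intro ext) (simp add: unit_char_def int_vec_simps inner_commute mult.commute)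
    finally show ?thesis unfolding F .
  qed
  have Qb: "\<theta> \<in> cbox (-1) 1" if "\<theta> \<in> ?Q" for \<theta> using unit_cube_subset_symmetric that by blast
  have cint: "integrable lborel (\<lambda>t. indicator ?Q t * (c::real))" for c
    using emeasure_unit_cube_finite by (intro integrable_mult_left integrable_real_indicator) auto
  have swap: "((\<lambda>\<kappa>. LINT \<theta>|lborel. indicator ?Q \<theta> *\<^sub>R h \<kappa> \<theta>) has_sum (LINT \<theta>|lborel. indicator ?Q \<theta> *\<^sub>R (\<Sum>\<^sub>\<infinity>\<kappa>. h \<kappa> \<theta>))) UNIV"
    if hc: "\<And>\<kappa>. continuous_on UNIV (h \<kappa>)" and hb: "\<And>\<kappa> \<theta>. \<theta> \<in> ?Q \<Longrightarrow> norm (h \<kappa> \<theta>) \<le> c * decay (int_vec \<kappa> :: real^'m)"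
    for h :: "int^'m \<Rightarrow> real^'m \<Rightarrow> complex" and c
  proof -
    have nb: "norm (indicator ?Q \<theta> *\<^sub>R h \<kappa> \<theta>) \<le> indicator ?Q \<theta> * (c * decay (int_vec \<kappa> :: real^'m))" for \<kappa> \<theta>
      using hb[of \<theta> \<kappa>] by (simp add: indicator_def)
    have i: "integrable lborel (\<lambda>\<theta>. indicator ?Q \<theta> *\<^sub>R h \<kappa> \<theta>)" for \<kappa>
      by (intro integrable_on_unit_cube continuous_on_subset[OF hc]) auto
    have "((\<lambda>\<kappa>. LINT \<theta>|lborel. indicator ?Q \<theta> *\<^sub>R h \<kappa> \<theta>) has_sum (LINT \<theta>|lborel. (\<Sum>\<^sub>\<infinity>\<kappa>. indicator ?Q \<theta> *\<^sub>R h \<kappa> \<theta>))) UNIV"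
    proof (rule has_sum_integral(2)[OF i])
      show "(\<lambda>\<kappa>. LINT \<theta>|lborel. norm (indicator ?Q \<theta> *\<^sub>R h \<kappa> \<theta>)) summable_on UNIV"
      proof (rule summable_on_comparison_test[OF sd[of "measure lborel ?Q * c"]])
        fix \<kappa>
        have "(LINT \<theta>|lborel. norm (indicator ?Q \<theta> *\<^sub>R h \<kappa> \<theta>)) \<le> (LINT \<theta>|lborel. indicator ?Q \<theta> * (c * decay (int_vec \<kappa> :: real^'m)))"
          by (intro integral_mono integrable_norm i cint nb)
        then show "(LINT \<theta>|lborel. norm (indicator ?Q \<theta> *\<^sub>R h \<kappa> \<theta>)) \<le> measure lborel ?Q * c * decay (int_vec \<kappa> :: real^'m)"
          by simp
      qed auto
      show "(\<lambda>\<kappa>. norm (indicator ?Q \<theta> *\<^sub>R h \<kappa> \<theta>)) summable_on UNIV" for \<theta>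
        by (rule Infinite_Sum.abs_summable_on_comparison_test'[OF sd[of "indicator ?Q \<theta> * c"]])
           (use nb in \<open>simp add: mult.assoc\<close>)
    qed
    also have "(\<lambda>\<theta>. \<Sum>\<^sub>\<infinity>\<kappa>. indicator ?Q \<theta> *\<^sub>R h \<kappa> \<theta>) = (\<lambda>\<theta>. indicator ?Q \<theta> *\<^sub>R (\<Sum>\<^sub>\<infinity>\<kappa>. h \<kappa> \<theta>))"
      by (intro ext) (simp add: indicator_def)
    finally show ?thesis .
  qed
  have "((\<lambda>\<kappa>. LINT \<theta>|lborel. indicator ?Q \<theta> *\<^sub>R fourier f (\<theta> + int_vec \<kappa>)) has_sum (LINT \<theta>|lborel. indicator ?Q \<theta> *\<^sub>R (\<Sum>\<^sub>\<infinity>\<kappa>. fourier f (\<theta> + int_vec \<kappa>)))) UNIV"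
  proof (rule swap)
    show "continuous_on UNIV (\<lambda>\<theta>. fourier f (\<theta> + int_vec \<kappa>))" for \<kappa>
      by (intro continuous_on_compose2[OF Fc] continuous_intros) auto
    show "norm (fourier f (\<theta> + int_vec \<kappa>)) \<le> B' * ?K * decay (int_vec \<kappa> :: real^'m)" if "\<theta> \<in> ?Q" for \<kappa> \<theta>
      by (rule bnd[OF B' Qb[OF that] Bpos(2)])
  qed
  then have 1: "(LINT \<omega>|lborel. fourier f \<omega>) = (LINT \<theta>|lborel. indicator ?Q \<theta> *\<^sub>R (\<Sum>\<^sub>\<infinity>\<kappa>. fourier f (\<theta> + int_vec \<kappa>)))"
    using integral_tiling[OF Fi] has_sum_unique by blast
  have "((\<lambda>\<kappa>. LINT \<theta>|lborel. indicator ?Q \<theta> *\<^sub>R (f (int_vec \<kappa>) * unit_char (- \<kappa>) \<theta>)) has_sum (LINT \<theta>|lborel. indicator ?Q \<theta> *\<^sub>R (\<Sum>\<^sub>\<infinity>\<kappa>. f (int_vec \<kappa>) * unit_char (- \<kappa>) \<theta>))) UNIV"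
    by (rule swap[where c=B]) (auto intro!: continuous_intros simp: norm_mult B)
  also have "(\<lambda>\<theta>. indicator ?Q \<theta> *\<^sub>R (\<Sum>\<^sub>\<infinity>\<kappa>. f (int_vec \<kappa>) * unit_char (- \<kappa>) \<theta>)) = (\<lambda>\<theta>. indicator ?Q \<theta> *\<^sub>R (\<Sum>\<^sub>\<infinity>\<kappa>. fourier f (\<theta> + int_vec \<kappa>)))"
    using infsumI[OF P[OF Qb]] by (intro ext) (auto simp: indicator_def)
  also have "(\<lambda>\<kappa>. LINT \<theta>|lborel. indicator ?Q \<theta> *\<^sub>R (f (int_vec \<kappa>) * unit_char (- \<kappa>) \<theta>)) = (\<lambda>\<kappa>. if \<kappa> = 0 then f 0 else 0)"
  proof
    fix \<kappa>
    have "(LINT \<theta>|lborel. indicator ?Q \<theta> *\<^sub>R (f (int_vec \<kappa>) * unit_char (- \<kappa>) \<theta>)) = (LINT \<theta>|lborel. f (int_vec \<kappa>) * (indicator ?Q \<theta> *\<^sub>R unit_char (- \<kappa>) \<theta>))"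
      by simp
    also have "\<dots> = f (int_vec \<kappa>) * (LINT \<theta>|lborel. indicator ?Q \<theta> *\<^sub>R unit_char (- \<kappa>) \<theta>)"
      by (rule integral_mult_right_zero)
    finally show "(LINT \<theta>|lborel. indicator ?Q \<theta> *\<^sub>R (f (int_vec \<kappa>) * unit_char (- \<kappa>) \<theta>)) = (if \<kappa> = 0 then f 0 else 0)"
      unfolding integral_unit_char by (simp add: int_vec_simps)
  qed
  finally have "((\<lambda>\<kappa>::int^'m. if \<kappa> = 0 then f 0 else 0) has_sum (LINT \<omega>|lborel. fourier f \<omega>)) UNIV" unfolding 1 .
  moreover have "((\<lambda>\<kappa>::int^'m. if \<kappa> = 0 then f 0 else 0) has_sum f 0) UNIV"
    by (rule has_sum_cong_neutral[THEN iffD1, OF _ _ _ has_sum_finite[of "{0}", simplified]]) auto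
  ultimately show ?thesis using has_sum_unique by blast
qed

theorem fourier_inversion:
  assumes f: "f \<in> schwartz"
  shows "(LINT \<omega>|lborel. fourier f \<omega> * cis (2 * pi * (x \<bullet> \<omega>))) = f x"
proof -
  let ?f = "\<lambda>t. f (t + x)"
  have T: "?f \<in> schwartz" using schwartz_translation[OF f, of "-x"] by (simp add: translation_def[abs_def])
  obtain B B' where "\<And>t. norm (?f t) \<le> B * decay t" "\<And>t. norm (fourier ?f t) \<le> B' * decay t"
    using schwartz_decay[OF T] fourier_schwartz_decay[OF T] by metis
  from fourier_inversion_at_0[OF schwartz_continuous[OF T] this]
  show ?thesis by (simp add: fourier_shift[OF schwartz_measurable[OF f]] mult.commute)
qed

section \<open>Gaussians\<close>

definition gauss :: "real \<Rightarrow> real^'n::finite \<Rightarrow> complex" where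
  "gauss a x = of_real (exp (- a * (x \<bullet> x)))"

text \<open>Products of polynomials with a fixed Gaussian, a set that is closed under partial derivatives.\<close>

inductive_set gauss_poly :: "real \<Rightarrow> (real^'n::finite \<Rightarrow> complex) set" for a where
  gauss: "gauss a \<in> gauss_poly a"
| coord: "f \<in> gauss_poly a \<Longrightarrow> (\<lambda>x. of_real (x $ i) * f x) \<in> gauss_poly a"
| lincomb: "f \<in> gauss_poly a \<Longrightarrow> g \<in> gauss_poly a \<Longrightarrow> (\<lambda>x. b * f x + c * g x) \<in> gauss_poly a"

text \<open>For large \<open>x\<close> this is \<open>(1 + y / k)\<^sup>k \<le> exp y\<close> at \<open>y = a (x \<bullet> x)\<close>.\<close>

lemma gauss_bounded:
  assumes a: "0 < a"
  shows "norm x ^ k * exp (- a * (x \<bullet> x)) \<le> 1 + (real k / a) ^ k"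
proof (cases "k = 0")
  case False
  define r where "r = norm x"
  have r: "0 \<le> r" "x \<bullet> x = r\<^sup>2" by (auto simp: r_def dot_square_norm)
  have e1: "exp (- a * r\<^sup>2) \<le> 1" using a by simp
  show ?thesis
  proof (cases "r \<le> 1")
    case True
    then have "r ^ k * exp (- a * r\<^sup>2) \<le> 1" using r e1 by (intro mult_le_one power_le_one) auto
    then show ?thesis using a unfolding r(2) r_def[symmetric] by (smt (verit) divide_nonneg_pos of_nat_0_le_iff zero_le_power)
  next
    case big: False
    have "(a * r\<^sup>2 / real k) ^ k \<le> (1 + a * r\<^sup>2 / real k) ^ k"
      using a by (intro power_mono) auto
    also have "\<dots> \<le> exp (a * r\<^sup>2)"
      using a False by (intro exp_ge_one_plus_x_over_n_power_n) (auto intro: order_trans[of _ 0])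
    finally have 1: "(a / real k) ^ k * (r\<^sup>2) ^ k \<le> exp (a * r\<^sup>2)" by (simp add: power_mult_distrib[symmetric])
    have "r ^ k \<le> (r\<^sup>2) ^ k" using big by (intro power_mono) (auto simp: power2_eq_square mult_le_cancel_left1)
    then have "(a / real k) ^ k * r ^ k \<le> (a / real k) ^ k * (r\<^sup>2) ^ k" using a by (intro mult_left_mono) auto
    also note 1
    finally have "r ^ k \<le> (real k / a) ^ k * exp (a * r\<^sup>2)"
      using a False by (simp add: power_divide field_simps)
    then have "r ^ k * exp (- a * r\<^sup>2) \<le> (real k / a) ^ k" by (simp add: exp_minus field_simps)
    then show ?thesis unfolding r(2) r_def[symmetric] by simp
  qed
next
  case True
  have "exp (- a * (x \<bullet> x)) \<le> 1" using a by simp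
  then have "exp (- a * (x \<bullet> x)) \<le> 2" by (rule order_trans) simp
  then show ?thesis using True by simp
qed

lemma has_derivative_gauss:
  "(gauss a has_derivative (\<lambda>h. of_real (- 2 * a * (x \<bullet> h)) * gauss a x)) (at x)"
proof -
  have "((\<lambda>x. - a * (x \<bullet> x)) has_derivative (\<lambda>h. - 2 * a * (x \<bullet> h))) (at x)"
    by (auto intro!: derivative_eq_intros simp: inner_commute)
  then have "((\<lambda>x. exp (- a * (x \<bullet> x))) has_derivative (\<lambda>h. exp (- a * (x \<bullet> x)) * (- 2 * a * (x \<bullet> h)))) (at x)"
    by (rule has_derivative_compose) (rule DERIV_exp[unfolded has_field_derivative_def])
  then have "((\<lambda>x. of_real (exp (- a * (x \<bullet> x))) :: complex) has_derivative (\<lambda>h. of_real (exp (- a * (x \<bullet> x)) * (- 2 * a * (x \<bullet> h))))) (at x)"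
    by (rule has_derivative_of_real)
  then show ?thesis by (simp add: gauss_def[abs_def] mult.commute)
qed

lemma gauss_poly_props:
  assumes "f \<in> gauss_poly a" "0 < a"
  shows "(\<forall>x. f differentiable (at x)) \<and> (\<forall>i. partial_deriv i f \<in> gauss_poly a) \<and>
    (\<forall>k. bounded (range (\<lambda>x. norm x ^ k *\<^sub>R f x)))"
  using assms(1)
proof induction
  case gauss
  have P: "partial_deriv i (gauss a) = (\<lambda>x. (- 2 * of_real a) * (of_real (x $ i) * gauss a x) + 0 * gauss a x)" for i
    by (rule ext, rule trans[OF partial_deriv_eqI[OF has_derivative_gauss]]) (simp add: inner_axis)
  have "partial_deriv i (gauss a :: real^'a \<Rightarrow> complex) \<in> gauss_poly a" for i
    by (subst P) (rule gauss_poly.lincomb[OF gauss_poly.coord[OF gauss_poly.gauss] gauss_poly.gauss])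
  moreover have "norm (norm x ^ k *\<^sub>R gauss a x) \<le> 1 + (real k / a) ^ k" for k and x :: "real^'a"
    using gauss_bounded[OF assms(2), of x k] by (simp add: gauss_def norm_mult)
  then have "bounded (range (\<lambda>x::real^'a. norm x ^ k *\<^sub>R gauss a x))" for k
    unfolding bounded_iff by blast
  ultimately show ?case using has_derivative_gauss unfolding differentiable_def by blast
next
  case (coord f j)
  have D: "((\<lambda>x. of_real (x $ j) * f x) has_derivative
     (\<lambda>h. of_real (x $ j) * frechet_derivative f (at x) h + of_real (h $ j) * f x)) (at x)" for x
    using coord.IH frechet_derivative_works
    by (intro has_derivative_mult has_derivative_of_real) (auto intro!: derivative_eq_intros bounded_linear_imp_has_derivative bounded_linear_vec_nth)
  have P: "partial_deriv i (\<lambda>x. of_real (x $ j) * f x) = (\<lambda>x. 1 * (of_real (x $ j) * partial_deriv i f x) + (if i = j then 1 else 0) * f x)" for i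
    by (rule ext, rule trans[OF partial_deriv_eqI[OF D]]) (auto simp: partial_deriv_def axis_def)
  have "partial_deriv i (\<lambda>x. of_real (x $ j) * f x) \<in> gauss_poly a" for i
    by (subst P, rule gauss_poly.lincomb[OF gauss_poly.coord]) (use coord in auto)
  moreover have "bounded (range (\<lambda>x. norm x ^ k *\<^sub>R (of_real (x $ j) * f x)))" for k
  proof -
    have "bounded (range (\<lambda>x. norm x ^ Suc k *\<^sub>R f x))" using coord.IH by blast
    then obtain B where B: "\<And>x. norm (norm x ^ Suc k *\<^sub>R f x) \<le> B"
      unfolding bounded_iff by blast
    have "norm (norm x ^ k *\<^sub>R (of_real (x $ j) * f x)) \<le> B" for x
    proof -
      have "norm (norm x ^ k *\<^sub>R (of_real (x $ j) * f x)) = norm x ^ k * (\<bar>x $ j\<bar> * norm (f x))"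
        by (simp add: norm_mult)
      also have "\<dots> \<le> norm x ^ k * (norm x * norm (f x))"
        by (intro mult_left_mono mult_right_mono component_le_norm_cart) auto
      also have "\<dots> \<le> B" using B[of x] by (simp add: ac_simps)
      finally show ?thesis .
    qed
    then show ?thesis unfolding bounded_iff by blast
  qed
  ultimately show ?case using D unfolding differentiable_def by blast
next
  case (lincomb f g b c)
  have D: "((\<lambda>x. b * f x + c * g x) has_derivative
     (\<lambda>h. b * frechet_derivative f (at x) h + c * frechet_derivative g (at x) h)) (at x)" for x
    using lincomb.IH frechet_derivative_works by (intro has_derivative_add has_derivative_mult_right) auto
  have "partial_deriv i (\<lambda>x. b * f x + c * g x) = (\<lambda>x. b * partial_deriv i f x + c * partial_deriv i g x)" for i
    by (rule ext, rule trans[OF partial_deriv_eqI[OF D]]) (auto simp: partial_deriv_def)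
  then have "partial_deriv i (\<lambda>x. b * f x + c * g x) \<in> gauss_poly a" for i
    using lincomb.IH by (simp add: gauss_poly.lincomb)
  moreover have "bounded (range (\<lambda>x. norm x ^ k *\<^sub>R (b * f x + c * g x)))" for k
  proof -
    have "bounded (range (\<lambda>x. b * (norm x ^ k *\<^sub>R f x)))" "bounded (range (\<lambda>x. c * (norm x ^ k *\<^sub>R g x)))"
      using lincomb.IH bounded_linear_image[OF _ bounded_linear_mult_right, of "range (\<lambda>x. norm x ^ k *\<^sub>R f x)" b]
        bounded_linear_image[OF _ bounded_linear_mult_right, of "range (\<lambda>x. norm x ^ k *\<^sub>R g x)" c]
      by (auto simp: image_image)
    from bounded_plus_comp[OF this] show ?thesis by (simp add: algebra_simps)
  qed
  ultimately show ?case using D unfolding differentiable_def by blast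
qed

lemma gauss_schwartz: "0 < a \<Longrightarrow> gauss a \<in> schwartz"
  by (rule schwartz_coinduct[where K="gauss_poly a"]) (auto simp: gauss_poly.gauss dest: gauss_poly_props)

text \<open>Rescaling by \<open>sqrt (2 * a)\<close> turns this into the characteristic function of the standard normal distribution.\<close>

lemma gauss_1d:
  assumes a: "0 < a"
  shows "integrable lborel (\<lambda>x::real. of_real (exp (- a * x\<^sup>2)) * cis (- 2 * pi * (x * w)))"
    and "(LINT x|lborel. of_real (exp (- a * x\<^sup>2)) * cis (- 2 * pi * (x * w))) = of_real (sqrt (pi / a) * exp (- (pi\<^sup>2 / a) * w\<^sup>2))"
proof -
  define c where "c = sqrt (2 * a)"
  have c: "0 < c" "c\<^sup>2 = 2 * a" using a by (auto simp: c_def)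
  define t where "t = - 2 * pi * w / c"
  let ?f = "\<lambda>x. std_normal_density x *\<^sub>R iexp (t * x)"
  have f: "integrable lborel ?f"
  proof (rule Bochner_Integration.integrable_bound)
    show "integrable lborel std_normal_density" by simp
  qed (auto simp: norm_mult)
  have "complex_of_real (exp (- (t\<^sup>2) / 2)) = (LINT x|lborel. ?f x)"
    using fun_cong[OF char_std_normal_distribution, of t] unfolding char_def
    by (subst (asm) integral_density) auto
  also have "\<dots> = c *\<^sub>R (LINT x|lborel. ?f (0 + c * x))"
    using c lborel_integral_real_affine[of c ?f 0] by simp
  finally have 0: "complex_of_real (exp (- (t\<^sup>2) / 2)) = c *\<^sub>R (LINT x|lborel. ?f (0 + c * x))" .
  have fe: "?f (0 + c * x) = of_real (1 / sqrt (2 * pi)) * (of_real (exp (- a * x\<^sup>2)) * cis (- 2 * pi * (x * w)))" for x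
  proof -
    have "t * (c * x) = - 2 * pi * (x * w)" using c by (simp add: t_def field_simps)
    moreover have "(c * x)\<^sup>2 / 2 = a * x\<^sup>2" using c by (simp add: power_mult_distrib)
    ultimately show ?thesis
      by (simp add: std_normal_density_def scaleR_conv_of_real cis_conv_exp mult.assoc[symmetric])
  qed
  have 1: "complex_of_real (exp (- (t\<^sup>2) / 2)) = c *\<^sub>R (LINT x|lborel. of_real (1 / sqrt (2 * pi)) * (of_real (exp (- a * x\<^sup>2)) * cis (- 2 * pi * (x * w))))"
    using 0 unfolding fe .
  have "integrable lborel (\<lambda>x. ?f (0 + c * x))"
    using f c lborel_integrable_real_affine[of ?f c 0] by simp
  then have "integrable lborel (\<lambda>x. of_real (sqrt (2 * pi)) * ?f (0 + c * x))"
    by (rule integrable_mult_right)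
  then show "integrable lborel (\<lambda>x::real. of_real (exp (- a * x\<^sup>2)) * cis (- 2 * pi * (x * w)))"
    unfolding fe by simp
  let ?J = "LINT x|lborel. of_real (exp (- a * x\<^sup>2)) * cis (- 2 * pi * (x * w))"
  have "complex_of_real (exp (- (t\<^sup>2) / 2)) = of_real (c / sqrt (2 * pi)) * ?J"
    unfolding 1 integral_mult_right_zero by (simp add: scaleR_conv_of_real)
  moreover have "t\<^sup>2 / 2 = (pi\<^sup>2 / a) * w\<^sup>2"
    using c a by (simp add: t_def power_divide power_mult_distrib)
  moreover have "c / sqrt (2 * pi) = 1 / sqrt (pi / a)"
    using a by (simp add: c_def real_sqrt_divide real_sqrt_mult)
  ultimately have "of_real (exp (- (pi\<^sup>2 / a) * w\<^sup>2)) = of_real (1 / sqrt (pi / a)) * ?J" by simp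
  then have "of_real (sqrt (pi / a)) * of_real (exp (- (pi\<^sup>2 / a) * w\<^sup>2)) = (of_real (sqrt (pi / a)) * of_real (1 / sqrt (pi / a))) * ?J"
    by (simp only: mult.assoc)
  also have "of_real (sqrt (pi / a)) * of_real (1 / sqrt (pi / a)) = (1::complex)"
    using a by (simp flip: of_real_mult)
  finally show "?J = of_real (sqrt (pi / a) * exp (- (pi\<^sup>2 / a) * w\<^sup>2))" by simp
qed

lemma fourier_gauss:
  assumes a: "0 < a"
  shows "fourier (gauss a) \<omega> = of_real (sqrt (pi / a) ^ CARD('n)) * gauss (pi\<^sup>2 / a) (\<omega> :: real^'n::finite)"
proof -
  have gsum: "gauss b x = (\<Prod>i\<in>UNIV. of_real (exp (- b * (x $ i)\<^sup>2)))" for b and x :: "real^'n"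
    by (simp add: gauss_def inner_vec_def sum_distrib_left exp_sum power2_eq_square sum_negf[symmetric] flip: of_real_prod)
  have csum: "cis (- 2 * pi * (x \<bullet> \<omega>)) = (\<Prod>i\<in>UNIV. cis (- 2 * pi * (x $ i * \<omega> $ i)))" for x :: "real^'n"
    by (simp add: inner_vec_def sum_distrib_left cis_conv_exp exp_sum sum_negf[symmetric])
  have "fourier (gauss a) \<omega> = (LINT x|lborel. (\<Prod>i\<in>UNIV. of_real (exp (- a * (x $ i)\<^sup>2)) * cis (- 2 * pi * (x $ i * \<omega> $ i))))"
    by (subst fourier_lborel) (simp_all only: gsum csum prod.distrib schwartz_measurable gauss_schwartz a)
  also have "\<dots> = (\<Prod>i\<in>UNIV. of_real (sqrt (pi / a) * exp (- (pi\<^sup>2 / a) * (\<omega> $ i)\<^sup>2)))"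
    by (subst integral_prod_vec(2)) (simp_all only: gauss_1d a)
  finally show ?thesis by (simp add: gsum prod.distrib)
qed

section \<open>Recovering a function from its distributional Fourier transform\<close>

lemma lebesgue_borel_representative:
  fixes f :: "'a::euclidean_space \<Rightarrow> complex"
  assumes [measurable]: "f \<in> borel_measurable lebesgue"
  obtains f' where "f' \<in> borel_measurable borel" "AE x in lborel. f x = f' x"
proof -
  have "(\<lambda>x. Re (f x)) \<in> borel_measurable lebesgue" "(\<lambda>x. Im (f x)) \<in> borel_measurable lebesgue" by measurable
  then obtain r i where [measurable]: "r \<in> borel_measurable lborel" "i \<in> borel_measurable lborel"
    and ae: "AE x in lborel. Re (f x) = r x" "AE x in lborel. Im (f x) = i x"
    by (metis completion_ex_borel_measurable_real)
  show thesis
  proof (rule that[of "\<lambda>x. Complex (r x) (i x)"])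
    have "(\<lambda>x. complex_of_real (r x) + \<i> * complex_of_real (i x)) \<in> borel_measurable borel" by measurable
    then show "(\<lambda>x. Complex (r x) (i x)) \<in> borel_measurable borel" by (simp add: complex_eq[symmetric] Complex_eq)
    show "AE x in lborel. f x = Complex (r x) (i x)"
      using ae by eventually_elim (simp add: complex_eq_iff)
  qed
qed

lemma lebesgue_integral_AE_eq:
  fixes f f' :: "'a::euclidean_space \<Rightarrow> 'b::{banach,second_countable_topology}"
  assumes f: "f \<in> borel_measurable lebesgue" and f': "f' \<in> borel_measurable borel"
    and ae: "AE x in lborel. f x = f' x"
  shows "(LINT x|lebesgue. f x) = (LINT x|lborel. f' x)"
    and "integrable lebesgue f \<longleftrightarrow> integrable lborel f'"
proof -
  have f'': "f' \<in> borel_measurable lebesgue" using f' by (intro measurable_completion) simp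
  have ae': "AE x in lebesgue. f x = f' x" using ae by (rule AE_completion)
  have "(LINT x|lebesgue. f x) = (LINT x|lebesgue. f' x)" by (rule integral_cong_AE[OF f f'' ae'])
  then show "(LINT x|lebesgue. f x) = (LINT x|lborel. f' x)" by (simp add: integral_lebesgue_lborel f')
  have "integrable lebesgue f \<longleftrightarrow> integrable lebesgue f'" by (rule integrable_cong_AE[OF f f'' ae'])
  then show "integrable lebesgue f \<longleftrightarrow> integrable lborel f'" using f' by (simp add: integrable_completion)
qed

lemma gauss_diff_commute: "gauss a (x - y) = gauss a (y - x)"
  by (simp add: gauss_def inner_diff_left inner_diff_right)

lemma measurable_gauss [measurable]: "gauss a \<in> borel_measurable borel"
  unfolding gauss_def[abs_def] by measurable

lemma integral_gauss: "(LINT x|lborel. gauss 1 (x::real^'n::finite)) = of_real (sqrt pi ^ CARD('n))"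
  using fourier_gauss[of 1 "0 :: real^'n"] by (simp add: fourier_lborel, simp add: gauss_def)

text \<open>By Fubini the integral of \<open>w\<close> against the convolution \<open>C r\<close> of \<open>c\<close> with a Gaussian of width \<open>r\<close> is a superposition
of integrals that vanish, and as \<open>r\<close> tends to \<open>0\<close> these convolutions tend to a multiple of \<open>c\<close>.\<close>

lemma orthogonal_to_gaussians_imp_orthogonal_to_continuous:
  fixes w :: "real^'n::finite \<Rightarrow> complex"
  assumes w: "integrable lborel w"
    and orth: "\<And>a y. 0 < a \<Longrightarrow> (LINT x|lborel. w x * gauss a (x - y)) = 0"
    and c: "continuous_on UNIV c" and bc: "\<And>x. norm (c x) \<le> 1"
  shows "(LINT x|lborel. w x * c x) = 0"
proof -
  have [measurable]: "w \<in> borel_measurable borel" "c \<in> borel_measurable borel"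
    using borel_measurable_integrable[OF w] c by (auto intro: borel_measurable_continuous_onI)
  have gi: "integrable lborel (gauss a :: real^'n \<Rightarrow> complex)" if "0 < a" for a
    by (rule schwartz_integrable[OF gauss_schwartz[OF that]])
  define C where "C r x = (LINT z|lborel. c (x + r *\<^sub>R z) * gauss 1 z)" for r x
  have zero: "(LINT x|lborel. w x * C r x) = 0" if r: "0 < r" for r
  proof -
    let ?a = "1 / r\<^sup>2"
    have ga: "gauss ?a (r *\<^sub>R z) = gauss 1 z" for z :: "real^'n" using r by (simp add: gauss_def power2_eq_square)
    have scale: "(LINT y|lborel. c y * gauss ?a (x - y)) = r ^ CARD('n) *\<^sub>R C r x" for x
    proof -
      have "(LINT y|lborel. c y * gauss ?a (x - y)) = (LINT y|density (distr lborel borel (\<lambda>z. x + r *\<^sub>R z)) (\<lambda>_. ennreal (\<bar>r\<bar> ^ DIM(real^'n))). c y * gauss ?a (x - y))"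
        using lborel_affine[of r x] r by simp
      also have "\<dots> = r ^ CARD('n) *\<^sub>R (LINT z|lborel. c (x + r *\<^sub>R z) * gauss ?a (x - (x + r *\<^sub>R z)))"
        using r by (simp add: integral_density integral_distr)
      also have "(LINT z|lborel. c (x + r *\<^sub>R z) * gauss ?a (x - (x + r *\<^sub>R z))) = C r x"
        unfolding C_def by (subst gauss_diff_commute) (simp add: ga)
      finally show ?thesis .
    qed
    have "(LINT x|lborel. LINT y|lborel. w x * (c y * gauss ?a (x - y))) = (LINT y|lborel. LINT x|lborel. w x * (c y * gauss ?a (x - y)))"
    proof (rule fubini_convolution_bound(4)[where a="\<lambda>x. norm (w x)" and b="\<lambda>y. norm (gauss ?a y)" and \<tau>="\<lambda>x. - x"])
      show "norm (w x * (c y * gauss ?a (x - y))) \<le> norm (w x) * norm (gauss ?a (y + - x))" for x y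
        using bc[of y] by (simp add: norm_mult gauss_diff_commute[of _ x] mult_left_mono mult_left_le_one_le)
    qed (use w r gi in auto)
    also have "(\<lambda>y. LINT x|lborel. w x * (c y * gauss ?a (x - y))) = (\<lambda>y. 0)"
    proof
      fix y
      have "(LINT x|lborel. w x * (c y * gauss ?a (x - y))) = c y * (LINT x|lborel. w x * gauss ?a (x - y))"
        by (subst integral_mult_right_zero[symmetric]) (simp add: ac_simps)
      then show "(LINT x|lborel. w x * (c y * gauss ?a (x - y))) = 0" using orth[of ?a y] r by simp
    qed
    finally have "(LINT x|lborel. w x * (r ^ CARD('n) *\<^sub>R C r x)) = 0" by (simp add: scale)
    then show ?thesis using r by simp
  qed
  define s where "s n = inverse (real (Suc n))" for n
  have s: "0 < s n" for n by (auto simp: s_def)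
  have s0: "s \<longlonglongrightarrow> 0" unfolding s_def by (rule LIMSEQ_inverse_real_of_nat)
  let ?I = "LINT z|lborel. norm (gauss 1 (z::real^'n))"
  have Cb: "norm (C r x) \<le> ?I" for r x
    unfolding C_def using bc gi[of 1]
    by (intro order_trans[OF integral_norm_bound] integral_mono' integrable_norm) (auto simp: norm_mult mult_left_le_one_le)
  have Clim: "(\<lambda>n. C (s n) x) \<longlonglongrightarrow> c x * of_real (sqrt pi ^ CARD('n))" for x
  proof -
    have "(\<lambda>n. LINT z|lborel. c (x + s n *\<^sub>R z) * gauss 1 z) \<longlonglongrightarrow> (LINT z|lborel. c x * gauss 1 (z::real^'n))"
    proof (rule integral_dominated_convergence[where w="\<lambda>z::real^'n. norm (gauss 1 z)"])
      show "AE z in lborel. (\<lambda>n. c (x + s n *\<^sub>R z) * gauss 1 z) \<longlonglongrightarrow> c x * gauss 1 z"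
      proof (intro AE_I2 tendsto_mult_right)
        fix z
        have "(\<lambda>n. x + s n *\<^sub>R z) \<longlonglongrightarrow> x + 0 *\<^sub>R z" by (intro tendsto_intros s0)
        then show "(\<lambda>n. c (x + s n *\<^sub>R z)) \<longlonglongrightarrow> c x"
          using c by (auto simp: continuous_on_sequentially o_def)
      qed
      show "AE z in lborel. norm (c (x + s n *\<^sub>R z) * gauss 1 z) \<le> norm (gauss 1 z)" for n
        using bc by (intro AE_I2) (simp add: norm_mult mult_left_le_one_le)
    qed (use gi in auto)
    then show ?thesis by (simp add: C_def integral_gauss)
  qed
  have [measurable]: "C r \<in> borel_measurable borel" for r
  proof -
    have "(\<lambda>x. LINT z|lborel. (\<lambda>x z. c (x + r *\<^sub>R z) * gauss 1 z) x z) \<in> borel_measurable borel"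
      by (rule lborel.borel_measurable_lebesgue_integral) measurable
    then show ?thesis by (simp add: C_def[abs_def])
  qed
  have "(\<lambda>n. LINT x|lborel. w x * C (s n) x) \<longlonglongrightarrow> (LINT x|lborel. w x * (c x * of_real (sqrt pi ^ CARD('n))))"
  proof (rule integral_dominated_convergence[where w="\<lambda>x. norm (w x) * ?I"])
    show "integrable lborel (\<lambda>x. norm (w x) * ?I)" using w by (intro integrable_mult_left integrable_norm)
    show "AE x in lborel. norm (w x * C (s n) x) \<le> norm (w x) * ?I" for n
      using Cb by (intro AE_I2) (simp add: norm_mult mult_left_mono)
    show "AE x in lborel. (\<lambda>n. w x * C (s n) x) \<longlonglongrightarrow> w x * (c x * of_real (sqrt pi ^ CARD('n)))"
      by (intro AE_I2 tendsto_mult_left Clim)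
  qed auto
  then have "(LINT x|lborel. w x * (c x * of_real (sqrt pi ^ CARD('n)))) = 0"
    unfolding zero[OF s] by (rule LIMSEQ_unique[OF tendsto_const, symmetric])
  then have "(LINT x|lborel. (w x * c x) * of_real (sqrt pi ^ CARD('n))) = 0" by (simp only: mult.assoc)
  then show ?thesis by simp
qed

text \<open>The conjugate sign of \<open>w\<close> is an almost everywhere limit of continuous functions, which may be cut off at absolute
value \<open>1\<close>. The integrals of \<open>w\<close> against these vanish and tend to the integral of \<open>\<bar>w\<bar>\<close>.\<close>

lemma orthogonal_to_gaussians_imp_zero:
  fixes w :: "real^'n::finite \<Rightarrow> complex"
  assumes w: "integrable lborel w"
    and orth: "\<And>a y. 0 < a \<Longrightarrow> (LINT x|lborel. w x * gauss a (x - y)) = 0"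
  shows "AE x in lborel. w x = 0"
proof -
  have [measurable]: "w \<in> borel_measurable borel" using borel_measurable_integrable[OF w] by simp
  let ?s = "\<lambda>x. cnj (sgn (w x))"
  have s_norm: "norm (?s x) \<le> 1" for x by (simp add: norm_sgn)
  have "(\<lambda>x. sgn (w x)) \<in> borel_measurable borel" by (simp add: sgn_div_norm[abs_def] scaleR_conv_of_real)
  then have [measurable]: "?s \<in> borel_measurable borel"
    by (rule measurable_compose) (intro borel_measurable_continuous_onI continuous_intros)
  then have "?s \<in> borel_measurable lebesgue" by (intro measurable_completion) simp
  then have "?s measurable_on UNIV" by (rule lebesgue_measurable_imp_measurable_on) simp
  then obtain N g where N: "negligible N" and g: "\<And>n. continuous_on UNIV (g n)"
    and lim: "\<And>x. x \<notin> N \<Longrightarrow> (\<lambda>n. g n x) \<longlonglongrightarrow> ?s x"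
    unfolding measurable_on_def by auto
  let ?clamp = "\<lambda>z::complex. z /\<^sub>R max 1 (norm z)"
  define c where "c n x = ?clamp (g n x)" for n x
  have cc: "continuous_on UNIV (c n)" for n
    unfolding c_def by (intro continuous_intros g) auto
  have cb: "norm (c n x) \<le> 1" for n x by (simp add: c_def divide_simps)
  have zero: "(LINT x|lborel. w x * c n x) = 0" for n
    by (rule orthogonal_to_gaussians_imp_orthogonal_to_continuous[OF w orth cc cb])
  have "(\<lambda>n. LINT x|lborel. w x * c n x) \<longlonglongrightarrow> (LINT x|lborel. w x * ?s x)"
  proof (rule integral_dominated_convergence[where w="\<lambda>x. norm (w x)"])
    have "AE x in lebesgue. x \<notin> N" using N by (simp add: negligible_iff_null_sets AE_not_in)
    then have "AE x in lborel. x \<notin> N" by (simp add: AE_completion_iff)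
    then show "AE x in lborel. (\<lambda>n. w x * c n x) \<longlonglongrightarrow> w x * ?s x"
    proof eventually_elim
      fix x assume "x \<notin> N"
      have "(\<lambda>n. ?clamp (g n x)) \<longlonglongrightarrow> ?clamp (?s x)"
        by (intro tendsto_intros lim[OF \<open>x \<notin> N\<close>]) auto
      also have "?clamp (?s x) = ?s x" using s_norm[of x] by (simp add: max_def)
      finally show "(\<lambda>n. w x * c n x) \<longlonglongrightarrow> w x * ?s x" unfolding c_def by (intro tendsto_mult_left)
    qed
    show "AE x in lborel. norm (w x * c n x) \<le> norm (w x)" for n
      using cb by (intro AE_I2) (simp add: norm_mult mult_right_le_one_le)
    show "(\<lambda>x. w x * c n x) \<in> borel_measurable lborel" for n
      using borel_measurable_continuous_onI[OF cc[of n]] by measurable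
  qed (use w in auto)
  then have "(LINT x|lborel. w x * ?s x) = 0"
    unfolding zero by (rule LIMSEQ_unique[OF tendsto_const, symmetric])
  moreover have "w x * ?s x = of_real (norm (w x))" for x
  proof (cases "w x = 0")
    case False
    have "w x * ?s x = inverse (of_real (norm (w x))) * (w x * cnj (w x))"
      by (simp add: sgn_div_norm scaleR_conv_of_real)
    also have "\<dots> = of_real (norm (w x))"
      using False unfolding complex_norm_square[symmetric] by (simp add: power2_eq_square)
    finally show ?thesis .
  qed simp
  ultimately have "(LINT x|lborel. norm (w x)) = 0" by simp
  then show ?thesis using w by (subst (asm) integral_nonneg_eq_0_iff_AE) auto
qed

definition inverse_fourier :: "(real^'n::finite \<Rightarrow> complex) \<Rightarrow> real^'n \<Rightarrow> complex" where
  "inverse_fourier h t = (LINT \<omega>|lborel. h \<omega> * cis (2 * pi * (t \<bullet> \<omega>)))"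

lemma norm_inverse_fourier_le:
  "norm (inverse_fourier h t) \<le> (LINT \<omega>|lborel. norm (h \<omega>))"
  unfolding inverse_fourier_def by (rule order_trans[OF integral_norm_bound]) (simp add: norm_mult)

lemma continuous_inverse_fourier:
  assumes h: "integrable lborel h"
  shows "continuous_on A (inverse_fourier h)"
proof -
  have [measurable]: "h \<in> borel_measurable borel" using borel_measurable_integrable[OF h] by simp
  have "continuous_on UNIV (\<lambda>t. LINT \<omega>|lborel. h \<omega> * cis (2 * pi * (t \<bullet> \<omega>)))"
    by (rule continuous_on_param_integral[where w="\<lambda>x. norm (h x)"])
       (use h in \<open>auto intro!: continuous_intros simp: norm_mult\<close>)
  then show ?thesis unfolding inverse_fourier_def[abs_def] by (rule continuous_on_subset) auto
qed

lemma measurable_inverse_fourier: "integrable lborel h \<Longrightarrow> inverse_fourier h \<in> borel_measurable borel"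
  by (intro borel_measurable_continuous_onI continuous_inverse_fourier)

lemma integral_inverse_fourier_fourier:
  assumes h: "integrable lborel h" and f: "f \<in> schwartz"
  shows "(LINT t|lborel. inverse_fourier h t * fourier f t) = (LINT \<omega>|lborel. h \<omega> * f \<omega>)"
proof -
  have [measurable]: "h \<in> borel_measurable borel" using borel_measurable_integrable[OF h] by simp
  have Fc: "continuous_on UNIV (fourier f)" by (rule fourier_continuous[OF schwartz_integrable[OF f]])
  have [measurable]: "fourier f \<in> borel_measurable borel" by (intro borel_measurable_continuous_onI Fc)
  obtain B where B: "0 < B" "\<And>x. norm (fourier f x) \<le> B * decay x" using fourier_schwartz_decay[OF f] by blast
  have Fi: "integrable lborel (fourier f)" by (rule integrable_decay_bound[OF _ B(2)]) simp
  have "(LINT \<omega>|lborel. h \<omega> * f \<omega>) = (LINT \<omega>|lborel. LINT t|lborel. h \<omega> * (fourier f t * cis (2 * pi * (\<omega> \<bullet> t))))"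
    using fourier_inversion[OF f] by (simp add: integral_mult_right_zero)
  also have "\<dots> = (LINT t|lborel. LINT \<omega>|lborel. h \<omega> * (fourier f t * cis (2 * pi * (\<omega> \<bullet> t))))"
    by (rule fubini_convolution_bound(4)[where a="\<lambda>\<omega>. norm (h \<omega>)" and b="\<lambda>t. norm (fourier f t)" and \<tau>="\<lambda>_. 0"])
       (use h Fi in \<open>auto simp: norm_mult\<close>)
  also have "\<dots> = (LINT t|lborel. inverse_fourier h t * fourier f t)"
    unfolding inverse_fourier_def integral_mult_left_zero[symmetric]
    by (simp add: inner_commute ac_simps)
  finally show ?thesis ..
qed

text \<open>Every Gaussian of any centre and width is a multiple of the Fourier transform of a modulated Gaussian. Tested
against these, \<open>g\<close> and the inverse Fourier transform of \<open>h\<close> have the same integrals, so their difference \<open>f\<close> is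
orthogonal to all Gaussians. As \<open>f\<close> itself need not be integrable, the uniqueness lemma is applied to \<open>f\<close> times a
fixed Gaussian. This product is again orthogonal to all Gaussians, since a product of two Gaussians is a multiple of
a Gaussian.\<close>

theorem fourier_in_L1_representation:
  fixes g :: "real^'n::finite \<Rightarrow> complex"
  assumes g: "g \<in> borel_measurable lebesgue" and gF: "fourier_in_L1 g"
  obtains h where "integrable lborel h" "AE t in lborel. g t = inverse_fourier h t"
proof -
  obtain h1 where h1: "integrable lebesgue h1"
    and dist: "fourier_distribution (regular_distribution g) = regular_distribution h1"
    using gF unfolding fourier_in_L1_def by blast
  have gint: "integrable lebesgue (\<lambda>t. g t * \<phi> t)" if "\<phi> \<in> schwartz" for \<phi>
    using gF that unfolding fourier_in_L1_def by blast
  obtain h where h_m: "h \<in> borel_measurable borel" and h_ae: "AE x in lborel. h1 x = h x"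
    by (rule lebesgue_borel_representative[OF borel_measurable_integrable[OF h1]])
  have h: "integrable lborel h"
    using lebesgue_integral_AE_eq(2)[OF borel_measurable_integrable[OF h1] h_m h_ae] h1 by simp
  obtain g' where g' [measurable]: "g' \<in> borel_measurable borel" and g'_ae: "AE x in lborel. g x = g' x"
    by (rule lebesgue_borel_representative[OF g])
  note [measurable] = h_m measurable_inverse_fourier[OF h]
  have leb: "\<phi> \<in> borel_measurable lebesgue" if "\<phi> \<in> schwartz" for \<phi> :: "real^'n \<Rightarrow> complex"
    using schwartz_measurable[OF that] by (intro measurable_completion) simp
  have g'_int: "integrable lborel (\<lambda>t. g' t * \<phi> t)" and g'_eq: "(LINT t|lebesgue. g t * \<phi> t) = (LINT t|lborel. g' t * \<phi> t)"
    if \<phi>: "\<phi> \<in> schwartz" for \<phi>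
  proof -
    have ae: "AE t in lborel. g t * \<phi> t = g' t * \<phi> t" using g'_ae by eventually_elim simp
    have m: "(\<lambda>t. g t * \<phi> t) \<in> borel_measurable lebesgue" "(\<lambda>t. g' t * \<phi> t) \<in> borel_measurable borel"
      using g leb[OF \<phi>] schwartz_measurable[OF \<phi>] by auto
    show "integrable lborel (\<lambda>t. g' t * \<phi> t)" using lebesgue_integral_AE_eq(2)[OF m ae] gint[OF \<phi>] by simp
    show "(LINT t|lebesgue. g t * \<phi> t) = (LINT t|lborel. g' t * \<phi> t)" by (rule lebesgue_integral_AE_eq(1)[OF m ae])
  qed
  define f where "f t = g' t - inverse_fourier h t" for t
  have [measurable]: "f \<in> borel_measurable borel" unfolding f_def by measurable
  have fint: "integrable lborel (\<lambda>t. f t * \<phi> t)" if \<phi>: "\<phi> \<in> schwartz" for \<phi>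
  proof -
    have "integrable lborel (\<lambda>t. inverse_fourier h t * \<phi> t)"
    proof (rule Bochner_Integration.integrable_bound)
      show "integrable lborel (\<lambda>t. (LINT \<omega>|lborel. norm (h \<omega>)) * norm (\<phi> t))"
        by (intro integrable_mult_right integrable_norm schwartz_integrable \<phi>)
      show "AE t in lborel. norm (inverse_fourier h t * \<phi> t) \<le> norm ((LINT \<omega>|lborel. norm (h \<omega>)) * norm (\<phi> t))"
        by (intro AE_I2) (simp add: norm_mult mult_right_mono norm_inverse_fourier_le abs_of_nonneg integral_nonneg_AE)
    qed (use schwartz_measurable[OF \<phi>] in auto)
    then show ?thesis using g'_int[OF \<phi>] by (simp add: f_def left_diff_distrib)
  qed
  have forth: "(LINT t|lborel. f t * gauss b (t - y)) = 0" if b: "0 < b" for b y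
  proof -
    define a where "a = pi\<^sup>2 / b"
    have a: "0 < a" "pi\<^sup>2 / a = b" using b by (auto simp: a_def)
    define K where "K = complex_of_real (sqrt (pi / a) ^ CARD('n))"
    have K: "K \<noteq> 0" using a by (simp add: K_def)
    let ?\<phi> = "modulation y (gauss a)"
    have \<phi>: "?\<phi> \<in> schwartz" by (intro schwartz_modulation gauss_schwartz a)
    have F: "fourier ?\<phi> = (\<lambda>t. K * gauss b (t - y))"
      unfolding modulation_def K_def
      by (rule ext, subst fourier_modulate) (simp_all add: fourier_gauss[OF a(1)] a(2))
    have G: "translation y (gauss b) \<in> schwartz" by (intro schwartz_translation gauss_schwartz b)
    then have FS: "fourier ?\<phi> \<in> schwartz"
      using schwartz_lincomb[OF G G, of K 0] by (simp add: F translation_def)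
    have "(LINT t|lborel. g' t * fourier ?\<phi> t) = (LINT t|lborel. h t * ?\<phi> t)"
    proof -
      have "(LINT t|lborel. g' t * fourier ?\<phi> t) = fourier_distribution (regular_distribution g) ?\<phi>"
        using \<phi> FS by (simp add: fourier_distribution_def regular_distribution_def g'_eq)
      also have "\<dots> = (LINT t|lebesgue. h1 t * ?\<phi> t)" unfolding dist using \<phi> by (simp add: regular_distribution_def)
      also have "\<dots> = (LINT t|lborel. h t * ?\<phi> t)"
      proof (rule lebesgue_integral_AE_eq(1))
        show "AE t in lborel. h1 t * ?\<phi> t = h t * ?\<phi> t" using h_ae by eventually_elim simp
      qed (use borel_measurable_integrable[OF h1] leb[OF \<phi>] schwartz_measurable[OF \<phi>] in auto)
      finally show ?thesis .
    qed
    also have "\<dots> = (LINT t|lborel. inverse_fourier h t * fourier ?\<phi> t)"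
      by (rule integral_inverse_fourier_fourier[OF h \<phi>, symmetric])
    finally have eq: "(LINT t|lborel. g' t * fourier ?\<phi> t) = (LINT t|lborel. inverse_fourier h t * fourier ?\<phi> t)" .
    have "integrable lborel (\<lambda>t. g' t * fourier ?\<phi> t - f t * fourier ?\<phi> t)"
      by (intro Bochner_Integration.integrable_diff g'_int fint FS)
    then have "integrable lborel (\<lambda>t. inverse_fourier h t * fourier ?\<phi> t)" by (simp add: f_def algebra_simps)
    then have "(LINT t|lborel. f t * fourier ?\<phi> t) = 0"
      using g'_int[OF FS] eq by (simp add: f_def left_diff_distrib)
    then have "(LINT t|lborel. K * (f t * gauss b (t - y))) = 0" unfolding F by (simp add: ac_simps)
    then show ?thesis using K by simp
  qed
  have "AE t in lborel. f t * gauss 1 t = 0"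
  proof (rule orthogonal_to_gaussians_imp_zero)
    show "integrable lborel (\<lambda>t. f t * gauss 1 t)" by (intro fint gauss_schwartz) simp
    fix a :: real and y :: "real^'n" assume a: "0 < a"
    \<comment> \<open>The product of the Gaussians of parameter \<open>1\<close> at \<open>0\<close> and of parameter \<open>a\<close> at \<open>y\<close> is centred at the weighted mean
        \<open>b *\<^sub>R y\<close>.\<close>
    define b where "b = a / (1 + a)"
    have b: "(1 + a) * b = a" using a by (simp add: b_def)
    let ?y = "b *\<^sub>R y"
    let ?K = "complex_of_real (exp (- b * (y \<bullet> y)))"
    have "gauss 1 t * gauss a (t - y) = ?K * gauss (1 + a) (t - ?y)" for t
    proof -
      have square: "T + a * (T - 2 * Z + Y) = b * Y + (1 + a) * (T - 2 * (b * Z) + b * (b * Y))" for T Y Z :: real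
      proof -
        have "b * Y + (1 + a) * (T - 2 * (b * Z) + b * (b * Y)) = (1 + a) * T - 2 * (((1 + a) * b) * Z) + (b * Y + ((1 + a) * b) * (b * Y))"
          by (simp add: algebra_simps)
        also have "\<dots> = (1 + a) * T - 2 * (a * Z) + (b * Y + a * (b * Y))" unfolding b ..
        also have "b * Y + a * (b * Y) = ((1 + a) * b) * Y" by (simp add: algebra_simps)
        finally show ?thesis unfolding b by (simp add: algebra_simps)
      qed
      have norm_diff: "(p - q) \<bullet> (p - q) = p \<bullet> p - 2 * (p \<bullet> q) + q \<bullet> q" for p q :: "real^'n"
        by (simp add: inner_diff_left inner_diff_right inner_commute)
      have "(t \<bullet> t) + a * ((t - y) \<bullet> (t - y)) = b * (y \<bullet> y) + (1 + a) * ((t - ?y) \<bullet> (t - ?y))"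
        unfolding norm_diff using square[of "t \<bullet> t" "t \<bullet> y" "y \<bullet> y"] by simp
      then have "exp (- ((t \<bullet> t) + a * ((t - y) \<bullet> (t - y)))) = exp (- (b * (y \<bullet> y) + (1 + a) * ((t - ?y) \<bullet> (t - ?y))))"
        by simp
      then show ?thesis by (simp add: gauss_def exp_add exp_diff exp_minus field_simps flip: of_real_mult)
    qed
    then have "(LINT t|lborel. f t * gauss 1 t * gauss a (t - y)) = (LINT t|lborel. ?K * (f t * gauss (1 + a) (t - ?y)))"
      by (simp add: mult.assoc mult.left_commute)
    also have "\<dots> = 0" using forth[of "1 + a" ?y] a by simp
    finally show "(LINT t|lborel. f t * gauss 1 t * gauss a (t - y)) = 0" .
  qed
  then have "AE t in lborel. g t = inverse_fourier h t"
    using g'_ae by eventually_elim (simp add: f_def gauss_def)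
  then show thesis using that h by blast
qed

section \<open>The Gabor series on Schwartz functions\<close>

lemma matrix_vector_mult_uminus: "A *v (- x) = - (A *v x)" for A :: "real^'n::finite^'m::finite"
  using linear_neg[OF matrix_vector_mul_linear[of A]] by simp

lemma measurable_pos [measurable]: "pos \<in> borel_measurable borel"
  and measurable_freq [measurable]: "freq \<in> borel_measurable borel"
  by (intro borel_measurable_continuous_onI continuous_intros)+

lemma measurable_cnj [measurable (raw)]:
  assumes "f \<in> borel_measurable M"
  shows "(\<lambda>x. cnj (f x)) \<in> borel_measurable M"
  by (rule measurable_compose[OF assms]) (intro borel_measurable_continuous_onI continuous_intros)

lemma integrable_phase_product:
  fixes a b :: "real^'n::finite \<Rightarrow> real"
  assumes a: "integrable lborel a" and b: "integrable lborel b"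
  shows "integrable lborel (\<lambda>p. a (pos p) * b (freq p))"
    and "(LINT p|lborel. a (pos p) * b (freq p)) = (LINT x|lborel. a x) * (LINT y|lborel. b y)"
proof -
  have [measurable]: "a \<in> borel_measurable borel" "b \<in> borel_measurable borel"
    using borel_measurable_integrable[OF a] borel_measurable_integrable[OF b] by auto
  have "integrable (lborel \<Otimes>\<^sub>M lborel) (\<lambda>(x, y). a x * b y)"
    by (rule fubini_convolution_bound(1)[where a="\<lambda>x. \<bar>a x\<bar>" and b="\<lambda>y. \<bar>b y\<bar>" and \<tau>="\<lambda>_. 0"])
       (use a b in \<open>auto simp: abs_mult\<close>)
  then show i: "integrable lborel (\<lambda>p. a (pos p) * b (freq p))"
    unfolding lborel_prod by (subst lborel_phase) (simp add: integrable_distr_eq split_beta')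
  show "(LINT p|lborel. a (pos p) * b (freq p)) = (LINT x|lborel. a x) * (LINT y|lborel. b y)"
    by (subst integral_phase[OF i]) simp
qed

lemma L2_inner_tf_shift: "L2_inner u (tf_shift z g) = STFT g u z"
  unfolding L2_inner_def STFT_def tf_shift_def modulation_def translation_def
  by (simp add: cis_cnj mult.assoc)

lemma STFT_lborel:
  assumes [measurable]: "u \<in> borel_measurable borel" "g \<in> borel_measurable borel"
  shows "STFT g u z = (LINT t|lborel. u t * cis (- 2 * pi * (freq z \<bullet> t)) * cnj (g (t - pos z)))"
  unfolding STFT_def by (rule integral_lebesgue_lborel) measurable

lemma matrix_inv_left: "matrix_inv A ** A = mat 1" if "invertible A" for A :: "real^'m::finite^'m"
  using someI_ex[OF that[unfolded invertible_def]] unfolding matrix_inv_def by simp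

lemma cnj_inverse_fourier:
  "cnj (inverse_fourier h t) = (LINT \<eta>|lborel. cnj (h \<eta>) * cis (- 2 * pi * (t \<bullet> \<eta>)))"
  unfolding inverse_fourier_def Bochner_Integration.integral_cnj[symmetric] complex_cnj_mult cis_cnj by (simp only: mult_minus_left)

lemma abs_decay [simp]: "\<bar>decay x\<bar> = decay x"
  using decay_pos[of x] by simp

text \<open>Integrating over \<open>t\<close> first writes the short-time Fourier transform as a convolution over frequencies. In this
form the short-time Fourier transform inherits the decay of the Fourier transform of \<open>u\<close> in the frequency
variable.\<close>

lemma STFT_inverse_fourier:
  assumes h: "integrable lborel h" and u: "u \<in> schwartz"
  shows "STFT (inverse_fourier h) u z = (LINT \<eta>|lborel. cnj (h \<eta>) * cis (2 * pi * (\<eta> \<bullet> pos z)) * fourier u (freq z + \<eta>))"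
proof -
  note [measurable] = borel_measurable_integrable[OF h, simplified] schwartz_measurable[OF u] measurable_inverse_fourier[OF h]
  let ?x = "pos z" and ?w = "freq z"
  let ?k = "\<lambda>t \<eta>. u t * cis (- 2 * pi * (?w \<bullet> t)) * (cnj (h \<eta>) * cis (- 2 * pi * ((t - ?x) \<bullet> \<eta>)))"
  have "STFT (inverse_fourier h) u z = (LINT t|lborel. u t * cis (- 2 * pi * (?w \<bullet> t)) * cnj (inverse_fourier h (t - ?x)))"
    by (rule STFT_lborel) measurable
  also have "\<dots> = (LINT t|lborel. LINT \<eta>|lborel. ?k t \<eta>)"
    unfolding cnj_inverse_fourier integral_mult_right_zero ..
  also have "\<dots> = (LINT \<eta>|lborel. LINT t|lborel. ?k t \<eta>)"
    by (rule fubini_convolution_bound(4)[where a="\<lambda>t. norm (u t)" and b="\<lambda>\<eta>. norm (h \<eta>)" and \<tau>="\<lambda>_. 0"])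
       (use h schwartz_integrable[OF u] in \<open>auto simp: norm_mult\<close>)
  also have "\<dots> = (LINT \<eta>|lborel. cnj (h \<eta>) * cis (2 * pi * (\<eta> \<bullet> ?x)) * fourier u (?w + \<eta>))"
  proof (intro Bochner_Integration.integral_cong refl)
    fix \<eta>
    have "?k t \<eta> = cnj (h \<eta>) * cis (2 * pi * (\<eta> \<bullet> ?x)) * (u t * cis (- 2 * pi * (t \<bullet> (?w + \<eta>))))" for t
    proof -
      have "cis (- 2 * pi * (?w \<bullet> t)) * cis (- 2 * pi * ((t - ?x) \<bullet> \<eta>)) = cis (2 * pi * (\<eta> \<bullet> ?x)) * cis (- 2 * pi * (t \<bullet> (?w + \<eta>)))"
        unfolding cis_mult by (simp add: inner_diff_left inner_add_right inner_commute algebra_simps)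
      then show ?thesis by (simp only: ac_simps)
    qed
    then have "(LINT t|lborel. ?k t \<eta>) = (LINT t|lborel. cnj (h \<eta>) * cis (2 * pi * (\<eta> \<bullet> ?x)) * (u t * cis (- 2 * pi * (t \<bullet> (?w + \<eta>)))))"
      by (simp only:)
    then show "(LINT t|lborel. ?k t \<eta>) = cnj (h \<eta>) * cis (2 * pi * (\<eta> \<bullet> ?x)) * fourier u (?w + \<eta>)"
      by (simp only: integral_mult_right_zero fourier_lborel[OF schwartz_measurable[OF u]])
  qed
  finally show ?thesis .
qed

text \<open>The pairing of \<open>\<pi>\<^sub>z \<gamma>\<close> with \<open>\<phi>\<close> after the substitution \<open>t = s + pos z\<close>, which moves the dependence on \<open>z\<close> from \<open>\<gamma>\<close>
to the smooth function \<open>\<phi>\<close>.\<close>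

definition window_pairing :: "(real^'n::finite \<Rightarrow> complex) \<Rightarrow> (real^'n \<Rightarrow> complex) \<Rightarrow> real^('n + 'n) \<Rightarrow> complex" where
  "window_pairing \<gamma> \<phi> z = (LINT s|lborel. \<gamma> s * \<phi> (s + pos z) * cis (2 * pi * (freq z \<bullet> (s + pos z))))"

lemma regular_distribution_tf_shift:
  assumes [measurable]: "\<gamma> \<in> borel_measurable borel" and \<phi>: "\<phi> \<in> schwartz"
  shows "regular_distribution (tf_shift z \<gamma>) \<phi> = window_pairing \<gamma> \<phi> z"
proof -
  note [measurable] = schwartz_measurable[OF \<phi>]
  let ?k = "\<lambda>t. cis (2 * pi * (freq z \<bullet> t)) * \<gamma> (t - pos z) * \<phi> t"
  have "regular_distribution (tf_shift z \<gamma>) \<phi> = (LINT t|lborel. ?k t)"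
    using \<phi> by (simp add: regular_distribution_def tf_shift_def modulation_def translation_def integral_lebesgue_lborel)
  also have "\<dots> = (LINT s|lborel. ?k (s + pos z))" by (rule integral_shift[symmetric]) measurable
  finally show ?thesis unfolding window_pairing_def by (simp add: ac_simps)
qed

context
  fixes h \<gamma> u \<phi> :: "real^'n::finite \<Rightarrow> complex"
  assumes h: "integrable lborel h" and \<gamma>: "integrable lborel \<gamma>"
    and u: "u \<in> schwartz" and \<phi>: "\<phi> \<in> schwartz"
begin

lemmas [measurable] = borel_measurable_integrable[OF h, simplified] borel_measurable_integrable[OF \<gamma>, simplified]
  schwartz_measurable[OF u] schwartz_measurable[OF \<phi>] measurable_inverse_fourier[OF h]

lemma fourier_u_continuous: "continuous_on A (fourier u)"
  by (rule continuous_on_subset[OF fourier_continuous[OF schwartz_integrable[OF u]]]) simp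

lemma fourier_u_measurable [measurable]: "fourier u \<in> borel_measurable borel"
  by (intro borel_measurable_continuous_onI fourier_u_continuous)

lemma fourier_u_integrable: "integrable lborel (fourier u)"
  by (metis fourier_schwartz_decay[OF u] integrable_decay_bound fourier_u_measurable)

text \<open>The values of this function at the points \<open>- L \<kappa>\<close> are the terms of the Gabor series of \<open>u\<close> tested against \<open>\<phi>\<close>.\<close>

definition gabor_symbol :: "real^('n + 'n) \<Rightarrow> complex" where
  "gabor_symbol z = STFT (inverse_fourier h) u z * window_pairing \<gamma> \<phi> z"

text \<open>The two factors of the symbol are dominated by convolutions in the frequency and in the position variable. Their
product is therefore dominated by a convolution over phase space of the integrable function
\<open>\<bar>\<gamma> (pos p)\<bar> \<bar>h (freq p)\<bar>\<close> with \<open>decay\<close>.\<close>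

lemma gabor_symbol_bound:
  obtains D where "0 < D" "\<And>z. norm (gabor_symbol z) \<le> D * (LINT p|lborel. norm (\<gamma> (pos p)) * norm (h (freq p)) * decay (z + p))"
proof -
  let ?N = "2 * CARD('n + 'n)"
  obtain B1 where B1: "0 < B1" "\<And>x. (1 + norm x) ^ ?N * norm (\<phi> x) \<le> B1"
    using schwartz_decay_power[OF \<phi>] by blast
  obtain B2 where B2: "0 < B2" "\<And>x. (1 + norm x) ^ ?N * norm (fourier u x) \<le> B2"
    using fourier_schwartz_decay_power[OF u] by blast
  define e where "e x = inverse ((1 + norm x) ^ ?N)" for x :: "real^'n"
  have pos1: "0 < (1 + norm x) ^ ?N" for x :: "real^'n" by (simp add: add_pos_nonneg)
  have e: "0 < e x" "e x \<le> 1" for x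
    using pos1[of x] by (auto simp: e_def intro!: inverse_le_1_iff[THEN iffD2] one_le_power)
  have [measurable]: "e \<in> borel_measurable borel" unfolding e_def[abs_def] by measurable
  have b1: "norm (\<phi> x) \<le> B1 * e x" and b2: "norm (fourier u x) \<le> B2 * e x" for x
    using B1(2)[of x] B2(2)[of x] pos1[of x] by (simp_all add: e_def field_simps)
  \<comment> \<open>The product of the decay in position and in frequency dominates decay in phase space, since
      \<open>1 + norm q \<le> (1 + norm (pos q)) * (1 + norm (freq q))\<close>.\<close>
  have ee: "e (pos z + pos p) * e (freq z + freq p) \<le> decay (z + p)" for z p :: "real^('n + 'n)"
  proof -
    let ?q = "z + p"
    have q: "pos z + pos p = pos ?q" "freq z + freq p = freq ?q" by (simp_all add: pos_def freq_def vec_eq_iff)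
    have "(norm ?q)\<^sup>2 = (norm (pos ?q))\<^sup>2 + (norm (freq ?q))\<^sup>2"
      unfolding power2_norm_eq_inner using inner_phase[of "pos ?q" "freq ?q" ?q] by simp
    also have "\<dots> \<le> (norm (pos ?q) + norm (freq ?q))\<^sup>2" by (simp add: power2_sum)
    finally have "norm ?q \<le> norm (pos ?q) + norm (freq ?q)" by (rule power2_le_imp_le) simp
    then have "1 + norm ?q \<le> 1 + (norm (pos ?q) + norm (freq ?q))" by simp
    also have "\<dots> \<le> (1 + norm (pos ?q)) * (1 + norm (freq ?q))" by (simp add: algebra_simps)
    finally have "1 + norm ?q \<le> (1 + norm (pos ?q)) * (1 + norm (freq ?q))" .
    then have "(1 + norm ?q) ^ ?N \<le> (1 + norm (pos ?q)) ^ ?N * (1 + norm (freq ?q)) ^ ?N"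
      unfolding power_mult_distrib[symmetric] by (intro power_mono) auto
    then have "inverse ((1 + norm (pos ?q)) ^ ?N * (1 + norm (freq ?q)) ^ ?N) \<le> inverse ((1 + norm ?q) ^ ?N)"
      by (intro le_imp_inverse_le) (auto simp: add_pos_nonneg)
    then show ?thesis unfolding q e_def decay_def by simp
  qed
  have ig: "integrable lborel (\<lambda>s. norm (\<gamma> s) * e (x + s))" for x
    by (rule Bochner_Integration.integrable_bound[OF integrable_norm[OF \<gamma>]])
       (use e in \<open>auto simp: abs_mult mult_left_le less_imp_le\<close>)
  have ih: "integrable lborel (\<lambda>\<eta>. norm (h \<eta>) * e (x + \<eta>))" for x
    by (rule Bochner_Integration.integrable_bound[OF integrable_norm[OF h]])
       (use e in \<open>auto simp: abs_mult mult_left_le less_imp_le\<close>)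
  have V: "norm (STFT (inverse_fourier h) u z) \<le> B2 * (LINT \<eta>|lborel. norm (h \<eta>) * e (freq z + \<eta>))" for z
  proof -
    have "norm (STFT (inverse_fourier h) u z) \<le> (LINT \<eta>|lborel. norm (cnj (h \<eta>) * cis (2 * pi * (\<eta> \<bullet> pos z)) * fourier u (freq z + \<eta>)))"
      unfolding STFT_inverse_fourier[OF h u] by (rule integral_norm_bound)
    also have "\<dots> \<le> (LINT \<eta>|lborel. B2 * (norm (h \<eta>) * e (freq z + \<eta>)))"
    proof (rule integral_mono')
      show "integrable lborel (\<lambda>\<eta>. B2 * (norm (h \<eta>) * e (freq z + \<eta>)))" by (intro integrable_mult_right ih)
      show "norm (cnj (h \<eta>) * cis (2 * pi * (\<eta> \<bullet> pos z)) * fourier u (freq z + \<eta>)) \<le> B2 * (norm (h \<eta>) * e (freq z + \<eta>))" for \<eta>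
        using mult_left_mono[OF b2[of "freq z + \<eta>"], of "norm (h \<eta>)"] by (simp add: norm_mult ac_simps)
    qed (use e B2(1) in \<open>simp add: less_imp_le\<close>)
    finally show ?thesis by simp
  qed
  have W: "norm (window_pairing \<gamma> \<phi> z) \<le> B1 * (LINT s|lborel. norm (\<gamma> s) * e (pos z + s))" for z
  proof -
    have "norm (window_pairing \<gamma> \<phi> z) \<le> (LINT s|lborel. norm (\<gamma> s * \<phi> (s + pos z) * cis (2 * pi * (freq z \<bullet> (s + pos z)))))"
      unfolding window_pairing_def by (rule integral_norm_bound)
    also have "\<dots> \<le> (LINT s|lborel. B1 * (norm (\<gamma> s) * e (pos z + s)))"
    proof (rule integral_mono')
      show "integrable lborel (\<lambda>s. B1 * (norm (\<gamma> s) * e (pos z + s)))" by (intro integrable_mult_right ig)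
      show "norm (\<gamma> s * \<phi> (s + pos z) * cis (2 * pi * (freq z \<bullet> (s + pos z)))) \<le> B1 * (norm (\<gamma> s) * e (pos z + s))" for s
        using mult_left_mono[OF b1[of "pos z + s"], of "norm (\<gamma> s)"] by (simp add: norm_mult ac_simps)
    qed (use e B1(1) in \<open>simp add: less_imp_le\<close>)
    finally show ?thesis by simp
  qed
  have "norm (gabor_symbol z) \<le> (B2 * B1) * (LINT p|lborel. norm (\<gamma> (pos p)) * norm (h (freq p)) * decay (z + p))" for z
  proof -
    let ?a = "\<lambda>s. norm (\<gamma> s) * e (pos z + s)" and ?b = "\<lambda>\<eta>. norm (h \<eta>) * e (freq z + \<eta>)"
    have "norm (gabor_symbol z) \<le> (B2 * (LINT \<eta>|lborel. ?b \<eta>)) * (B1 * (LINT s|lborel. ?a s))"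
      unfolding gabor_symbol_def norm_mult using e B2(1)
      by (intro mult_mono V W mult_nonneg_nonneg integral_nonneg_AE AE_I2) (auto simp: less_imp_le)
    also have "\<dots> = (B2 * B1) * (LINT p|lborel. ?a (pos p) * ?b (freq p))"
      unfolding integrable_phase_product(2)[OF ig ih] by simp
    also have "\<dots> \<le> (B2 * B1) * (LINT p|lborel. norm (\<gamma> (pos p)) * norm (h (freq p)) * decay (z + p))"
    proof (intro mult_left_mono integral_mono integrable_phase_product(1) ig ih)
      show "integrable lborel (\<lambda>p. norm (\<gamma> (pos p)) * norm (h (freq p)) * decay (z + p))"
        by (rule Bochner_Integration.integrable_bound[OF integrable_phase_product(1)[OF integrable_norm[OF \<gamma>] integrable_norm[OF h]]])
           (use decay_le_1 in \<open>auto simp: abs_mult intro!: AE_I2 mult_left_le\<close>)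
      show "?a (pos p) * ?b (freq p) \<le> norm (\<gamma> (pos p)) * norm (h (freq p)) * decay (z + p)" for p
        using mult_left_mono[OF ee[of z p], of "norm (\<gamma> (pos p)) * norm (h (freq p))"] by (simp add: ac_simps)
    qed (use B1 B2 in auto)
    finally show ?thesis .
  qed
  then show thesis using that[of "B2 * B1"] B1(1) B2(1) by simp
qed

lemma gabor_symbol_continuous: "continuous_on UNIV gabor_symbol"
proof -
  obtain B2 where B2: "0 < B2" "\<And>x. norm (fourier u x) \<le> B2 * decay x" by (rule fourier_schwartz_decay[OF u]) (rule that)
  obtain B1 where B1: "0 < B1" "\<And>x. norm (\<phi> x) \<le> B1 * decay x" by (rule schwartz_decay[OF \<phi>]) (rule that)
  have b: "norm (fourier u x) \<le> B2" "norm (\<phi> x) \<le> B1" for x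
    using le_of_le_mult_decay[OF B2(2)] le_of_le_mult_decay[OF B1(2)] B1(1) B2(1) by simp_all
  have 1: "continuous_on UNIV (\<lambda>z. LINT \<eta>|lborel. cnj (h \<eta>) * cis (2 * pi * (\<eta> \<bullet> pos z)) * fourier u (freq z + \<eta>))"
  proof (rule continuous_on_param_integral[where w="\<lambda>\<eta>. norm (h \<eta>) * B2"])
    show "continuous_on UNIV (\<lambda>z. cnj (h \<eta>) * cis (2 * pi * (\<eta> \<bullet> pos z)) * fourier u (freq z + \<eta>))" for \<eta>
      by (intro continuous_intros continuous_on_compose2[OF fourier_u_continuous[of UNIV]]) auto
  qed (use h b in \<open>auto simp: norm_mult mult_left_mono\<close>)
  have 2: "continuous_on UNIV (\<lambda>z. LINT s|lborel. \<gamma> s * \<phi> (s + pos z) * cis (2 * pi * (freq z \<bullet> (s + pos z))))"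
  proof (rule continuous_on_param_integral[where w="\<lambda>s. norm (\<gamma> s) * B1"])
    show "continuous_on UNIV (\<lambda>z. \<gamma> s * \<phi> (s + pos z) * cis (2 * pi * (freq z \<bullet> (s + pos z))))" for s
      by (intro continuous_intros continuous_on_compose2[OF schwartz_continuous[OF \<phi>, of UNIV]]) auto
  qed (use \<gamma> b in \<open>auto simp: norm_mult mult_left_mono\<close>)
  show ?thesis
    unfolding gabor_symbol_def[abs_def] STFT_inverse_fourier[OF h u] window_pairing_def by (intro continuous_intros 1 2)
qed

text \<open>For each fixed \<open>p\<close> the translates of \<open>decay\<close> have summable suprema over the cells of the lattice, with a bound that
does not depend on \<open>p\<close>. Integrating this bound against \<open>\<bar>\<gamma> (pos p)\<bar> \<bar>h (freq p)\<bar>\<close> gives the claim.\<close>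

lemma gabor_symbol_lattice_bound:
  fixes L :: "real^('n + 'n)^('n + 'n)"
  assumes L: "invertible L"
  obtains M where "M summable_on UNIV"
    "\<And>\<kappa> t. t \<in> cbox (-1) 1 \<Longrightarrow> norm (gabor_symbol (L *v (t + int_vec \<kappa>))) \<le> M \<kappa>"
proof -
  let ?L' = "matrix_inv L"
  let ?m = "real CARD('n + 'n)" and ?N = "2 * CARD('n + 'n)"
  obtain D where D: "0 < D" "\<And>z. norm (gabor_symbol z) \<le> D * (LINT p|lborel. norm (\<gamma> (pos p)) * norm (h (freq p)) * decay (z + p))"
    using gabor_symbol_bound by blast
  let ?k = "\<lambda>p. norm (\<gamma> (pos p)) * norm (h (freq p))"
  have k: "integrable lborel ?k" by (rule integrable_phase_product(1)[OF integrable_norm[OF \<gamma>] integrable_norm[OF h]])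
  have kd: "integrable lborel (\<lambda>p. ?k p * decay (f p))" if [measurable]: "f \<in> borel_measurable borel" for f :: "_ \<Rightarrow> real^('n + 'n)"
    by (rule Bochner_Integration.integrable_bound[OF k])
       (use decay_le_1 in \<open>auto simp: abs_mult intro!: AE_I2 mult_left_le\<close>)
  obtain R where R: "0 < R" "\<And>x. norm (?L' *v x) \<le> norm x * R"
    using linear_bounded_pos[OF matrix_vector_mul_linear[of ?L']] by (metis mult.commute)
  let ?K1 = "(1 + R) ^ ?N" and ?K2 = "(1 + 1 + ?m) ^ ?N"
  have est: "decay (L *v (t + int_vec \<kappa>) + p) \<le> ?K1 * ?K2 * decay (int_vec \<kappa> + ?L' *v p)"
    if t: "t \<in> cbox (-1) 1" for t \<kappa> p
  proof -
    have "?L' *v (L *v (t + int_vec \<kappa>) + p) = t + (int_vec \<kappa> + ?L' *v p)"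
      by (simp add: matrix_vector_right_distrib matrix_vector_mul_assoc matrix_inv_left[OF L] add.assoc)
    then have "norm (t + (int_vec \<kappa> + ?L' *v p)) \<le> R * norm (L *v (t + int_vec \<kappa>) + p) + 0"
      using R(2)[of "L *v (t + int_vec \<kappa>) + p"] by (simp add: mult.commute)
    then have "decay (L *v (t + int_vec \<kappa>) + p) \<le> (1 + R + 0) ^ ?N * decay (t + (int_vec \<kappa> + ?L' *v p))"
      by (rule decay_perturb) (use R in auto)
    also have "\<dots> \<le> (1 + R + 0) ^ ?N * (?K2 * decay (int_vec \<kappa> + ?L' *v p))"
      using R by (intro mult_left_mono decay_box_shift t) auto
    finally show ?thesis by (simp add: mult.assoc)
  qed
  define M where "M \<kappa> = D * (?K1 * ?K2) * (LINT p|lborel. ?k p * decay (int_vec \<kappa> + ?L' *v p))" for \<kappa>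
  have M: "norm (gabor_symbol (L *v (t + int_vec \<kappa>))) \<le> M \<kappa>" if t: "t \<in> cbox (-1) 1" for t \<kappa>
  proof -
    have "norm (gabor_symbol (L *v (t + int_vec \<kappa>))) \<le> D * (LINT p|lborel. ?k p * decay (L *v (t + int_vec \<kappa>) + p))"
      by (rule D(2))
    also have "\<dots> \<le> D * (LINT p|lborel. (?K1 * ?K2) * (?k p * decay (int_vec \<kappa> + ?L' *v p)))"
    proof (intro mult_left_mono integral_mono integrable_mult_right kd)
      show "?k p * decay (L *v (t + int_vec \<kappa>) + p) \<le> (?K1 * ?K2) * (?k p * decay (int_vec \<kappa> + ?L' *v p))" for p
        using mult_left_mono[OF est[OF t, of \<kappa> p], of "?k p"] by (simp add: ac_simps)
    qed (use D in auto)
    finally show ?thesis by (simp add: M_def mult.assoc)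
  qed
  obtain B where B: "\<And>(q::real^('n + 'n)) F. finite F \<Longrightarrow> (\<Sum>\<kappa>\<in>F. decay (int_vec \<kappa> + q)) \<le> B" and "0 \<le> B"
    by (rule sum_decay_bounded) (rule that)
  have "(\<lambda>\<kappa>. LINT p|lborel. ?k p * decay (int_vec \<kappa> + ?L' *v p)) summable_on UNIV"
  proof (rule nonneg_bdd_above_summable_on)
    show "0 \<le> (LINT p|lborel. ?k p * decay (int_vec \<kappa> + ?L' *v p))" for \<kappa>
      by (intro integral_nonneg_AE AE_I2 mult_nonneg_nonneg less_imp_le[OF decay_pos]) auto
    show "bdd_above (sum (\<lambda>\<kappa>. LINT p|lborel. ?k p * decay (int_vec \<kappa> + ?L' *v p)) ` {F. F \<subseteq> UNIV \<and> finite F})"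
    proof (rule bdd_aboveI2[where M="(LINT p|lborel. ?k p * B)"], clarify)
      fix F :: "(int^('n + 'n)) set" assume F: "finite F"
      have "(\<Sum>\<kappa>\<in>F. LINT p|lborel. ?k p * decay (int_vec \<kappa> + ?L' *v p)) = (LINT p|lborel. (\<Sum>\<kappa>\<in>F. ?k p * decay (int_vec \<kappa> + ?L' *v p)))"
        by (rule Bochner_Integration.integral_sum[symmetric]) (intro kd, measurable)
      also have "\<dots> \<le> (LINT p|lborel. ?k p * B)"
      proof (rule integral_mono)
        show "integrable lborel (\<lambda>p. \<Sum>\<kappa>\<in>F. ?k p * decay (int_vec \<kappa> + ?L' *v p))"
          by (intro Bochner_Integration.integrable_sum kd) measurable
        show "integrable lborel (\<lambda>p. ?k p * B)" by (intro integrable_mult_left k)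
        show "(\<Sum>\<kappa>\<in>F. ?k p * decay (int_vec \<kappa> + ?L' *v p)) \<le> ?k p * B" for p
          unfolding sum_distrib_left[symmetric] by (intro mult_left_mono B F) auto
      qed
      finally show "(\<Sum>\<kappa>\<in>F. LINT p|lborel. ?k p * decay (int_vec \<kappa> + ?L' *v p)) \<le> (LINT p|lborel. ?k p * B)" .
    qed
  qed
  then have "M summable_on UNIV" unfolding M_def[abs_def] by (rule summable_on_cmult_right)
  then show thesis using that M by blast
qed

text \<open>For a fixed position the short-time Fourier transform is the Fourier transform of \<open>u t * cnj (g (t - x))\<close>. As it is
integrable in the frequency, it can be inverted, which reduces to Fourier inversion for \<open>u\<close>.\<close>

lemma STFT_integrable_freq: "integrable lborel (\<lambda>\<omega>. STFT (inverse_fourier h) u (phase x \<omega>))"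
  and STFT_inversion: "(LINT \<omega>|lborel. STFT (inverse_fourier h) u (phase x \<omega>) * cis (2 * pi * (\<omega> \<bullet> t))) = u t * cnj (inverse_fourier h (t - x))"
proof -
  have eq: "STFT (inverse_fourier h) u (phase x \<omega>) = (LINT \<eta>|lborel. cnj (h \<eta>) * cis (2 * pi * (\<eta> \<bullet> x)) * fourier u (\<omega> + \<eta>))" for \<omega>
    unfolding STFT_inverse_fourier[OF h u] by simp
  show "integrable lborel (\<lambda>\<omega>. STFT (inverse_fourier h) u (phase x \<omega>))"
    unfolding eq
    by (rule fubini_convolution_bound(3)[where a="\<lambda>\<eta>. norm (h \<eta>)" and b="\<lambda>\<omega>. norm (fourier u \<omega>)" and \<tau>="\<lambda>\<eta>. \<eta>"])
       (use h fourier_u_integrable in \<open>auto simp: norm_mult\<close>)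
  let ?k = "\<lambda>\<eta> \<omega>. cnj (h \<eta>) * cis (2 * pi * (\<eta> \<bullet> x)) * (fourier u (\<omega> + \<eta>) * cis (2 * pi * (\<omega> \<bullet> t)))"
  have "(LINT \<omega>|lborel. STFT (inverse_fourier h) u (phase x \<omega>) * cis (2 * pi * (\<omega> \<bullet> t))) = (LINT \<omega>|lborel. LINT \<eta>|lborel. ?k \<eta> \<omega>)"
    unfolding eq integral_mult_left_zero[symmetric] by (simp only: mult.assoc)
  also have "\<dots> = (LINT \<eta>|lborel. LINT \<omega>|lborel. ?k \<eta> \<omega>)"
    by (rule fubini_convolution_bound(4)[symmetric, where a="\<lambda>\<eta>. norm (h \<eta>)" and b="\<lambda>\<omega>. norm (fourier u \<omega>)" and \<tau>="\<lambda>\<eta>. \<eta>"])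
       (use h fourier_u_integrable in \<open>auto simp: norm_mult\<close>)
  also have "\<dots> = (LINT \<eta>|lborel. u t * cnj (h \<eta> * cis (2 * pi * ((t - x) \<bullet> \<eta>))))"
  proof (intro Bochner_Integration.integral_cong refl)
    fix \<eta>
    have "(LINT \<omega>|lborel. fourier u (\<omega> + \<eta>) * cis (2 * pi * (\<omega> \<bullet> t))) = (LINT \<omega>|lborel. (\<lambda>\<omega>. fourier u \<omega> * cis (2 * pi * ((\<omega> - \<eta>) \<bullet> t))) (\<omega> + \<eta>))"
      by simp
    also have "\<dots> = (LINT \<omega>|lborel. fourier u \<omega> * cis (2 * pi * ((\<omega> - \<eta>) \<bullet> t)))"
      by (rule integral_shift) measurable
    also have "\<dots> = (LINT \<omega>|lborel. cis (- 2 * pi * (\<eta> \<bullet> t)) * (fourier u \<omega> * cis (2 * pi * (t \<bullet> \<omega>))))"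
    proof (intro Bochner_Integration.integral_cong refl)
      fix \<omega>
      have "cis (2 * pi * ((\<omega> - \<eta>) \<bullet> t)) = cis (- 2 * pi * (\<eta> \<bullet> t)) * cis (2 * pi * (t \<bullet> \<omega>))"
        unfolding cis_mult by (simp add: inner_diff_left inner_commute algebra_simps)
      then show "fourier u \<omega> * cis (2 * pi * ((\<omega> - \<eta>) \<bullet> t)) = cis (- 2 * pi * (\<eta> \<bullet> t)) * (fourier u \<omega> * cis (2 * pi * (t \<bullet> \<omega>)))"
        by (simp only: ac_simps)
    qed
    also have "\<dots> = cis (- 2 * pi * (\<eta> \<bullet> t)) * u t"
      unfolding integral_mult_right_zero fourier_inversion[OF u] ..
    finally have "(LINT \<omega>|lborel. ?k \<eta> \<omega>) = cnj (h \<eta>) * cis (2 * pi * (\<eta> \<bullet> x)) * (cis (- 2 * pi * (\<eta> \<bullet> t)) * u t)"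
      unfolding integral_mult_right_zero by (rule arg_cong)
    also have "cis (2 * pi * (\<eta> \<bullet> x)) * cis (- 2 * pi * (\<eta> \<bullet> t)) = cnj (cis (2 * pi * ((t - x) \<bullet> \<eta>)))"
      unfolding cis_mult by (simp add: inner_diff_left inner_commute algebra_simps cis_cnj)
    then have "cnj (h \<eta>) * cis (2 * pi * (\<eta> \<bullet> x)) * (cis (- 2 * pi * (\<eta> \<bullet> t)) * u t) = u t * cnj (h \<eta> * cis (2 * pi * ((t - x) \<bullet> \<eta>)))"
      by (simp only: complex_cnj_mult mult.assoc[symmetric]) (simp only: ac_simps)
    finally show "(LINT \<omega>|lborel. ?k \<eta> \<omega>) = u t * cnj (h \<eta> * cis (2 * pi * ((t - x) \<bullet> \<eta>)))" .
  qed
  also have "\<dots> = u t * cnj (inverse_fourier h (t - x))" by (simp add: inverse_fourier_def del: complex_cnj_mult)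
  finally show "(LINT \<omega>|lborel. STFT (inverse_fourier h) u (phase x \<omega>) * cis (2 * pi * (\<omega> \<bullet> t))) = u t * cnj (inverse_fourier h (t - x))" .
qed

text \<open>A form of the orthogonality relations for short-time Fourier transforms. Integrating over the frequency first undoes
the Fourier transform in \<open>V\<^sub>g u\<close> by the preceding lemma; the remaining double integral over position and time then
splits into a product after a translation.\<close>

lemma fourier_gabor_symbol:
  assumes F: "integrable lborel gabor_symbol"
  shows "fourier gabor_symbol \<zeta> = STFT (inverse_fourier h) \<gamma> (phase (freq \<zeta>) (- pos \<zeta>)) *
     (LINT t|lborel. tf_shift (phase (freq \<zeta>) (- pos \<zeta>)) u t * \<phi> t)"
proof -
  let ?q = "pos \<zeta>" and ?y = "freq \<zeta>"
  let ?I = "\<lambda>x s. \<gamma> s * cnj (inverse_fourier h (s - ?y)) * (\<phi> (s + x) * u (s + x - ?y) * cis (- 2 * pi * (x \<bullet> ?q)))"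
  obtain Bu where Bu: "0 < Bu" "\<And>x. norm (u x) \<le> Bu * decay x" by (rule schwartz_decay[OF u]) (rule that)
  obtain B1 where B1: "0 < B1" "\<And>x. norm (\<phi> x) \<le> B1 * decay x" by (rule schwartz_decay[OF \<phi>]) (rule that)
  have b: "norm (u x) \<le> Bu" "norm (\<phi> x) \<le> B1" for x
    using le_of_le_mult_decay[OF Bu(2)] le_of_le_mult_decay[OF B1(2)] B1(1) Bu(1) by simp_all
  define Bg where "Bg = (LINT \<omega>|lborel. norm (h \<omega>))"
  have bg: "norm (inverse_fourier h x) \<le> Bg" for x unfolding Bg_def by (rule norm_inverse_fourier_le)
  have Bg0: "0 \<le> Bg" by (rule order_trans[OF norm_ge_zero bg[of 0]])
  have [measurable]: "gabor_symbol \<in> borel_measurable borel" using borel_measurable_integrable[OF F] by simp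
  have [measurable]: "(\<lambda>\<omega>. STFT (inverse_fourier h) u (phase x \<omega>)) \<in> borel_measurable borel" for x
    using borel_measurable_integrable[OF STFT_integrable_freq[of x]] by simp
  have Fi: "integrable lborel (\<lambda>z. gabor_symbol z * cis (- 2 * pi * (z \<bullet> \<zeta>)))"
    by (rule Bochner_Integration.integrable_bound[OF F]) (auto simp: norm_mult)
  have "fourier gabor_symbol \<zeta> = (LINT z|lborel. gabor_symbol z * cis (- 2 * pi * (z \<bullet> \<zeta>)))"
    by (rule fourier_lborel) measurable
  also have "\<dots> = (LINT x|lborel. LINT \<omega>|lborel. gabor_symbol (phase x \<omega>) * cis (- 2 * pi * (phase x \<omega> \<bullet> \<zeta>)))"
    by (rule integral_phase[OF Fi])
  also have "(\<lambda>x. LINT \<omega>|lborel. gabor_symbol (phase x \<omega>) * cis (- 2 * pi * (phase x \<omega> \<bullet> \<zeta>)))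
     = (\<lambda>x. LINT s|lborel. ?I x s)"
  proof
    fix x
    let ?V = "\<lambda>\<omega>. STFT (inverse_fourier h) u (phase x \<omega>)"
    let ?k = "\<lambda>\<omega> s. (\<gamma> s * \<phi> (s + x) * cis (- 2 * pi * (x \<bullet> ?q))) * (?V \<omega> * cis (2 * pi * (\<omega> \<bullet> (s + x - ?y))))"
    have "(LINT \<omega>|lborel. gabor_symbol (phase x \<omega>) * cis (- 2 * pi * (phase x \<omega> \<bullet> \<zeta>))) = (LINT \<omega>|lborel. LINT s|lborel. ?k \<omega> s)"
    proof (intro Bochner_Integration.integral_cong refl)
      fix \<omega>
      have "gabor_symbol (phase x \<omega>) * cis (- 2 * pi * (phase x \<omega> \<bullet> \<zeta>)) =
         (LINT s|lborel. ?V \<omega> * cis (- 2 * pi * (phase x \<omega> \<bullet> \<zeta>)) * (\<gamma> s * \<phi> (s + x) * cis (2 * pi * (\<omega> \<bullet> (s + x)))))"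
        by (simp add: gabor_symbol_def window_pairing_def)
      also have "\<dots> = (LINT s|lborel. ?k \<omega> s)"
      proof (intro Bochner_Integration.integral_cong refl)
        fix s
        have "cis (- 2 * pi * (phase x \<omega> \<bullet> \<zeta>)) * cis (2 * pi * (\<omega> \<bullet> (s + x))) = cis (- 2 * pi * (x \<bullet> ?q)) * cis (2 * pi * (\<omega> \<bullet> (s + x - ?y)))"
          unfolding cis_mult by (simp add: inner_phase inner_diff_right inner_add_right algebra_simps)
        then show "?V \<omega> * cis (- 2 * pi * (phase x \<omega> \<bullet> \<zeta>)) * (\<gamma> s * \<phi> (s + x) * cis (2 * pi * (\<omega> \<bullet> (s + x)))) = ?k \<omega> s"
          by (metis (no_types, lifting) mult.assoc mult.left_commute)
      qed
      finally show "gabor_symbol (phase x \<omega>) * cis (- 2 * pi * (phase x \<omega> \<bullet> \<zeta>)) = (LINT s|lborel. ?k \<omega> s)" .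
    qed
    also have "\<dots> = (LINT s|lborel. LINT \<omega>|lborel. ?k \<omega> s)"
    proof (rule fubini_convolution_bound(4)[where a="\<lambda>\<omega>. norm (?V \<omega>)" and b="\<lambda>s. norm (\<gamma> s) * B1" and \<tau>="\<lambda>_. 0"])
      show "integrable lborel (\<lambda>\<omega>. norm (?V \<omega>))" by (intro integrable_norm STFT_integrable_freq)
      show "integrable lborel (\<lambda>s. norm (\<gamma> s) * B1)" by (intro integrable_mult_left integrable_norm \<gamma>)
      show "norm (?k \<omega> s) \<le> norm (?V \<omega>) * (norm (\<gamma> (s + 0)) * B1)" for \<omega> s
      proof -
        have "norm (\<gamma> s) * norm (\<phi> (s + x)) \<le> norm (\<gamma> s) * B1" by (intro mult_left_mono b) auto
        then have "norm (?V \<omega>) * (norm (\<gamma> s) * norm (\<phi> (s + x))) \<le> norm (?V \<omega>) * (norm (\<gamma> s) * B1)" by (rule mult_left_mono) auto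
        then show ?thesis by (simp add: norm_mult ac_simps)
      qed
    qed measurable
    also have "\<dots> = (LINT s|lborel. ?I x s)"
      unfolding integral_mult_right_zero STFT_inversion by (simp add: ac_simps)
    finally show "(LINT \<omega>|lborel. gabor_symbol (phase x \<omega>) * cis (- 2 * pi * (phase x \<omega> \<bullet> \<zeta>)))
      = (LINT s|lborel. ?I x s)" .
  qed
  also have "(LINT x|lborel. LINT s|lborel. ?I x s)
    = (LINT s|lborel. LINT x|lborel. ?I x s)"
  proof (rule fubini_convolution_bound(4)[symmetric, where a="\<lambda>s. norm (\<gamma> s) * (Bg * Bu)" and b="\<lambda>x. norm (\<phi> x)" and \<tau>="\<lambda>s. s"])
    show "integrable lborel (\<lambda>s. norm (\<gamma> s) * (Bg * Bu))" by (intro integrable_mult_left integrable_norm \<gamma>)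
    show "integrable lborel (\<lambda>x. norm (\<phi> x))" by (intro integrable_norm schwartz_integrable \<phi>)
    show "norm (?I x s) \<le> norm (\<gamma> s) * (Bg * Bu) * norm (\<phi> (x + s))" for s x
    proof -
      have "norm (inverse_fourier h (s - ?y)) * norm (u (s + x - ?y)) \<le> Bg * Bu" using Bg0 by (intro mult_mono b bg) auto
      then have "(norm (\<gamma> s) * norm (\<phi> (x + s))) * (norm (inverse_fourier h (s - ?y)) * norm (u (s + x - ?y))) \<le> (norm (\<gamma> s) * norm (\<phi> (x + s))) * (Bg * Bu)"
        by (rule mult_left_mono) auto
      then show ?thesis by (simp add: norm_mult ac_simps)
    qed
  qed measurable
  also have "\<dots> = (LINT s|lborel. (\<gamma> s * cnj (inverse_fourier h (s - ?y)) * cis (2 * pi * (s \<bullet> ?q))) * (LINT t|lborel. \<phi> t * u (t - ?y) * cis (- 2 * pi * (t \<bullet> ?q))))"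
  proof (intro Bochner_Integration.integral_cong refl)
    fix s
    let ?p = "\<lambda>t. \<phi> t * u (t - ?y) * cis (- 2 * pi * (t \<bullet> ?q))"
    have "\<phi> (s + x) * u (s + x - ?y) * cis (- 2 * pi * (x \<bullet> ?q)) = cis (2 * pi * (s \<bullet> ?q)) * ?p (x + s)" for x
    proof -
      have "cis (- 2 * pi * (x \<bullet> ?q)) = cis (2 * pi * (s \<bullet> ?q)) * cis (- 2 * pi * ((x + s) \<bullet> ?q))"
        unfolding cis_mult by (simp add: inner_add_left algebra_simps)
      then show ?thesis by (simp only: ac_simps)
    qed
    moreover have "(LINT x|lborel. ?p (x + s)) = (LINT t|lborel. ?p t)" by (rule integral_shift) measurable
    ultimately show "(LINT x|lborel. ?I x s)
      = (\<gamma> s * cnj (inverse_fourier h (s - ?y)) * cis (2 * pi * (s \<bullet> ?q))) * (LINT t|lborel. ?p t)"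
      by (simp only: integral_mult_right_zero mult.assoc)
  qed
  also have "\<dots> = (LINT s|lborel. \<gamma> s * cnj (inverse_fourier h (s - ?y)) * cis (2 * pi * (s \<bullet> ?q))) * (LINT t|lborel. \<phi> t * u (t - ?y) * cis (- 2 * pi * (t \<bullet> ?q)))"
    by (rule integral_mult_left_zero)
  also have "(LINT s|lborel. \<gamma> s * cnj (inverse_fourier h (s - ?y)) * cis (2 * pi * (s \<bullet> ?q))) = STFT (inverse_fourier h) \<gamma> (phase ?y (- ?q))"
    by (subst STFT_lborel) (simp_all add: inner_commute ac_simps)
  also have "(LINT t|lborel. \<phi> t * u (t - ?y) * cis (- 2 * pi * (t \<bullet> ?q))) = (LINT t|lborel. tf_shift (phase ?y (- ?q)) u t * \<phi> t)"
    by (simp add: tf_shift_def modulation_def translation_def inner_commute ac_simps)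
  finally show ?thesis .
qed

text \<open>Poisson summation for the symbol composed with \<open>L\<close>, whose Fourier transform lives on the dual lattice
\<open>L\<^sup>-\<^sup>T \<kappa>\<close> and carries the factor \<open>1 / \<bar>det L\<bar>\<close> from the change of variables. Replacing \<open>\<kappa>\<close> by \<open>- \<kappa>\<close> on both sides
absorbs the signs.\<close>

theorem janssen_representation:
  fixes L :: "real^('n + 'n)^('n + 'n)"
  assumes L: "invertible L"
    and summable: "(\<lambda>\<kappa>. norm (STFT (inverse_fourier h) \<gamma> (adjoint_lattice_point L \<kappa>))) summable_on UNIV"
  shows "((\<lambda>\<kappa>. L2_inner u (tf_shift (- (L *v int_vec \<kappa>)) (inverse_fourier h)) * regular_distribution (tf_shift (- (L *v int_vec \<kappa>)) \<gamma>) \<phi>)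
     has_sum (\<Sum>\<^sub>\<infinity>\<kappa>. STFT (inverse_fourier h) \<gamma> (adjoint_lattice_point L \<kappa>) *
        (LINT t|lborel. tf_shift (adjoint_lattice_point L \<kappa>) u t * \<phi> t)) / \<bar>det L\<bar>) UNIV"
proof -
  have dL: "det L \<noteq> 0" using L by (simp add: invertible_det_nz)
  let ?l = "adjoint_lattice_point L"
  let ?c = "\<lambda>\<kappa>. STFT (inverse_fourier h) \<gamma> (?l \<kappa>) * (LINT t|lborel. tf_shift (?l \<kappa>) u t * \<phi> t)"
  obtain M where sM: "M summable_on UNIV"
    and M: "\<And>\<kappa> t. t \<in> cbox (-1) 1 \<Longrightarrow> norm (gabor_symbol (L *v (t + int_vec \<kappa>))) \<le> M \<kappa>"
    using gabor_symbol_lattice_bound[OF L] by blast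
  let ?f = "\<lambda>t. gabor_symbol (L *v t)"
  have Fm [measurable]: "gabor_symbol \<in> borel_measurable borel"
    by (intro borel_measurable_continuous_onI gabor_symbol_continuous)
  have fc: "continuous_on UNIV ?f"
    by (intro continuous_on_compose2[OF gabor_symbol_continuous] matrix_vector_mult_linear_continuous_on) auto
  have fi: "integrable lborel ?f"
    by (rule integrable_tiling[OF _ _ sM]) (use M unit_cube_subset_symmetric in auto)
  have F: "integrable lborel gabor_symbol" using fi integrable_linear_vec_iff[OF dL Fm] by simp
  have neg: "?l (- \<kappa>) = - ?l \<kappa>" for \<kappa>
    by (simp add: adjoint_lattice_point_def int_vec_simps matrix_vector_mult_uminus)
  have J: "symplectic_J *v \<zeta> = phase (- freq \<zeta>) (pos \<zeta>)" for \<zeta> :: "real^('n + 'n)"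
  proof -
    have "(symplectic_J *v \<zeta>) $ Inl a = - \<zeta> $ Inr a" "(symplectic_J *v \<zeta>) $ Inr a = \<zeta> $ Inl a" for a
      by (simp_all add: matrix_vector_mult_def symplectic_J_def sum_UNIV_sum if_distrib[of "\<lambda>x. x * c" for c] cong: if_cong)
    then show ?thesis by (simp add: vec_eq_iff phase_def pos_def freq_def split: sum.splits)
  qed
  have ft: "fourier ?f (int_vec \<kappa>) = ?c (- \<kappa>) / \<bar>det L\<bar>" for \<kappa>
  proof -
    let ?r = "transpose (matrix_inv L) *v int_vec \<kappa>"
    have pairing: "(L *v t) \<bullet> ?r = t \<bullet> int_vec \<kappa>" for t
    proof -
      have "(L *v t) \<bullet> ?r = int_vec \<kappa> \<bullet> (matrix_inv L *v (L *v t))"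
        unfolding transpose_matrix_vector inner_commute[of "L *v t"] by (rule dot_lmul_matrix)
      then show ?thesis by (simp add: matrix_vector_mul_assoc matrix_inv_left[OF L] inner_commute)
    qed
    have "fourier gabor_symbol ?r = (LINT z|lborel. gabor_symbol z * cis (- 2 * pi * (z \<bullet> ?r)))"
      by (rule fourier_lborel) measurable
    also have "\<dots> = \<bar>det L\<bar> *\<^sub>R (LINT t|lborel. gabor_symbol (L *v t) * cis (- 2 * pi * ((L *v t) \<bullet> ?r)))"
      by (rule integral_linear_vec[OF dL]) measurable
    also have "(LINT t|lborel. gabor_symbol (L *v t) * cis (- 2 * pi * ((L *v t) \<bullet> ?r))) = fourier ?f (int_vec \<kappa>)"
      unfolding pairing by (rule fourier_lborel[symmetric]) measurable
    finally have "fourier ?f (int_vec \<kappa>) = fourier gabor_symbol ?r / \<bar>det L\<bar>"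
      using dL by (simp add: scaleR_conv_of_real)
    also have "phase (freq ?r) (- pos ?r) = ?l (- \<kappa>)"
      unfolding neg unfolding adjoint_lattice_point_def J by (simp add: vec_eq_iff phase_def split: sum.splits)
    then have "fourier gabor_symbol ?r = ?c (- \<kappa>)" unfolding fourier_gabor_symbol[OF F] by simp
    finally show ?thesis .
  qed
  obtain Bu where Bu: "0 < Bu" "\<And>x. norm (u x) \<le> Bu * decay x" by (rule schwartz_decay[OF u]) (rule that)
  have b: "norm (u x) \<le> Bu" for x
    using le_of_le_mult_decay[OF Bu(2)] Bu(1) by simp
  have cb: "norm (?c \<kappa>) \<le> norm (STFT (inverse_fourier h) \<gamma> (?l \<kappa>)) * (LINT t|lborel. Bu * norm (\<phi> t))" for \<kappa>
  proof -
    have "norm (LINT t|lborel. tf_shift (?l \<kappa>) u t * \<phi> t) \<le> (LINT t|lborel. norm (tf_shift (?l \<kappa>) u t * \<phi> t))"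
      by (rule integral_norm_bound)
    also have "\<dots> \<le> (LINT t|lborel. Bu * norm (\<phi> t))"
    proof (rule integral_mono')
      show "integrable lborel (\<lambda>t. Bu * norm (\<phi> t))" by (intro integrable_mult_right integrable_norm schwartz_integrable \<phi>)
      show "norm (tf_shift (?l \<kappa>) u t * \<phi> t) \<le> Bu * norm (\<phi> t)" for t
        using b by (simp add: tf_shift_def modulation_def translation_def norm_mult mult_right_mono)
    qed (use Bu in auto)
    finally show ?thesis unfolding norm_mult by (rule mult_left_mono) simp
  qed
  have cs: "(\<lambda>\<kappa>. norm (?c \<kappa>)) summable_on UNIV"
    by (rule Infinite_Sum.abs_summable_on_comparison_test'[OF summable_on_cmult_left[OF summable]]) (rule cb)
  have bij: "bij (uminus :: int^('n + 'n) \<Rightarrow> _)" by (rule bij_uminus)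
  have cs': "(\<lambda>\<kappa>. norm (fourier ?f (int_vec \<kappa>))) summable_on UNIV"
  proof -
    have "(\<lambda>\<kappa>. norm (?c (- \<kappa>))) summable_on UNIV"
      using summable_on_reindex_bij_betw[of uminus UNIV UNIV "\<lambda>\<kappa>. norm (?c \<kappa>)"] bij cs by simp
    then have "(\<lambda>\<kappa>. norm (?c (- \<kappa>)) * (1 / \<bar>det L\<bar>)) summable_on UNIV" by (rule summable_on_cmult_left)
    then show ?thesis unfolding ft by (simp add: norm_divide)
  qed
  have "((\<lambda>\<kappa>. ?f (int_vec \<kappa>)) has_sum (\<Sum>\<^sub>\<infinity>\<kappa>. fourier ?f (int_vec \<kappa>))) UNIV"
    by (rule poisson_summation[OF fc M sM cs'])
  then have "((\<lambda>\<kappa>. ?f (int_vec (- \<kappa>))) has_sum (\<Sum>\<^sub>\<infinity>\<kappa>. fourier ?f (int_vec \<kappa>))) UNIV"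
    using has_sum_reindex_bij_betw[of uminus UNIV UNIV "\<lambda>\<kappa>. ?f (int_vec \<kappa>)"] bij by simp
  also have "(\<Sum>\<^sub>\<infinity>\<kappa>. fourier ?f (int_vec \<kappa>)) = (\<Sum>\<^sub>\<infinity>\<kappa>. ?c \<kappa> / \<bar>det L\<bar>)"
    unfolding ft using infsum_reindex_bij_betw[of uminus UNIV UNIV "\<lambda>\<kappa>. ?c \<kappa> / \<bar>det L\<bar>"] bij by simp
  also have "\<dots> = (\<Sum>\<^sub>\<infinity>\<kappa>. ?c \<kappa>) / \<bar>det L\<bar>"
    unfolding divide_inverse by (intro infsum_cmult_left abs_summable_summable[OF cs])
  also have "(\<lambda>\<kappa>. ?f (int_vec (- \<kappa>))) = (\<lambda>\<kappa>. L2_inner u (tf_shift (- (L *v int_vec \<kappa>)) (inverse_fourier h)) * regular_distribution (tf_shift (- (L *v int_vec \<kappa>)) \<gamma>) \<phi>)"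
    by (simp add: gabor_symbol_def L2_inner_tf_shift regular_distribution_tf_shift \<phi> int_vec_simps matrix_vector_mult_uminus)
  finally show ?thesis .
qed

end

section \<open>Complex-linear operators\<close>

lemma scaleC_simps:
  fixes x :: "'x::complex_banach"
  shows "scaleC c 0 = (0::'x)" "scaleC 1 x = x" "scaleC c (r *\<^sub>R x) = r *\<^sub>R scaleC c x"
    "scaleC c (x - y) = scaleC c x - scaleC c y"
proof -
  show z: "scaleC c 0 = (0::'x)" using scaleC_add_right[of c "0::'x" 0] by simp
  show "scaleC 1 x = x" using scaleC_of_real[of 1 x] by simp
  show "scaleC c (r *\<^sub>R x) = r *\<^sub>R scaleC c x" by (simp add: scaleC_of_real[symmetric] scaleC_scaleC mult.commute)
  have "scaleC c (x - y) + scaleC c y = scaleC c x" by (simp add: scaleC_add_right[symmetric])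
  then show "scaleC c (x - y) = scaleC c x - scaleC c y" by (simp add: eq_diff_eq)
qed

lemma bounded_linear_scaleC: "bounded_linear (scaleC c :: 'x::complex_banach \<Rightarrow> 'x)"
  by (rule bounded_linear_intro[where K="cmod c"]) (simp_all add: scaleC_add_right scaleC_simps norm_scaleC mult.commute)

lemma bounded_ops_infsum:
  fixes T :: "'k \<Rightarrow> 'x::complex_banach \<Rightarrow>\<^sub>L 'x"
  assumes T: "\<And>k. T k \<in> bounded_ops" and S: "(T has_sum R) A"
  shows "R \<in> bounded_ops"
proof -
  have ev: "((\<lambda>k. T k u) has_sum R u) A" for u
    by (rule has_sum_bounded_linear[OF blinfun.bounded_linear_left S])
  have "R (scaleC c u) = scaleC c (R u)" for c u
  proof (rule has_sum_unique[OF ev])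
    have "((\<lambda>k. scaleC c (T k u)) has_sum scaleC c (R u)) A"
      by (rule has_sum_bounded_linear[OF bounded_linear_scaleC ev])
    then show "((\<lambda>k. T k (scaleC c u)) has_sum scaleC c (R u)) A" using T by (simp add: bounded_ops_def)
  qed
  then show ?thesis by (simp add: bounded_ops_def)
qed

text \<open>The equation \<open>T u = y\<close> is a fixed point equation for the contraction \<open>u \<mapsto> (y - R u) / c\<close>, and the lower bound
\<open>(\<bar>c\<bar> - norm R) * norm u \<le> norm (T u)\<close> gives injectivity and the norm of the inverse.\<close>

lemma invertible_small_perturbation:
  fixes R T :: "'x::complex_banach \<Rightarrow>\<^sub>L 'x"
  assumes R: "R \<in> bounded_ops" and small: "norm R < cmod c" and T: "\<And>u. T u = scaleC c u + R u"
  obtains B where "B \<in> bounded_ops" "T o\<^sub>L B = id_blinfun" "B o\<^sub>L T = id_blinfun" "norm B \<le> 1 / (cmod c - norm R)"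
proof -
  let ?d = "cmod c - norm R"
  have c: "0 < cmod c" "c \<noteq> 0" and d: "0 < ?d" using small norm_ge_zero[of R] by auto
  have Tlin: "T (scaleC b u) = scaleC b (T u)" for b u
    using R by (simp add: T bounded_ops_def scaleC_add_right scaleC_scaleC mult.commute)
  have lower: "?d * norm u \<le> norm (T u)" for u
  proof -
    have "norm (scaleC c u) \<le> norm (T u) + norm (R u)"
      using norm_triangle_ineq4[of "T u" "R u"] by (simp add: T)
    then have "cmod c * norm u \<le> norm (T u) + norm R * norm u"
      using norm_blinfun[of R u] by (simp add: norm_scaleC)
    then show ?thesis by (simp add: algebra_simps)
  qed
  have inj: "u = w" if "T u = T w" for u w
  proof -
    have "?d * norm (u - w) \<le> 0" using lower[of "u - w"] that by (simp add: blinfun.diff_right)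
    then show ?thesis using d by (simp add: mult_le_0_iff)
  qed
  have ex: "\<exists>u. T u = y" for y
  proof -
    let ?F = "\<lambda>u. scaleC (1 / c) (y - R u)"
    have "\<exists>!u. ?F u = u"
    proof (rule banach_fix_type[where c="norm R / cmod c"])
      show "0 \<le> norm R / cmod c" "norm R / cmod c < 1" using small c by auto
      show "\<forall>u w. dist (?F u) (?F w) \<le> norm R / cmod c * dist u w"
      proof (intro allI)
        fix u w
        have "?F u - ?F w = scaleC (1 / c) (R (w - u))" by (simp add: scaleC_simps(4)[symmetric] blinfun.diff_right)
        then have "dist (?F u) (?F w) = norm (R (w - u)) / cmod c" by (simp add: dist_norm norm_scaleC norm_divide)
        also have "\<dots> \<le> norm R * norm (w - u) / cmod c" by (intro divide_right_mono norm_blinfun) simp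
        finally show "dist (?F u) (?F w) \<le> norm R / cmod c * dist u w" by (simp add: dist_norm norm_minus_commute)
      qed
    qed
    then obtain u where "?F u = u" by blast
    then have "scaleC c u = y - R u" using c by (metis scaleC_scaleC nonzero_eq_divide_eq mult.commute scaleC_simps(2))
    then show ?thesis by (auto simp: T intro!: exI[of _ u])
  qed
  define S where "S y = (THE u. T u = y)" for y
  have TS: "T (S y) = y" for y
    unfolding S_def by (rule theI') (use ex inj in metis)
  have ST: "S (T u) = u" for u by (rule inj) (rule TS)
  have Snorm: "norm (S y) \<le> norm y * (1 / ?d)" for y
    using lower[of "S y"] d by (simp add: TS field_simps)
  have Slin: "bounded_linear S"
  proof (rule bounded_linear_intro[OF _ _ Snorm])
    show "S (x + y) = S x + S y" for x y by (rule inj) (simp add: blinfun.add_right TS)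
    show "S (r *\<^sub>R x) = r *\<^sub>R S x" for r x by (rule inj) (simp add: blinfun.scaleR_right TS)
  qed
  note SB = bounded_linear_Blinfun_apply[OF Slin]
  show thesis
  proof (rule that[of "Blinfun S"])
    have "S (scaleC b y) = scaleC b (S y)" for b y by (rule inj) (simp add: Tlin TS)
    then show "Blinfun S \<in> bounded_ops" by (simp add: bounded_ops_def SB)
    show "T o\<^sub>L Blinfun S = id_blinfun" "Blinfun S o\<^sub>L T = id_blinfun"
      by (auto intro!: blinfun_eqI simp: SB TS ST)
    show "norm (Blinfun S) \<le> 1 / ?d"
      by (rule norm_blinfun_bound) (use d Snorm in \<open>auto simp: SB mult.commute\<close>)
  qed
qed

section \<open>Time-frequency shifts as operators\<close>

lemma regular_distribution_shifted_test_function: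
  assumes u: "u \<in> schwartz" and \<phi>: "\<phi> \<in> schwartz"
  shows "tf_shift_distribution z (regular_distribution u) \<phi> = (LINT t|lborel. tf_shift z u t * \<phi> t)"
proof -
  note [measurable] = schwartz_measurable[OF u] schwartz_measurable[OF \<phi>]
  let ?k = "\<lambda>t. tf_shift z u t * \<phi> t"
  have [measurable]: "tf_shift z u \<in> borel_measurable borel"
    unfolding tf_shift_def modulation_def translation_def by measurable
  have "translation (- pos z) (modulation (freq z) \<phi>) \<in> schwartz" by (intro schwartz_translation schwartz_modulation \<phi>)
  then have "tf_shift_distribution z (regular_distribution u) \<phi> = (LINT t|lebesgue. ?k (t + pos z))"
    by (simp add: tf_shift_distribution_def regular_distribution_def tf_shift_def translation_def modulation_def ac_simps)
  also have "\<dots> = (LINT t|lborel. ?k (t + pos z))" by (rule integral_lebesgue_lborel) measurable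
  also have "\<dots> = (LINT t|lborel. ?k t)" by (rule integral_shift) measurable
  finally show ?thesis .
qed

lemma banach_between_simps:
  assumes "banach_between \<iota>"
  shows "\<iota> (scaleC a u + scaleC b w) \<phi> = a * \<iota> u \<phi> + b * \<iota> w \<phi>"
    and "inj \<iota>" and "\<phi> \<notin> schwartz \<Longrightarrow> \<iota> u \<phi> = 0"
    and "f \<in> schwartz \<Longrightarrow> \<iota> (schwartz_incl \<iota> f) = regular_distribution f"
    and "continuous_on UNIV (\<lambda>u. \<iota> u \<phi>)"
    and "closure (schwartz_incl \<iota> ` schwartz) = UNIV"
proof -
  show "\<iota> (scaleC a u + scaleC b w) \<phi> = a * \<iota> u \<phi> + b * \<iota> w \<phi>" and "inj \<iota>" and "closure (schwartz_incl \<iota> ` schwartz) = UNIV"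
    using assms unfolding banach_between_def by blast+
  have "\<iota> u \<in> tempered_distributions" using assms unfolding banach_between_def by blast
  then show "\<phi> \<notin> schwartz \<Longrightarrow> \<iota> u \<phi> = 0" unfolding tempered_distributions_def by blast
  have "regular_distribution ` schwartz \<subseteq> range \<iota>" using assms unfolding banach_between_def by blast
  then show "f \<in> schwartz \<Longrightarrow> \<iota> (schwartz_incl \<iota> f) = regular_distribution f"
    unfolding schwartz_incl_def by (intro f_inv_into_f) blast
  have "continuous_on UNIV \<iota>" using assms unfolding banach_between_def by blast
  then show "continuous_on UNIV (\<lambda>u. \<iota> u \<phi>)" by (rule continuous_on_product_then_coordinatewise)
qed

lemma banach_between_linear:
  assumes "banach_between \<iota>"
  shows "\<iota> (u + w) \<phi> = \<iota> u \<phi> + \<iota> w \<phi>" "\<iota> (scaleC a u) \<phi> = a * \<iota> u \<phi>" "\<iota> (r *\<^sub>R u) \<phi> = r * \<iota> u \<phi>" "\<iota> 0 \<phi> = 0"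
proof -
  note L = banach_between_simps(1)[OF assms]
  show "\<iota> (u + w) \<phi> = \<iota> u \<phi> + \<iota> w \<phi>" using L[of 1 u 1 w \<phi>] by (simp add: scaleC_simps)
  have z: "scaleC 0 u = 0" for u using scaleC_of_real[of 0 u] by simp
  show s: "\<iota> (scaleC a u) \<phi> = a * \<iota> u \<phi>" for a u using L[of a u 0 u \<phi>] by (simp add: z)
  show "\<iota> (r *\<^sub>R u) \<phi> = r * \<iota> u \<phi>" using s[of "of_real r" u] by (simp add: scaleC_of_real)
  show "\<iota> 0 \<phi> = 0" using s[of 0 u] by (simp add: z)
qed

text \<open>The element of \<open>X\<close> that represents the shifted distribution is unique because \<open>\<iota>\<close> is injective. Hence it depends
linearly on \<open>u\<close>, over the complex numbers.\<close>

lemma tf_shift_operator: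
  fixes \<iota> :: "'x::complex_banach \<Rightarrow> ('n::finite) functional"
  assumes tf: "tf_invariant_with \<iota> v C"
  obtains P where "P \<in> bounded_ops" "\<And>u. \<iota> (blinfun_apply P u) = tf_shift_distribution z (\<iota> u)" "norm P \<le> C * v z"
proof -
  have bb: "banach_between \<iota>" and C: "0 < C" and v: "polynomial_weight v"
    and ex: "\<And>u. \<exists>w. \<iota> w = tf_shift_distribution z (\<iota> u) \<and> norm w \<le> C * v z * norm u"
    using tf unfolding tf_invariant_with_def by blast+
  obtain f where f: "\<And>u. \<iota> (f u) = tf_shift_distribution z (\<iota> u)" "\<And>u. norm (f u) \<le> C * v z * norm u"
    using ex by metis
  have inj: "u = w" if "\<And>\<phi>. \<iota> u \<phi> = \<iota> w \<phi>" for u w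
    using banach_between_simps(2)[OF bb] that by (metis ext injD)
  note lin = banach_between_linear[OF bb]
  have fbl: "bounded_linear f"
  proof (rule bounded_linear_intro)
    show "f (x + y) = f x + f y" for x y by (rule inj) (simp add: f lin tf_shift_distribution_def)
    show "f (r *\<^sub>R x) = r *\<^sub>R f x" for r x by (rule inj) (simp add: f lin tf_shift_distribution_def)
    show "norm (f x) \<le> norm x * (C * v z)" for x using f(2)[of x] by (simp add: mult.commute)
  qed
  have fC: "f (scaleC a x) = scaleC a (f x)" for a x by (rule inj) (simp add: f lin tf_shift_distribution_def)
  have "0 \<le> v z" using v unfolding polynomial_weight_def by auto
  note Bf = bounded_linear_Blinfun_apply[OF fbl]
  show thesis
  proof (rule that[of "Blinfun f"])
    show "Blinfun f \<in> bounded_ops" by (simp add: bounded_ops_def Bf fC)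
    show "\<iota> (Blinfun f u) = tf_shift_distribution z (\<iota> u)" for u by (simp add: Bf f)
    show "norm (Blinfun f) \<le> C * v z"
      by (rule norm_blinfun_bound) (use C \<open>0 \<le> v z\<close> f(2) in \<open>auto simp: Bf\<close>)
  qed
qed

text \<open>The series determines the operator on Schwartz functions, which are dense in \<open>X\<close>.\<close>

lemma gabor_extension_unique:
  assumes bb: "banach_between \<iota>" and A: "is_gabor_extension \<iota> L g \<gamma> A" and A': "is_gabor_extension \<iota> L g \<gamma> A'"
  shows "A = A'"
proof -
  have eq: "A (schwartz_incl \<iota> u) = A' (schwartz_incl \<iota> u)" if u: "u \<in> schwartz" for u
  proof -
    have "\<iota> (A (schwartz_incl \<iota> u)) \<phi> = \<iota> (A' (schwartz_incl \<iota> u)) \<phi>" for \<phi>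
    proof (cases "\<phi> \<in> schwartz")
      case True
      then show ?thesis
        using A A' u unfolding is_gabor_extension_def by (blast intro: has_sum_unique)
    qed (simp add: banach_between_simps(3)[OF bb])
    then show ?thesis using banach_between_simps(2)[OF bb] by (metis ext injD)
  qed
  have "closed {x. A x = A' x}" by (intro closed_Collect_eq continuous_intros)
  moreover have "schwartz_incl \<iota> ` schwartz \<subseteq> {x. A x = A' x}" using eq by blast
  ultimately have "closure (schwartz_incl \<iota> ` schwartz) \<subseteq> {x. A x = A' x}" by (rule closure_minimal[rotated])
  then show ?thesis using banach_between_simps(6)[OF bb] by (intro blinfun_eqI) blast
qed

section \<open>Passing to almost everywhere equal windows\<close>

lemma AE_lborel_translate:
  fixes a :: "'a::euclidean_space"
  assumes "AE x in lborel. P x"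
  shows "AE x in lborel. P (x - a)"
proof -
  have "AE x in distr lborel borel ((+) (- a)). P x" unfolding lborel_distr_plus by (rule assms)
  then have "AE x in lborel. P (- a + x)" by (rule AE_distrD[rotated]) simp
  then show ?thesis by simp
qed

lemma lebesgue_measurable_translate:
  fixes f :: "'a::euclidean_space \<Rightarrow> 'b::topological_space"
  assumes "f \<in> borel_measurable lebesgue"
  shows "(\<lambda>x. f (x - a)) \<in> borel_measurable lebesgue"
proof -
  have "(\<lambda>x. (- a) + (\<Sum>j\<in>Basis. (1 * (x \<bullet> j)) *\<^sub>R j)) \<in> lebesgue \<rightarrow>\<^sub>M lebesgue"
    by (rule lebesgue_affine_measurable) simp
  then have "(\<lambda>x. x - a) \<in> lebesgue \<rightarrow>\<^sub>M lebesgue" by (simp add: euclidean_representation)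
  then show ?thesis by (rule measurable_compose) (rule assms)
qed

text \<open>The hypotheses concern Lebesgue measurable windows, while Fubini's theorem was used for Borel functions. The
integrals that enter the Gabor operator do not distinguish windows that agree almost everywhere.\<close>

lemma STFT_AE_cong:
  fixes g g' \<gamma> \<gamma>' :: "real^'n::finite \<Rightarrow> complex"
  assumes "g \<in> borel_measurable lebesgue" "\<gamma> \<in> borel_measurable lebesgue"
    and [measurable]: "g' \<in> borel_measurable borel" "\<gamma>' \<in> borel_measurable borel"
    and "AE x in lborel. g x = g' x" "AE x in lborel. \<gamma> x = \<gamma>' x"
  shows "STFT g \<gamma> z = STFT g' \<gamma>' z"
proof -
  have m: "(\<lambda>t. g (t - pos z)) \<in> borel_measurable lebesgue" by (rule lebesgue_measurable_translate) fact
  have [measurable]: "(\<lambda>t. cis (- 2 * pi * (freq z \<bullet> t))) \<in> borel_measurable lebesgue"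
    by (intro measurable_completion) measurable
  note [measurable] = m assms(2)
  have "STFT g \<gamma> z = (LINT t|lborel. \<gamma>' t * cis (- 2 * pi * (freq z \<bullet> t)) * cnj (g' (t - pos z)))"
    unfolding STFT_def
  proof (rule lebesgue_integral_AE_eq(1))
    show "AE t in lborel. \<gamma> t * cis (- 2 * pi * (freq z \<bullet> t)) * cnj (g (t - pos z)) = \<gamma>' t * cis (- 2 * pi * (freq z \<bullet> t)) * cnj (g' (t - pos z))"
      using assms(6) AE_lborel_translate[OF assms(5), of "pos z"] by eventually_elim simp
  qed measurable
  then show ?thesis by (simp add: STFT_lborel)
qed

lemma regular_distribution_AE_cong:
  fixes \<gamma> \<gamma>' :: "real^'n::finite \<Rightarrow> complex"
  assumes \<gamma>: "\<gamma> \<in> borel_measurable lebesgue" and [measurable]: "\<gamma>' \<in> borel_measurable borel"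
    and ae: "AE x in lborel. \<gamma> x = \<gamma>' x"
  shows "regular_distribution (tf_shift z \<gamma>) \<phi> = regular_distribution (tf_shift z \<gamma>') \<phi>"
proof (cases "\<phi> \<in> schwartz")
  case \<phi>: True
  note [measurable] = schwartz_measurable[OF \<phi>]
  have [measurable]: "\<phi> \<in> borel_measurable lebesgue" "(\<lambda>t. cis (2 * pi * (freq z \<bullet> t))) \<in> borel_measurable lebesgue"
    by (intro measurable_completion, measurable)+
  note [measurable] = lebesgue_measurable_translate[OF \<gamma>, of "pos z"]
  have *: "(LINT t|lebesgue. tf_shift z \<gamma> t * \<phi> t) = (LINT t|lborel. tf_shift z \<gamma>' t * \<phi> t)"
    unfolding tf_shift_def modulation_def translation_def
  proof (rule lebesgue_integral_AE_eq(1))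
    show "AE t in lborel. cis (2 * pi * (freq z \<bullet> t)) * \<gamma> (t - pos z) * \<phi> t = cis (2 * pi * (freq z \<bullet> t)) * \<gamma>' (t - pos z) * \<phi> t"
      using AE_lborel_translate[OF ae, of "pos z"] by eventually_elim simp
  qed measurable
  have [measurable]: "tf_shift z \<gamma>' \<in> borel_measurable borel"
    unfolding tf_shift_def modulation_def translation_def by measurable
  show ?thesis using \<phi> * by (simp add: regular_distribution_def integral_lebesgue_lborel)
qed (simp add: regular_distribution_def)

lemma polynomial_weight_ge_1:
  assumes "polynomial_weight v"
  shows "1 \<le> v z" and "v 0 = 1"
  using assms unfolding polynomial_weight_def by (auto intro!: ge_one_powr_ge_zero)

section \<open>Invertibility of the Gabor operator\<close>

theorem proposition4p4:
  fixes \<iota> :: "'x::complex_banach \<Rightarrow> ('n::finite) functional"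
    and v :: "real^('n + 'n) \<Rightarrow> real" and C :: real
    and g \<gamma> :: "real^'n \<Rightarrow> complex"
    and L :: "real^('n + 'n)^('n + 'n)"
  assumes "tf_invariant_with \<iota> v C"
    and "g \<in> borel_measurable lebesgue" and "\<gamma> \<in> borel_measurable lebesgue"
    and "integrable lebesgue \<gamma>"
    and "fourier_in_L1 g"
    and "L2_inner \<gamma> g \<noteq> 0"
    and "invertible L"
    and "(\<lambda>\<kappa>. v (adjoint_lattice_point L \<kappa>) * cmod (STFT g \<gamma> (adjoint_lattice_point L \<kappa>)))
           summable_on (UNIV - {0})"
    and "(\<Sum>\<^sub>\<infinity>\<kappa>\<in>UNIV - {0}.
            v (adjoint_lattice_point L \<kappa>) * cmod (STFT g \<gamma> (adjoint_lattice_point L \<kappa>)))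
         < 1 / C * cmod (L2_inner \<gamma> g)"
  shows "(\<exists>!A. is_gabor_extension \<iota> L g \<gamma> A) \<and>
         (\<exists>B\<in>bounded_ops.
            gabor_operator \<iota> L g \<gamma> o\<^sub>L B = id_blinfun \<and>
            B o\<^sub>L gabor_operator \<iota> L g \<gamma> = id_blinfun \<and>
            norm B \<le> \<bar>det L\<bar> / ((1 + C) * cmod (L2_inner \<gamma> g) - C *
                (\<Sum>\<^sub>\<infinity>\<kappa>.
                   v (adjoint_lattice_point L \<kappa>) * cmod (STFT g \<gamma> (adjoint_lattice_point L \<kappa>)))))"
proof -
  let ?l = "adjoint_lattice_point L"
  let ?c = "\<lambda>\<kappa>. STFT g \<gamma> (?l \<kappa>)"
  let ?m = "\<lambda>\<kappa>. v (?l \<kappa>) * cmod (?c \<kappa>)"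
  let ?s = "cmod (L2_inner \<gamma> g)" and ?\<sigma> = "\<Sum>\<^sub>\<infinity>\<kappa>\<in>UNIV - {0}. ?m \<kappa>"
  have bb: "banach_between \<iota>" and C: "0 < C" and v: "polynomial_weight v"
    using assms(1) unfolding tf_invariant_with_def by blast+
  note v1 = polynomial_weight_ge_1[OF v]
  have dL: "det L \<noteq> 0" using assms(7) by (simp add: invertible_det_nz)
  obtain h where h: "integrable lborel h" and h_ae: "AE t in lborel. g t = inverse_fourier h t"
    by (rule fourier_in_L1_representation[OF assms(2,5)])
  obtain \<gamma>' where \<gamma>': "\<gamma>' \<in> borel_measurable borel" and \<gamma>'_ae: "AE t in lborel. \<gamma> t = \<gamma>' t"
    by (rule lebesgue_borel_representative[OF assms(3)])
  have \<gamma>'_int: "integrable lborel \<gamma>'"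
    using lebesgue_integral_AE_eq(2)[OF assms(3) \<gamma>' \<gamma>'_ae] assms(4) by simp
  have stft_eq: "STFT g \<gamma> z = STFT (inverse_fourier h) \<gamma>' z" for z
    by (rule STFT_AE_cong[OF assms(2,3) measurable_inverse_fourier[OF h] \<gamma>' h_ae \<gamma>'_ae])
  have l0: "?l 0 = 0" by (simp add: adjoint_lattice_point_def int_vec_simps)
  have c0: "?c 0 = L2_inner \<gamma> g"
    by (simp add: l0 STFT_def L2_inner_def pos_def freq_def zero_vec_def[symmetric])
  have m0: "?m 0 = ?s" by (simp add: l0 v1) (simp add: c0[unfolded l0])
  have sumI: "?m summable_on UNIV"
    using summable_on_Un_disjoint[of ?m "{0}" "UNIV - {0}"] assms(8) by simp
  have total: "(\<Sum>\<^sub>\<infinity>\<kappa>. ?m \<kappa>) = ?s + ?\<sigma>"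
    using infsum_Un_disjoint[of ?m "{0}" "UNIV - {0}"] assms(8) m0 by simp
  have csum: "(\<lambda>\<kappa>. norm (?c \<kappa>)) summable_on UNIV"
  proof (rule Infinite_Sum.abs_summable_on_comparison_test'[OF sumI])
    show "norm (?c \<kappa>) \<le> ?m \<kappa>" for \<kappa> using mult_right_mono[OF v1(1)[of "?l \<kappa>"], of "cmod (?c \<kappa>)"] by simp
  qed
  obtain P where P: "\<And>z. P z \<in> bounded_ops" "\<And>z u. \<iota> (blinfun_apply (P z) u) = tf_shift_distribution z (\<iota> u)"
      "\<And>z. norm (P z) \<le> C * v z"
  proof -
    have "\<forall>z. \<exists>Q. Q \<in> bounded_ops \<and> (\<forall>u. \<iota> (blinfun_apply Q u) = tf_shift_distribution z (\<iota> u)) \<and> norm Q \<le> C * v z"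
    proof
      fix z
      show "\<exists>Q. Q \<in> bounded_ops \<and> (\<forall>u. \<iota> (blinfun_apply Q u) = tf_shift_distribution z (\<iota> u)) \<and> norm Q \<le> C * v z"
        by (rule tf_shift_operator[OF assms(1), of z]) blast
    qed
    from choice[OF this] show thesis using that by blast
  qed
  have inj: "u = w" if "\<And>\<phi>. \<iota> u \<phi> = \<iota> w \<phi>" for u w
    using banach_between_simps(2)[OF bb] that by (metis ext injD)
  note lin = banach_between_linear[OF bb]
  define T where "T \<kappa> = Blinfun (scaleC (?c \<kappa>)) o\<^sub>L P (?l \<kappa>)" for \<kappa>
  have T_apply: "T \<kappa> u = scaleC (?c \<kappa>) (P (?l \<kappa>) u)" for \<kappa> u
    by (simp add: T_def bounded_linear_Blinfun_apply[OF bounded_linear_scaleC])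
  have T_ops: "T \<kappa> \<in> bounded_ops" for \<kappa>
    using P(1)[of "?l \<kappa>"] by (simp add: bounded_ops_def T_apply scaleC_scaleC mult.commute)
  have T_norm: "norm (T \<kappa>) \<le> C * ?m \<kappa>" for \<kappa>
  proof (rule norm_blinfun_bound)
    show "0 \<le> C * ?m \<kappa>" using C v1(1)[of "?l \<kappa>"] by (intro mult_nonneg_nonneg) auto
    fix u
    have "norm (T \<kappa> u) \<le> cmod (?c \<kappa>) * (norm (P (?l \<kappa>)) * norm u)"
      unfolding T_apply norm_scaleC by (intro mult_left_mono norm_blinfun) auto
    also have "\<dots> \<le> cmod (?c \<kappa>) * (C * v (?l \<kappa>) * norm u)" by (intro mult_left_mono mult_right_mono P) auto
    finally show "norm (T \<kappa> u) \<le> C * ?m \<kappa> * norm u" by (simp add: ac_simps)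
  qed
  have T0: "T 0 u = scaleC (L2_inner \<gamma> g) u" for u
  proof -
    have "P (?l 0) u = u"
    proof (rule inj)
      fix \<phi> :: "real^'n \<Rightarrow> complex"
      have "translation (- pos 0) (modulation (freq 0) \<phi>) = \<phi>"
        by (simp add: translation_def modulation_def pos_def freq_def zero_vec_def[symmetric])
      then show "\<iota> (P (?l 0) u) \<phi> = \<iota> u \<phi>" unfolding l0 P(2) by (simp add: tf_shift_distribution_def)
    qed
    then show ?thesis by (simp add: T_apply c0)
  qed
  have Tsum: "(\<lambda>\<kappa>. norm (T \<kappa>)) summable_on UNIV" and Tsum': "(\<lambda>\<kappa>. norm (T \<kappa>)) summable_on (UNIV - {0})"
    by (rule Infinite_Sum.abs_summable_on_comparison_test'[OF summable_on_cmult_right[OF sumI] T_norm])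
      (rule Infinite_Sum.abs_summable_on_comparison_test'[OF summable_on_cmult_right[OF assms(8)] T_norm])
  define S where "S = (\<Sum>\<^sub>\<infinity>\<kappa>. T \<kappa>)"
  define R where "R = (\<Sum>\<^sub>\<infinity>\<kappa>\<in>UNIV - {0}. T \<kappa>)"
  have S: "(T has_sum S) UNIV" unfolding S_def by (rule has_sum_infsum[OF abs_summable_summable[OF Tsum]])
  have R: "(T has_sum R) (UNIV - {0})" unfolding R_def by (rule has_sum_infsum[OF abs_summable_summable[OF Tsum']])
  have SR: "S = T 0 + R"
    unfolding S_def R_def using infsum_Un_disjoint[of T "{0}" "UNIV - {0}"] abs_summable_summable[OF Tsum'] by simp
  have S_apply: "S u = scaleC (L2_inner \<gamma> g) u + R u" for u by (simp add: SR blinfun.add_left T0)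
  have R_norm: "norm R \<le> C * ?\<sigma>"
  proof -
    have "norm R \<le> (\<Sum>\<^sub>\<infinity>\<kappa>\<in>UNIV - {0}. norm (T \<kappa>))" unfolding R_def by (rule norm_infsum_bound[OF Tsum'])
    also have "\<dots> \<le> (\<Sum>\<^sub>\<infinity>\<kappa>\<in>UNIV - {0}. C * ?m \<kappa>)"
      by (intro infsum_mono Tsum' summable_on_cmult_right assms(8) T_norm)
    also have "\<dots> = C * ?\<sigma>" by (intro infsum_cmult_right assms(8))
    finally show ?thesis .
  qed
  have C\<sigma>: "C * ?\<sigma> < ?s" using assms(9) C by (simp add: field_simps)
  have R_ops: "R \<in> bounded_ops" and S_ops: "S \<in> bounded_ops"
    by (rule bounded_ops_infsum[OF T_ops R], rule bounded_ops_infsum[OF T_ops S])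
  \<comment> \<open>By Janssen's identity this is the Gabor operator; existence of a bounded extension is thereby shown as well.\<close>
  define A where "A = (1 / \<bar>det L\<bar>) *\<^sub>R S"
  have A: "is_gabor_extension \<iota> L g \<gamma> A"
    unfolding is_gabor_extension_def
  proof (intro conjI ballI)
    show "A \<in> bounded_ops" using S_ops by (simp add: A_def bounded_ops_def blinfun.scaleR_left scaleC_simps)
    fix u \<phi> :: "real^'n \<Rightarrow> complex" assume u: "u \<in> schwartz" and \<phi>: "\<phi> \<in> schwartz"
    let ?u = "schwartz_incl \<iota> u"
    let ?p = "\<lambda>\<kappa>. LINT t|lborel. tf_shift (?l \<kappa>) u t * \<phi> t"
    have ev: "((\<lambda>\<kappa>. T \<kappa> ?u) has_sum S ?u) UNIV"
      by (rule has_sum_bounded_linear[OF blinfun.bounded_linear_left S])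
    have "(((\<lambda>w. \<iota> w \<phi>) \<circ> (\<lambda>\<kappa>. T \<kappa> ?u)) has_sum \<iota> (S ?u) \<phi>) UNIV"
    proof (rule has_sum_comm_additive_general[OF _ _ ev])
      show "sum ((\<lambda>w. \<iota> w \<phi>) \<circ> (\<lambda>\<kappa>. T \<kappa> ?u)) F = \<iota> (\<Sum>\<kappa>\<in>F. T \<kappa> ?u) \<phi>" if "finite F" for F
        using that by induction (simp_all add: lin)
      show "((\<lambda>w. \<iota> w \<phi>) \<longlongrightarrow> \<iota> (S ?u) \<phi>) (at (S ?u))"
        using banach_between_simps(5)[OF bb, of \<phi>] by (simp add: continuous_on_eq_continuous_at isCont_def)
    qed
    moreover have "\<iota> (T \<kappa> ?u) \<phi> = ?c \<kappa> * ?p \<kappa>" for \<kappa>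
      by (simp add: T_apply lin P(2) banach_between_simps(4)[OF bb u] regular_distribution_shifted_test_function[OF u \<phi>])
    ultimately have "((\<lambda>\<kappa>. ?c \<kappa> * ?p \<kappa>) has_sum \<iota> (S ?u) \<phi>) UNIV" by (simp add: o_def)
    then have "(\<Sum>\<^sub>\<infinity>\<kappa>. ?c \<kappa> * ?p \<kappa>) / \<bar>det L\<bar> = \<iota> (A ?u) \<phi>"
      by (simp add: infsumI A_def blinfun.scaleR_left lin)
    moreover have "((\<lambda>\<kappa>. L2_inner u (tf_shift (- (L *v int_vec \<kappa>)) g) * regular_distribution (tf_shift (- (L *v int_vec \<kappa>)) \<gamma>) \<phi>)
       has_sum (\<Sum>\<^sub>\<infinity>\<kappa>. ?c \<kappa> * ?p \<kappa>) / \<bar>det L\<bar>) UNIV"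
    proof -
      have "u \<in> borel_measurable lebesgue" using schwartz_measurable[OF u] by (intro measurable_completion) simp
      then have "STFT g u z = STFT (inverse_fourier h) u z" for z
        by (rule STFT_AE_cong[OF assms(2) _ measurable_inverse_fourier[OF h] schwartz_measurable[OF u] h_ae]) simp
      then show ?thesis
        using janssen_representation[OF h \<gamma>'_int u \<phi> assms(7)] csum
        by (simp add: stft_eq L2_inner_tf_shift regular_distribution_AE_cong[OF assms(3) \<gamma>' \<gamma>'_ae])
    qed
    ultimately show "((\<lambda>\<kappa>. L2_inner u (tf_shift (- (L *v int_vec \<kappa>)) g) * regular_distribution (tf_shift (- (L *v int_vec \<kappa>)) \<gamma>) \<phi>)
       has_sum \<iota> (A ?u) \<phi>) UNIV" by simp
  qed
  have uniq: "\<exists>!A. is_gabor_extension \<iota> L g \<gamma> A" using A gabor_extension_unique[OF bb] by blast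
  then have op: "gabor_operator \<iota> L g \<gamma> = A" unfolding gabor_operator_def using A by (rule the1_equality)
  have small: "norm R < ?s" using R_norm C\<sigma> by simp
  obtain B where B: "B \<in> bounded_ops" "S o\<^sub>L B = id_blinfun" "B o\<^sub>L S = id_blinfun" "norm B \<le> 1 / (?s - norm R)"
    by (rule invertible_small_perturbation[OF R_ops small S_apply])
  have "norm (\<bar>det L\<bar> *\<^sub>R B) \<le> \<bar>det L\<bar> / ((1 + C) * ?s - C * (\<Sum>\<^sub>\<infinity>\<kappa>. ?m \<kappa>))"
  proof -
    have "norm B \<le> 1 / (?s - C * ?\<sigma>)"
      using R_norm C\<sigma> by (intro order_trans[OF B(4)] divide_left_mono mult_pos_pos) auto
    then have "\<bar>det L\<bar> * norm B \<le> \<bar>det L\<bar> * (1 / (?s - C * ?\<sigma>))" by (rule mult_left_mono) simp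
    \<comment> \<open>The full sum contains the term for \<open>0\<close>, which is \<open>?s\<close> because \<open>v 0 = 1\<close>.\<close>
    also have "?s - C * ?\<sigma> = (1 + C) * ?s - C * (\<Sum>\<^sub>\<infinity>\<kappa>. ?m \<kappa>)" unfolding total by (simp add: algebra_simps)
    finally show ?thesis by simp
  qed
  moreover have "\<bar>det L\<bar> *\<^sub>R B \<in> bounded_ops" using B(1) by (simp add: bounded_ops_def blinfun.scaleR_left scaleC_simps)
  moreover have "A o\<^sub>L (\<bar>det L\<bar> *\<^sub>R B) = S o\<^sub>L B" "(\<bar>det L\<bar> *\<^sub>R B) o\<^sub>L A = B o\<^sub>L S"
    using dL by (auto intro!: blinfun_eqI simp: A_def blinfun.scaleR_left blinfun.scaleR_right)
  ultimately show ?thesis using uniq B(2,3) unfolding op by (auto intro!: bexI[of _ "\<bar>det L\<bar> *\<^sub>R B"])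
qed

end
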